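(* Let $\Omega=\{M+\mathfrak{i}v\in\mathbb{C}: M\ge-\frac14,\ M\neq0,\ 0\le v<1\}$. Consider the function $\rho$ from $\Omega$ to the set of immersions in $\mathbb{R}^3$ (considered up to rigid motions) given by $$\rho(M+\mathfrak{i}v)=\mathfrak{T}(M,v)\ \text{ for } v>0,\ M\neq-\tfrac14;\qquad \rho(M)=\mathbb{D}(M)\ \text{ for } M\neq0,\ M\neq-\tfrac14;$$ $$\rho(-\tfrac14+\mathfrak{i}v)=\{(x,y,z)\in\mathbb{R}^3:x^2+z^2=\tfrac14\}.$$ Then $\rho$ is continuous in the following sense: for every $p\in\Omega$ there exist a neighborhood $U$ of $p$ in $\Omega$ and a continuous function $f:U\times\mathbb{R}^2\to\mathbb{R}^3$ such that for any $M+\mathfrak{i}v\in U$ the map $(s,t)\mapsto f(M+\mathfrak{i}v,s,t)$ defines a parametrization of the surface $\rho(M+\mathfrak{i}v)$. Moreover, $\rho$ is one-to-one in the interior of $\Omega$.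
   Context: Twizzlers: a Twizzler is an immersion $\phi(s,t)=(x(s)\cos(wt)+z(s)\sin(wt),\,t,\,-x(s)\sin(wt)+z(s)\cos(wt))$, $(s,t)\in\mathbb{R}^2$, of constant mean curvature; $\alpha(s)=(x(s),z(s))$, $s\in\mathbb{R}$, parametrized by arc length, is its profile curve. The mean curvature (half the sum of the principal curvatures) is taken with respect to $\nu=\frac{\phi_s\times\phi_t}{|\phi_s\times\phi_t|}$. Put $\xi_1=xx'+zz'$, $\xi_2=-xz'+zx'$. $\mathfrak{T}(M,v)$, for $M>-\frac14$ and $0<v<1$, denotes the Twizzler (unique up to rigid motions) with mean curvature $1$ and parameter $w=\sqrt{(1-v)/v}$ for which $s\mapsto(\xi_1(s),\xi_2(s))$ traverses the closed curve $h_w^{-1}(M)$, where $h_w(x_1,x_2)=x_1^2+x_2^2+\frac{x_2}{\sqrt{1+w^2x_1^2}}$; that is, $h_w(\xi_1(s),\xi_2(s))=M$ for all $s$. For nonzero $M\in(-\frac14,\infty)$, $\mathbb{D}(M)$ is the Delaunay surface with mean curvature $1$ obtained by rolling the conic $\{(x,y):4x^2-\frac{y^2}{M}=1\}$ without slipping on a line in a plane and rotating about this line the trace of a focus. For $M<0$ (ellipse; one focus used) it is an unduloid. For $M>0$ (hyperbola) both foci are used: as a branch of the hyperbola rolls on the line, the two foci trace two arcs, one on each side of the line; after reflecting one of them in the line and translating along the line, copies of the two arcs alternately fit together into a complete $C^2$ (in fact smooth) periodic profile curve; rotating it about the line gives the nodoid $\mathbb{D}(M)$. Since $\mathfrak{T}(M,v)$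 and $\mathbb{D}(M)$ are determined only up to rigid motions of $\mathbb{R}^3$, a parametrization of $\rho(M+\mathfrak{i}v)$ means a parametrization by $\mathbb{R}^2$ of a representative of this surface, and "one-to-one" means that distinct interior points give surfaces that do not differ by a rigid motion. The surfaces of revolution are parametrized by $\mathbb{R}^2$ as immersed surfaces via their universal covers. *)

theory Defs
  imports "HOL-Analysis.Analysis"
begin

definition C1_map :: "('a::real_normed_vector \<Rightarrow> 'b::real_normed_vector) \<Rightarrow> bool" where
  "C1_map f \<longleftrightarrow> (\<exists>f'. (\<forall>x. (f has_derivative blinfun_apply (f' x)) (at x)) \<and> continuous_on UNIV f')"

definition C2_map :: "('a::real_normed_vector \<Rightarrow> 'b::real_normed_vector) \<Rightarrow> bool" where
  "C2_map f \<longleftrightarrow> (\<exists>f'. (\<forall>x. (f has_derivative blinfun_apply (f' x)) (at x)) \<and> C1_map f')"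

definition C2_diffeo :: "('a::real_normed_vector \<Rightarrow> 'a) \<Rightarrow> bool" where
  "C2_diffeo h \<longleftrightarrow> bij h \<and> C2_map h \<and> C2_map (inv h)"

(* C^2 is the regularity needed to speak of mean curvature. *)
definition immersion :: "(real \<times> real \<Rightarrow> real^3) \<Rightarrow> bool" where
  "immersion \<phi> \<longleftrightarrow> C2_map \<phi> \<and> (\<forall>p. inj (frechet_derivative \<phi> (at p)))"

(* Rigid motions are orientation preserving. *)
definition rigid_motion :: "(real^3 \<Rightarrow> real^3) \<Rightarrow> bool" where
  "rigid_motion R \<longleftrightarrow> (\<exists>Q c. rotation_matrix Q \<and> R = (\<lambda>x. Q *v x + c))"

(* psi parametrizes a surface that differs from the one parametrized by phi by a rigid motion. *)
definition same_surface :: "(real \<times> real \<Rightarrow> real^3) \<Rightarrow> (real \<times> real \<Rightarrow> real^3) \<Rightarrow> bool" where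
  "same_surface \<phi> \<psi> \<longleftrightarrow> (\<exists>R h. rigid_motion R \<and> C2_diffeo h \<and> \<psi> = R \<circ> \<phi> \<circ> h)"

definition partial_s :: "(real \<times> real \<Rightarrow> real^3) \<Rightarrow> real \<times> real \<Rightarrow> real^3" where
  "partial_s \<phi> p = frechet_derivative \<phi> (at p) (1, 0)"

definition partial_t :: "(real \<times> real \<Rightarrow> real^3) \<Rightarrow> real \<times> real \<Rightarrow> real^3" where
  "partial_t \<phi> p = frechet_derivative \<phi> (at p) (0, 1)"

definition unit_normal :: "(real \<times> real \<Rightarrow> real^3) \<Rightarrow> real \<times> real \<Rightarrow> real^3" where
  "unit_normal \<phi> p =
     (let n = cross3 (partial_s \<phi> p) (partial_t \<phi> p) in n /\<^sub>R norm n)"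

(* k1, k2 are the roots, counted with multiplicity, of det (II - k I) = 0, where I and II are the
   first and second fundamental forms.  Sign convention: II is the scalar product of the second
   derivatives with the unit normal, so curvature towards the normal is positive. *)
definition principal_curvatures ::
    "(real \<times> real \<Rightarrow> real^3) \<Rightarrow> real \<times> real \<Rightarrow> real \<Rightarrow> real \<Rightarrow> bool" where
  "principal_curvatures \<phi> p k1 k2 \<longleftrightarrow>
     (let E = partial_s \<phi> p \<bullet> partial_s \<phi> p;
          F = partial_s \<phi> p \<bullet> partial_t \<phi> p;
          G = partial_t \<phi> p \<bullet> partial_t \<phi> p;
          L = partial_s (partial_s \<phi>) p \<bullet> unit_normal \<phi> p;
          M = partial_s (partial_t \<phi>) p \<bullet> unit_normal \<phi> p;
          N = partial_t (partial_t \<phi>) p \<bullet> unit_normal \<phi> p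
      in \<forall>k. (L - k * E) * (N - k * G) - (M - k * F)\<^sup>2 = (E * G - F\<^sup>2) * (k - k1) * (k - k2))"

definition constant_mean_curvature :: "(real \<times> real \<Rightarrow> real^3) \<Rightarrow> real \<Rightarrow> bool" where
  "constant_mean_curvature \<phi> H \<longleftrightarrow>
     (\<forall>p. \<exists>k1 k2. principal_curvatures \<phi> p k1 k2 \<and> (k1 + k2) / 2 = H)"

definition twizzler_map ::
    "real \<Rightarrow> (real \<Rightarrow> real) \<Rightarrow> (real \<Rightarrow> real) \<Rightarrow> real \<times> real \<Rightarrow> real^3" where
  "twizzler_map w x z = (\<lambda>(s, t). vector
     [x s * cos (w * t) + z s * sin (w * t), t, - x s * sin (w * t) + z s * cos (w * t)])"

definition twizzler :: "real \<Rightarrow> real \<Rightarrow> (real \<Rightarrow> real) \<Rightarrow> (real \<Rightarrow> real) \<Rightarrow> bool" where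
  "twizzler H w x z \<longleftrightarrow>
     immersion (twizzler_map w x z) \<and>
     constant_mean_curvature (twizzler_map w x z) H \<and>
     (\<forall>s. (deriv x s)\<^sup>2 + (deriv z s)\<^sup>2 = 1)"

definition xi1 :: "(real \<Rightarrow> real) \<Rightarrow> (real \<Rightarrow> real) \<Rightarrow> real \<Rightarrow> real" where
  "xi1 x z s = x s * deriv x s + z s * deriv z s"

definition xi2 :: "(real \<Rightarrow> real) \<Rightarrow> (real \<Rightarrow> real) \<Rightarrow> real \<Rightarrow> real" where
  "xi2 x z s = - x s * deriv z s + z s * deriv x s"

definition h_fun :: "real \<Rightarrow> real \<Rightarrow> real \<Rightarrow> real" where
  "h_fun w x1 x2 = x1\<^sup>2 + x2\<^sup>2 + x2 / sqrt (1 + w\<^sup>2 * x1\<^sup>2)"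

definition twizzler_surface :: "real \<Rightarrow> real \<Rightarrow> (real \<times> real \<Rightarrow> real^3) set" where
  "twizzler_surface M v =
     (let w = sqrt ((1 - v) / v)
      in {twizzler_map w x z | x z.
            twizzler 1 w x z \<and> (\<forall>s. h_fun w (xi1 x z s) (xi2 x z s) = M)})"

definition conic :: "real \<Rightarrow> complex set" where
  "conic M = {\<zeta>. 4 * (Re \<zeta>)\<^sup>2 - (Im \<zeta>)\<^sup>2 / M = 1}"

(* The semi-axes are 1/2 and sqrt |M|, so the foci are at +focus M and -focus M, both for the
   ellipse (-1/4 < M < 0) and for the hyperbola (M > 0). *)
definition focus :: "real \<Rightarrow> complex" where
  "focus M = complex_of_real (sqrt (1 / 4 + M))"

definition hyperbola_branch :: "real \<Rightarrow> complex set" where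
  "hyperbola_branch M = {\<zeta> \<in> conic M. 0 < Re \<zeta>}"

(* For an ellipse the curve runs around it infinitely often. *)
definition arc_length_param :: "(real \<Rightarrow> complex) \<Rightarrow> complex set \<Rightarrow> bool" where
  "arc_length_param \<gamma> C \<longleftrightarrow>
     C1_map \<gamma> \<and> (\<forall>s. norm (vector_derivative \<gamma> (at s)) = 1) \<and> range \<gamma> = C"

(* Rolling without slipping along the real line: at time s the plane of the conic has been moved by
   the orientation preserving isometry that sends the contact point (gamma s) to s and the unit
   tangent (gamma' s) to 1.  The value is the position of the point P carried along. *)
definition roll :: "(real \<Rightarrow> complex) \<Rightarrow> complex \<Rightarrow> real \<Rightarrow> complex" where
  "roll \<gamma> P s = of_real s + (P - \<gamma> s) * cnj (vector_derivative \<gamma> (at s))"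

definition undulary :: "real \<Rightarrow> (real \<Rightarrow> complex) set" where
  "undulary M = {roll \<gamma> (focus M) | \<gamma>. arc_length_param \<gamma> (conic M)}"

(* One period of the curve consists of the arc traced by one focus on (0, a) and the reflected arc
   traced by the other focus on (a, T), each up to a translation along the line; the regular C^2
   condition fixes in which direction each arc is run through. *)
definition nodary :: "real \<Rightarrow> (real \<Rightarrow> complex) set" where
  "nodary M = {\<beta>. C2_map \<beta> \<and> (\<forall>u. vector_derivative \<beta> (at u) \<noteq> 0) \<and>
     (\<exists>\<gamma> a T d c1 c2 g1 g2.
        arc_length_param \<gamma> (hyperbola_branch M) \<and> 0 < a \<and> a < T \<and>
        (\<forall>u. \<beta> (u + T) = \<beta> u + complex_of_real d) \<and>
        continuous_on {0<..<a} g1 \<and> bij_betw g1 {0<..<a} UNIV \<and>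
        (\<forall>u\<in>{0<..<a}. \<beta> u = roll \<gamma> (focus M) (g1 u) + complex_of_real c1) \<and>
        continuous_on {a<..<T} g2 \<and> bij_betw g2 {a<..<T} UNIV \<and>
        (\<forall>u\<in>{a<..<T}. \<beta> u = cnj (roll \<gamma> (- focus M) (g2 u)) + complex_of_real c2))}"

definition revolve :: "(real \<Rightarrow> complex) \<Rightarrow> real \<times> real \<Rightarrow> real^3" where
  "revolve \<beta> = (\<lambda>(u, \<theta>). vector [Re (\<beta> u), Im (\<beta> u) * cos \<theta>, Im (\<beta> u) * sin \<theta>])"

definition delaunay_surface :: "real \<Rightarrow> (real \<times> real \<Rightarrow> real^3) set" where
  "delaunay_surface M = revolve ` (if M < 0 then undulary M else nodary M)"

(* The parametrizations of the cylinder by its universal cover. *)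
definition cylinder_surface :: "(real \<times> real \<Rightarrow> real^3) set" where
  "cylinder_surface =
     {\<phi>. immersion \<phi> \<and> covering_space UNIV \<phi> {p. (p $ 1)\<^sup>2 + (p $ 3)\<^sup>2 = 1 / 4}}"

definition Omega :: "complex set" where
  "Omega = {p. - 1 / 4 \<le> Re p \<and> Re p \<noteq> 0 \<and> 0 \<le> Im p \<and> Im p < 1}"

(* The immersions representing rho p; the surface itself is determined up to same_surface. *)
definition rho :: "complex \<Rightarrow> (real \<times> real \<Rightarrow> real^3) set" where
  "rho p = (if Re p = - 1 / 4 then cylinder_surface
            else if 0 < Im p then twizzler_surface (Re p) (Im p)
            else delaunay_surface (Re p))"

definition parametrizes :: "(real \<times> real \<Rightarrow> real^3) \<Rightarrow> (real \<times> real \<Rightarrow> real^3) set \<Rightarrow> bool" where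
  "parametrizes \<psi> S \<longleftrightarrow> (\<exists>\<phi>\<in>S. same_surface \<phi> \<psi>)"

end

theory Submission
  imports Defs
begin

text \<open>
  Both statements rest on explicit formulas.  Let \<open>e = sqrt (1 + 4 M)\<close> be the eccentricity of the conic
  belonging to \<open>M\<close>, let \<open>\<epsilon> = 1 / w = sqrt (v / (1 - v))\<close>, and put \<open>\<rho> (u) = (1 + e\<^sup>2 - 2 e cos u) / 4\<close> and
  \<open>P (u) = (1 - e cos u) / 2\<close>, so that \<open>\<rho> - P = M\<close>.  Every surface of the family is parametrized by
  \<open>f (u, \<theta>) = (sqrt \<rho> * cos \<theta>, Y (u) - \<epsilon> * \<theta>, sqrt \<rho> * sin \<theta>)\<close>, where \<open>Y (0) = 0\<close> and \<open>Y\<close> has the derivative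
  \<open>P * sqrt (\<epsilon>\<^sup>2 + \<rho>) / (2 \<rho>)\<close>.
  The right-hand side is continuous in \<open>M\<close>, \<open>v\<close>, \<open>u\<close> and \<open>\<theta>\<close> on all of \<open>Omega\<close>, since \<open>\<rho>\<close> vanishes only
  if \<open>e = 1\<close>, that is \<open>M = 0\<close>.  So \<open>U\<close> can always be \<open>Omega\<close>.

  For \<open>v > 0\<close> this is a Twizzler.  The squared distance from the axis, taken as a function of arc length
  along the orthogonal trajectories of the helices, satisfies a differential equation that does not
  involve \<open>w\<close>; this is why \<open>\<rho>\<close> depends on \<open>e\<close> only and why the remaining data are integrals
  (\<open>twizzler_exists\<close>).  For \<open>v = 0\<close> the formula is the classical one for the meridian of a Delaunay
  surface.  It describes the trace of a focus of a rolling conic: if the conic is written in polar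
  coordinates about the other focus, with polar angle \<open>u\<close>, then the rolled focus has height \<open>sqrt \<rho>\<close> and
  its abscissa has derivative \<open>P / (2 * sqrt \<rho>)\<close> (\<open>roll_focus\<close>, \<open>focus_offset_derivative\<close>).  For a hyperbola
  the same formula serves for both foci, since \<open>u\<close> passes from one branch to the other when \<open>P\<close> changes
  sign (\<open>nodary\<close>).  For \<open>M = -1/4\<close> the functions \<open>\<rho>\<close> and \<open>P\<close> are constant and \<open>f\<close> is a covering of
  the cylinder (\<open>cylinder_parametrized\<close>).

  For the second statement let a Twizzler be given.  Its squared distance from the axis
  is \<open>\<rho>\<close> up to a change of parameter (\<open>twizzler_radius\<close>), so it projects along the axis onto an
  annulus with outer radius \<open>(1 + e) / 2\<close>.  A rigid motion between two Twizzlers has to preserve the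
  direction of the axis, because both surfaces stay near the axis, and it has to match the annuli; so
  it preserves the axis and \<open>e\<close> (\<open>rigid_motion_helix\<close>).  The points at maximal distance form countably
  many helices of pitch determined by \<open>w\<close>, and these cannot be covered by countably many helices of
  another pitch (\<open>helix_pitch_unique\<close>).
\<close>

section \<open>Calculus of twice continuously differentiable maps\<close>

lemma C1_mapI:
  assumes "\<And>x. (f has_derivative blinfun_apply (f' x)) (at x)" "continuous_on UNIV f'"
  shows "C1_map f"
  using assms unfolding C1_map_def by blast

lemma C2_mapI:
  assumes "\<And>x. (f has_derivative blinfun_apply (f' x)) (at x)" "C1_map f'"
  shows "C2_map f"
  using assms unfolding C2_map_def by blast

lemma C1_map_imp_continuous: "C1_map f \<Longrightarrow> continuous_on UNIV f"
  unfolding C1_map_def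
  by (meson UNIV_I has_derivative_continuous continuous_at_imp_continuous_on)

lemma C2_map_imp_C1: "C2_map f \<Longrightarrow> C1_map f"
  unfolding C2_map_def using C1_mapI C1_map_imp_continuous by blast

lemma C2_map_imp_differentiable: "C2_map f \<Longrightarrow> f differentiable at p"
  unfolding C2_map_def differentiable_def by blast

lemma C1_map_bounded_linear:
  assumes "bounded_linear f" shows "C1_map f"
  by (rule C1_mapI[where f' = "\<lambda>_. Blinfun f"])
     (auto simp: bounded_linear_Blinfun_apply assms bounded_linear_imp_has_derivative)

lemma C2_map_bounded_linear:
  assumes "bounded_linear f" shows "C2_map f"
proof (rule C2_mapI[where f' = "\<lambda>_. Blinfun f"])
  show "C1_map (\<lambda>_::'a. Blinfun f)"
    by (rule C1_mapI[where f' = "\<lambda>_. 0"]) (auto simp: zero_blinfun.rep_eq)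
qed (auto simp: bounded_linear_Blinfun_apply assms bounded_linear_imp_has_derivative)

lemma C1_map_const: "C1_map (\<lambda>_. c)"
  by (rule C1_mapI[where f' = "\<lambda>_. 0"]) (auto simp: zero_blinfun.rep_eq)

lemma C2_map_const: "C2_map (\<lambda>_. c)"
  by (rule C2_mapI[where f' = "\<lambda>_. 0"]) (auto simp: zero_blinfun.rep_eq C1_map_const)

lemma C1_map_add:
  assumes "C1_map f" "C1_map g" shows "C1_map (\<lambda>x. f x + g x)"
proof -
  obtain f' g' where "\<And>x. (f has_derivative blinfun_apply (f' x)) (at x)" "continuous_on UNIV f'"
     "\<And>x. (g has_derivative blinfun_apply (g' x)) (at x)" "continuous_on UNIV g'"
    using assms unfolding C1_map_def by blast
  then show ?thesis
    by (intro C1_mapI[where f' = "\<lambda>x. f' x + g' x"])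
       (simp_all add: plus_blinfun.rep_eq has_derivative_add continuous_on_add)
qed

lemma C2_map_add:
  assumes "C2_map f" "C2_map g" shows "C2_map (\<lambda>x. f x + g x)"
proof -
  obtain f' g' where "\<And>x. (f has_derivative blinfun_apply (f' x)) (at x)" "C1_map f'"
     "\<And>x. (g has_derivative blinfun_apply (g' x)) (at x)" "C1_map g'"
    using assms unfolding C2_map_def by blast
  then show ?thesis
    by (intro C2_mapI[where f' = "\<lambda>x. f' x + g' x"])
       (simp_all add: plus_blinfun.rep_eq has_derivative_add C1_map_add)
qed

lemma has_derivative_bilinear_blinfun:
  assumes pr: "bounded_bilinear pr"
    and "(f has_derivative blinfun_apply f') (at x)" "(g has_derivative blinfun_apply g') (at x)"
  shows "((\<lambda>x. pr (f x) (g x)) has_derivative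
     blinfun_apply ((Blinfun (pr (f x)) o\<^sub>L g') + (Blinfun (\<lambda>a. pr a (g x)) o\<^sub>L f'))) (at x)"
proof -
  interpret bounded_bilinear pr by fact
  have "blinfun_apply (Blinfun (pr (f x))) = pr (f x)"
    "blinfun_apply (Blinfun (\<lambda>a. pr a (g x))) = (\<lambda>a. pr a (g x))"
    by (auto intro!: bounded_linear_Blinfun_apply bounded_linear_left bounded_linear_right)
  then show ?thesis
    by (intro has_derivative_eq_rhs[OF FDERIV[OF assms(2,3)]])
       (simp add: fun_eq_iff plus_blinfun.rep_eq)
qed

lemma Blinfun_bilinear_bounded_linear:
  assumes pr: "bounded_bilinear pr"
  shows "bounded_linear (\<lambda>a. Blinfun (pr a))" "bounded_linear (\<lambda>b. Blinfun (\<lambda>a. pr a b))"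
proof -
  interpret bounded_bilinear pr by fact
  have "(\<lambda>a. Blinfun (pr a)) = prod_right" "(\<lambda>b. Blinfun (\<lambda>a. pr a b)) = prod_left"
    by (auto intro!: ext blinfun_eqI simp: bounded_linear_Blinfun_apply bounded_linear_left
        bounded_linear_right)
  then show "bounded_linear (\<lambda>a. Blinfun (pr a))" "bounded_linear (\<lambda>b. Blinfun (\<lambda>a. pr a b))"
    by (simp_all add: bounded_linear_prod_left bounded_linear_prod_right)
qed

text \<open>Products, scalar multiples and the composition of linear operators are bounded bilinear, so one
  product rule serves both for functions and, at the next order, for their derivatives.\<close>

lemma C1_map_bilinear:
  assumes pr: "bounded_bilinear pr" and "C1_map f" "C1_map g"
  shows "C1_map (\<lambda>x. pr (f x) (g x))"
proof -
  obtain f' g' where d: "\<And>x. (f has_derivative blinfun_apply (f' x)) (at x)" "continuous_on UNIV f'"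
     "\<And>x. (g has_derivative blinfun_apply (g' x)) (at x)" "continuous_on UNIV g'"
    using assms unfolding C1_map_def by blast
  note bl = Blinfun_bilinear_bounded_linear[OF pr]
  show ?thesis
    by (rule C1_mapI, rule has_derivative_bilinear_blinfun[OF pr d(1,3)])
       (intro continuous_on_add bounded_bilinear.continuous_on[OF bounded_bilinear_blinfun_compose]
          bounded_linear.continuous_on[OF bl(1) C1_map_imp_continuous[OF assms(2)]]
          bounded_linear.continuous_on[OF bl(2) C1_map_imp_continuous[OF assms(3)]] d(2,4))
qed

lemma C1_map_compose:
  assumes "C1_map f" "C1_map g"
  shows "C1_map (\<lambda>x. f (g x))"
proof -
  obtain f' g' where d: "\<And>x. (f has_derivative blinfun_apply (f' x)) (at x)" "continuous_on UNIV f'"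
     "\<And>x. (g has_derivative blinfun_apply (g' x)) (at x)" "continuous_on UNIV g'"
    using assms unfolding C1_map_def by blast
  show ?thesis
  proof (rule C1_mapI)
    show "((\<lambda>x. f (g x)) has_derivative blinfun_apply (f' (g x) o\<^sub>L g' x)) (at x)" for x
      by (rule has_derivative_eq_rhs[OF has_derivative_compose[OF d(3) d(1)]]) (simp add: fun_eq_iff)
    have "continuous_on UNIV (\<lambda>x. f' (g x))"
      using continuous_on_compose2[OF d(2) C1_map_imp_continuous[OF assms(2)]] by simp
    then show "continuous_on UNIV (\<lambda>x. f' (g x) o\<^sub>L g' x)"
      by (rule bounded_bilinear.continuous_on[OF bounded_bilinear_blinfun_compose]) (rule d)
  qed
qed

text \<open>The chain rule expresses the derivative as a composition of operators, which is bilinear; the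
  second order thus reduces to the first.\<close>

lemma C2_map_compose:
  assumes "C2_map f" "C2_map g"
  shows "C2_map (\<lambda>x. f (g x))"
proof -
  obtain f' g' where d: "\<And>x. (f has_derivative blinfun_apply (f' x)) (at x)" "C1_map f'"
     "\<And>x. (g has_derivative blinfun_apply (g' x)) (at x)" "C1_map g'"
    using assms unfolding C2_map_def by blast
  show ?thesis
  proof (rule C2_mapI)
    show "((\<lambda>x. f (g x)) has_derivative blinfun_apply (f' (g x) o\<^sub>L g' x)) (at x)" for x
      by (rule has_derivative_eq_rhs[OF has_derivative_compose[OF d(3) d(1)]]) (simp add: fun_eq_iff)
    show "C1_map (\<lambda>x. f' (g x) o\<^sub>L g' x)"
      by (intro C1_map_bilinear[OF bounded_bilinear_blinfun_compose]
          C1_map_compose[OF d(2) C2_map_imp_C1[OF assms(2)]] d(4))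
  qed
qed

lemma C2_map_linear_compose: "bounded_linear L \<Longrightarrow> C2_map g \<Longrightarrow> C2_map (\<lambda>x. L (g x))"
  by (rule C2_map_compose[OF C2_map_bounded_linear])

lemma C2_map_bilinear:
  assumes pr: "bounded_bilinear pr" and "C2_map f" "C2_map g"
  shows "C2_map (\<lambda>x. pr (f x) (g x))"
proof -
  obtain f' g' where d: "\<And>x. (f has_derivative blinfun_apply (f' x)) (at x)" "C1_map f'"
     "\<And>x. (g has_derivative blinfun_apply (g' x)) (at x)" "C1_map g'"
    using assms unfolding C2_map_def by blast
  note bl = Blinfun_bilinear_bounded_linear[OF pr]
  show ?thesis
    by (rule C2_mapI, rule has_derivative_bilinear_blinfun[OF pr d(1,3)])
       (intro C1_map_add C1_map_bilinear[OF bounded_bilinear_blinfun_compose]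
          C1_map_compose[OF C1_map_bounded_linear[OF bl(1)] C2_map_imp_C1[OF assms(2)]]
          C1_map_compose[OF C1_map_bounded_linear[OF bl(2)] C2_map_imp_C1[OF assms(3)]] d(2,4))
qed

lemmas C2_map_mult = C2_map_bilinear[OF bounded_bilinear_mult]
lemmas C2_map_scaleR = C2_map_bilinear[OF bounded_bilinear_scaleR]

lemma has_derivative_blinfun_vector:
  "(f has_vector_derivative d) (at x) \<Longrightarrow> (f has_derivative blinfun_apply (blinfun_scaleR_left d)) (at x)"
  by (simp add: has_vector_derivative_def)

lemma C1_map_vectorI:
  assumes "\<And>x. (f has_vector_derivative f' x) (at x)" "continuous_on UNIV f'"
  shows "C1_map f"
  by (rule C1_mapI[OF has_derivative_blinfun_vector[OF assms(1)]])
     (rule bounded_linear.continuous_on[OF bounded_linear_blinfun_scaleR_left assms(2)])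

lemma C2_map_vectorI:
  assumes "\<And>x. (f has_vector_derivative f' x) (at x)" "\<And>x. (f' has_vector_derivative f'' x) (at x)"
    "continuous_on UNIV f''"
  shows "C2_map f"
  by (rule C2_mapI[OF has_derivative_blinfun_vector[OF assms(1)]])
     (rule C1_map_compose[OF C1_map_bounded_linear[OF bounded_linear_blinfun_scaleR_left]
        C1_map_vectorI[OF assms(2,3)]])

lemma C2_map_realI:
  fixes f :: "real \<Rightarrow> real"
  assumes "\<And>x. (f has_real_derivative f' x) (at x)" "\<And>x. (f' has_real_derivative f'' x) (at x)"
    "continuous_on UNIV f''"
  shows "C2_map f"
  using assms by (intro C2_map_vectorI) (auto simp: has_real_derivative_iff_has_vector_derivative)

lemma C2_map_sin: "C2_map (sin :: real \<Rightarrow> real)"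
  by (rule C2_map_realI[where f' = cos and f'' = "\<lambda>x. - sin x"])
     (auto intro!: derivative_eq_intros continuous_intros)

lemma C2_map_cos: "C2_map (cos :: real \<Rightarrow> real)"
  by (rule C2_map_realI[where f' = "\<lambda>x. - sin x" and f'' = "\<lambda>x. - cos x"])
     (auto intro!: derivative_eq_intros continuous_intros)

lemma C1_map_vectorD:
  assumes "C1_map (f :: real \<Rightarrow> 'b::real_normed_vector)"
  obtains f' where "\<And>x. (f has_vector_derivative f' x) (at x)" "continuous_on UNIV f'"
proof -
  obtain F where F: "\<And>x. (f has_derivative blinfun_apply (F x)) (at x)" "continuous_on UNIV F"
    using assms unfolding C1_map_def by blast
  show thesis
  proof
    show "(f has_vector_derivative F x 1) (at x)" for x
      using F(1)[of x] unfolding has_vector_derivative_def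
      by (rule has_derivative_eq_rhs)
         (auto simp: fun_eq_iff simp flip: blinfun.scaleR_right)
    show "continuous_on UNIV (\<lambda>x. F x 1)"
      by (intro continuous_intros F)
  qed
qed

lemma C2_map_vectorD:
  assumes "C2_map (f :: real \<Rightarrow> 'b::real_normed_vector)"
  obtains f' f'' where "\<And>x. (f has_vector_derivative f' x) (at x)"
    "\<And>x. (f' has_vector_derivative f'' x) (at x)" "continuous_on UNIV f''"
proof -
  obtain F where F: "\<And>x. (f has_derivative blinfun_apply (F x)) (at x)" "C1_map F"
    using assms unfolding C2_map_def by blast
  have 1: "(f has_vector_derivative F x 1) (at x)" for x
    using F(1)[of x] unfolding has_vector_derivative_def
    by (rule has_derivative_eq_rhs)
       (auto simp: fun_eq_iff simp flip: blinfun.scaleR_right)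
  have bl: "bounded_linear (\<lambda>L :: real \<Rightarrow>\<^sub>L 'b. L 1)"
    by (rule blinfun.bounded_linear_left)
  have "C1_map (\<lambda>x. F x 1)"
    by (rule C1_map_compose[OF C1_map_bounded_linear[OF bl] F(2)])
  then obtain F' where "\<And>x. ((\<lambda>x. F x 1) has_vector_derivative F' x) (at x)" "continuous_on UNIV F'"
    by (rule C1_map_vectorD) blast
  with 1 show thesis by (rule that)
qed


section \<open>Primitives, inverse functions and diffeomorphisms of the plane\<close>

text \<open>The integral of \<open>k\<close> from \<open>0\<close> to \<open>u\<close>, substituted to a fixed interval: continuity in further
  parameters then is continuity of a parameter integral, and negative \<open>u\<close> need no separate treatment.\<close>

definition prim :: "(real \<Rightarrow> real) \<Rightarrow> real \<Rightarrow> real" where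
  "prim k u = u * integral {0..1} (\<lambda>\<tau>. k (u * \<tau>))"

lemma prim_0 [simp]: "prim k 0 = 0"
  by (simp add: prim_def)

lemma has_real_derivative_prim:
  assumes k: "continuous_on UNIV k"
  shows "(prim k has_real_derivative k u) (at u)"
proof -
  define a where "a = - \<bar>u\<bar> - 1"
  define b where "b = \<bar>u\<bar> + 1"
  define G where "G = (\<lambda>x. integral {a..x} k)"
  have kab: "continuous_on {a..b} k" using continuous_on_subset[OF k] by blast
  have G: "(G has_real_derivative k x) (at x)" if "x \<in> {a<..<b}" for x
  proof -
    have "(G has_vector_derivative k x) (at x within {a..b})"
      unfolding G_def using that by (intro integral_has_vector_derivative[OF kab]) auto
    then have "(G has_vector_derivative k x) (at x)"
      using that at_within_interior[of x "{a..b}"] by simp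
    then show ?thesis by (simp add: has_real_derivative_iff_has_vector_derivative)
  qed
  have eq: "prim k x = G x - G 0" if x: "x \<in> {a<..<b}" for x
  proof -
    have inside: "x * \<tau> \<in> {a<..<b}" if \<tau>: "\<tau> \<in> {0..1}" for \<tau>
    proof -
      have "\<bar>x * \<tau>\<bar> \<le> \<bar>x\<bar>" using \<tau> by (simp add: abs_mult mult_left_le)
      moreover have "\<bar>x\<bar> < \<bar>u\<bar> + 1" using x by (auto simp: a_def b_def)
      ultimately show ?thesis by (auto simp: a_def b_def)
    qed
    have "((\<lambda>\<tau>. x * k (x * \<tau>)) has_integral (G (x * 1) - G (x * 0))) {0..1}"
    proof (rule fundamental_theorem_of_calculus)
      fix \<tau> :: real assume \<tau>: "\<tau> \<in> {0..1}"
      have "((\<lambda>\<tau>. G (x * \<tau>)) has_real_derivative x * k (x * \<tau>)) (at \<tau>)"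
        using DERIV_chain2[of G "k (x * \<tau>)" "\<lambda>\<tau>. x * \<tau>" \<tau> x UNIV] G[OF inside[OF \<tau>]]
        by (auto intro!: derivative_eq_intros DERIV_cmult_Id simp: mult.commute[of x "k _"])
      then show "((\<lambda>\<tau>. G (x * \<tau>)) has_vector_derivative x * k (x * \<tau>)) (at \<tau> within {0..1})"
        by (simp add: has_real_derivative_iff_has_vector_derivative has_vector_derivative_at_within)
    qed simp
    then show ?thesis
      by (simp add: prim_def integral_unique flip: integral_mult_right)
  qed
  have "((\<lambda>x. G x - G 0) has_real_derivative k u) (at u)"
    by (auto intro!: derivative_eq_intros G simp: a_def b_def)
  then show ?thesis
    by (rule has_field_derivative_transform_within_open[of _ _ _ "{a<..<b}"])
       (auto simp: eq a_def b_def)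
qed

lemma continuous_on_prim_param:
  fixes k :: "'a::topological_space \<Rightarrow> real \<Rightarrow> real"
  assumes k: "continuous_on (U \<times> UNIV) (\<lambda>(q, u). k q u)"
  shows "continuous_on (U \<times> UNIV) (\<lambda>(q, u). prim (k q) u)"
proof -
  have "continuous_on ((U \<times> UNIV) \<times> cbox 0 1) (\<lambda>z. (\<lambda>(q, u). k q u) (fst (fst z), snd (fst z) * snd z))"
    by (rule continuous_on_compose2[OF k]) (auto intro!: continuous_intros)
  then have "continuous_on (U \<times> UNIV) (\<lambda>z. integral (cbox 0 1) (\<lambda>\<tau>. k (fst z) (snd z * \<tau>)))"
    by (intro integral_continuous_on_param) (simp add: case_prod_unfold)
  then show ?thesis
    by (simp add: prim_def case_prod_unfold) (intro continuous_intros, simp)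
qed

text \<open>The arc length functions below are primitives of speeds that are bounded away from zero; this
  makes the whole real line their range, so that curves can be run through by arc length forever.\<close>

lemma bij_and_inverse_of_derivative_bound:
  fixes S k :: "real \<Rightarrow> real"
  assumes S: "\<And>u. (S has_real_derivative k u) (at u)" and c: "0 < c" "\<And>u. c \<le> k u"
  shows "bij S" "\<And>y. (inv S has_real_derivative 1 / k (inv S y)) (at y)"
proof -
  have grow: "c * (y - x) \<le> S y - S x" if "x \<le> y" for x y
  proof -
    have "(\<lambda>u. S u - c * u) x \<le> (\<lambda>u. S u - c * u) y"
      by (rule DERIV_nonneg_imp_nondecreasing[OF that])
         (auto intro!: exI derivative_eq_intros S simp: c)
    then show ?thesis by (simp add: algebra_simps)
  qed
  have "strict_mono S"
    by (rule strict_monoI, rule DERIV_pos_imp_increasing) (use S c in \<open>auto intro: less_le_trans\<close>)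
  then have inj: "inj S" by (rule strict_mono_imp_inj_on)
  have cont: "isCont S x" for x using DERIV_isCont[OF S] .
  have "\<exists>x. S x = y" for y
  proof -
    define n where "n = \<bar>y - S 0\<bar> / c"
    have n: "n \<ge> 0" "c * n = \<bar>y - S 0\<bar>" using c by (auto simp: n_def)
    have "S (- n) \<le> y" "y \<le> S n"
      using grow[of "-n" 0] grow[of 0 n] n by auto
    then show ?thesis using IVT[of S "-n" y n] cont n by auto
  qed
  then have surj: "surj S" by (metis surjI)
  show bij: "bij S" using inj surj by (simp add: bij_def)
  have ci: "isCont (inv S) y" for y
    using isCont_inverse_function[of 1 "inv S y" "inv S" S] cont inj surj
    by (simp add: surj_f_inv_f)
  show "(inv S has_real_derivative 1 / k (inv S y)) (at y)" for y
    using DERIV_inverse_function[OF S, of "inv S" y "y - 1" "y + 1"] c(1) c(2)[of "inv S y"] ci surj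
    by (simp add: surj_f_inv_f inverse_eq_divide)
qed

lemma C2_map_inverse:
  fixes S k :: "real \<Rightarrow> real"
  assumes S: "\<And>u. (S has_real_derivative k u) (at u)" and c: "0 < c" "\<And>u. c \<le> k u"
    and k: "\<And>u. (k has_real_derivative k' u) (at u)" and k': "continuous_on UNIV k'"
  shows "C2_map (inv S)"
proof (rule C2_map_realI)
  note D = bij_and_inverse_of_derivative_bound(2)[of S k, OF S c]
  show "(inv S has_real_derivative 1 / k (inv S y)) (at y)" for y by (rule D)
  have pos: "k u \<noteq> 0" for u using c(1) c(2)[of u] by linarith
  show "((\<lambda>y. 1 / k (inv S y)) has_real_derivative
      - (k' (inv S y) * (1 / k (inv S y))) / (k (inv S y))^2) (at y)" for y
    by (auto intro!: derivative_eq_intros DERIV_chain2[OF k] D pos simp: power2_eq_square)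
  have "continuous_on UNIV k" "continuous_on UNIV (inv S)"
    using k D by (auto intro!: continuous_at_imp_continuous_on intro: DERIV_isCont)
  then show "continuous_on UNIV (\<lambda>y. - (k' (inv S y) * (1 / k (inv S y))) / (k (inv S y))^2)"
    using continuous_on_compose2[of UNIV k UNIV "inv S"]
      continuous_on_compose2[of UNIV k' UNIV "inv S"] k' pos
    by (auto intro!: continuous_intros)
qed

lemma C2_map_Pair:
  assumes "C2_map f" "C2_map g" shows "C2_map (\<lambda>x. (f x, g x))"
proof -
  have "C2_map (\<lambda>x. (f x, 0) + (0, g x))"
    by (intro C2_map_add C2_map_linear_compose[OF _ assms(1)] C2_map_linear_compose[OF _ assms(2)]
        bounded_linear_Pair bounded_linear_ident bounded_linear_zero)
  then show ?thesis by simp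
qed

lemma C2_map_fst: "C2_map f \<Longrightarrow> C2_map (\<lambda>p. f (fst p))"
  and C2_map_snd: "C2_map f \<Longrightarrow> C2_map (\<lambda>p. f (snd p))"
  by (auto intro: C2_map_compose[of f] C2_map_bounded_linear bounded_linear_fst bounded_linear_snd)

lemma C2_diffeoI:
  assumes "C2_map h" "C2_map j" "\<And>p. j (h p) = p" "\<And>p. h (j p) = p"
  shows "C2_diffeo h"
proof -
  have "inv h = j" by (rule inv_equality) (use assms in auto)
  moreover have "bij h" by (rule o_bij[of j]) (use assms in \<open>auto simp: fun_eq_iff\<close>)
  ultimately show ?thesis using assms by (simp add: C2_diffeo_def)
qed

text \<open>The parameters in which the surfaces are defined (arc length of a profile curve and screw or
  rotation parameter) differ from the common parameters of the family by such a map.\<close>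

lemma C2_diffeo_shear:
  fixes S \<Theta> :: "real \<Rightarrow> real"
  assumes S: "bij S" "C2_map S" "C2_map (inv S)" and \<Theta>: "C2_map \<Theta>" and b: "b \<noteq> 0"
  shows "C2_diffeo (\<lambda>(u, \<theta>). (S u, \<Theta> u + b * \<theta>))"
proof (rule C2_diffeoI)
  let ?h = "\<lambda>(u, \<theta>). (S u, \<Theta> u + b * \<theta>)"
  let ?j = "\<lambda>(s, t). (inv S s, inverse b * t + (- inverse b) * \<Theta> (inv S s))"
  have lin: "C2_map (\<lambda>x::real. c * x)" for c
    by (rule C2_map_bounded_linear) (rule bounded_linear_mult_right)
  show "?j (?h p) = p" for p
    using S(1) b by (auto simp: case_prod_unfold bij_is_inj field_simps)
  show "?h (?j p) = p" for p
    using S(1) b by (auto simp: case_prod_unfold bij_is_surj surj_f_inv_f field_simps)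
  show "C2_map ?h" unfolding case_prod_unfold
    by (intro C2_map_Pair C2_map_add C2_map_fst[OF S(2)] C2_map_fst[OF \<Theta>] C2_map_snd[OF lin])
  show "C2_map ?j" unfolding case_prod_unfold
    by (intro C2_map_Pair C2_map_add C2_map_fst[OF S(3)]
        C2_map_fst[OF C2_map_compose[OF lin C2_map_compose[OF \<Theta> S(3)]]] C2_map_snd[OF lin])
qed

section \<open>Mean curvature of helicoidal surfaces\<close>

lemma vector_3_scaleR:
  "(vector [a, b, c] :: real^3) =
     a *\<^sub>R vector [1, 0, 0] + (b *\<^sub>R vector [0, 1, 0] + c *\<^sub>R vector [0, 0, 1])"
  by (simp add: vec_eq_iff forall_3)

lemma C2_map_vector_3:
  assumes "C2_map a" "C2_map b" "C2_map c"
  shows "C2_map (\<lambda>p. vector [a p, b p, c p] :: real^3)"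
  unfolding vector_3_scaleR[of "a _" "b _" "c _"]
  by (intro C2_map_add C2_map_scaleR assms C2_map_const)

lemma continuous_on_vector_3:
  assumes "continuous_on A a" "continuous_on A b" "continuous_on A c"
  shows "continuous_on A (\<lambda>p. vector [a p, b p, c p] :: real^3)"
  unfolding vector_3_scaleR[of "a _" "b _" "c _"]
  by (intro continuous_intros assms)

lemma has_vector_derivative_vector_3:
  assumes "(a has_real_derivative a') F" "(b has_real_derivative b') F" "(c has_real_derivative c') F"
  shows "((\<lambda>s. vector [a s, b s, c s] :: real^3) has_vector_derivative vector [a', b', c']) F"
  unfolding vector_3_scaleR[of "a _" "b _" "c _"] vector_3_scaleR[of a' b' c']
  using assms unfolding has_real_derivative_iff_has_vector_derivative
  by (intro has_vector_derivative_add
      bounded_linear.has_vector_derivative[OF bounded_linear_scaleR_left])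

lemma C2_map_vec_nth:
  assumes "C2_map (\<phi> :: 'a::real_normed_vector \<Rightarrow> real^3)" shows "C2_map (\<lambda>p. \<phi> p $ i)"
  by (rule C2_map_linear_compose[OF bounded_linear_vec_nth assms])

lemma frechet_derivative_partials:
  "\<phi> differentiable (at p) \<Longrightarrow> frechet_derivative \<phi> (at p) (a, b) = a *\<^sub>R partial_s \<phi> p + b *\<^sub>R partial_t \<phi> p"
proof -
  assume "\<phi> differentiable (at p)"
  then interpret bounded_linear "frechet_derivative \<phi> (at p)"
    by (meson frechet_derivative_works has_derivative_bounded_linear)
  have "(a, b) = a *\<^sub>R (1, 0) + b *\<^sub>R (0, 1)" by simp
  then show ?thesis by (simp only: add scaleR partial_s_def partial_t_def)
qed

lemma partial_s_eqI:
  assumes "\<phi> differentiable (at (s, t))" "((\<lambda>u. \<phi> (u, t)) has_vector_derivative d) (at s)"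
  shows "partial_s \<phi> (s, t) = d"
proof -
  have "((\<lambda>u. (u, t)) has_derivative (\<lambda>h. (h, 0))) (at s)"
    by (auto intro!: derivative_eq_intros)
  from has_derivative_compose[OF this assms(1)[unfolded frechet_derivative_works]]
  have "((\<lambda>u. \<phi> (u, t)) has_vector_derivative partial_s \<phi> (s, t)) (at s)"
    by (simp add: has_vector_derivative_def frechet_derivative_partials assms(1))
  then show ?thesis using assms(2) vector_derivative_unique_at by blast
qed

lemma partial_t_eqI:
  assumes "\<phi> differentiable (at (s, t))" "((\<lambda>u. \<phi> (s, u)) has_vector_derivative d) (at t)"
  shows "partial_t \<phi> (s, t) = d"
proof -
  have "((\<lambda>u. (s, u)) has_derivative (\<lambda>h. (0, h))) (at t)"
    by (auto intro!: derivative_eq_intros)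
  from has_derivative_compose[OF this assms(1)[unfolded frechet_derivative_works]]
  have "((\<lambda>u. \<phi> (s, u)) has_vector_derivative partial_t \<phi> (s, t)) (at t)"
    by (simp add: has_vector_derivative_def frechet_derivative_partials assms(1))
  then show ?thesis using assms(2) vector_derivative_unique_at by blast
qed

lemma partials_differentiable:
  assumes "C2_map \<phi>"
  shows "partial_s \<phi> differentiable (at p)" "partial_t \<phi> differentiable (at p)"
proof -
  obtain F where F: "\<And>p. (\<phi> has_derivative blinfun_apply (F p)) (at p)" "C1_map F"
    using assms unfolding C2_map_def by blast
  then have fr: "frechet_derivative \<phi> (at p) = blinfun_apply (F p)" for p
    using frechet_derivative_at by metis
  obtain F' where "\<And>p. (F has_derivative blinfun_apply (F' p)) (at p)"
    using F(2) unfolding C1_map_def by blast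
  then have "((\<lambda>p. F p v) has_derivative (\<lambda>h. F' p h v)) (at p)" for v
    by (rule bounded_linear.has_derivative[OF blinfun.bounded_linear_left])
  then have "(\<lambda>p. F p v) differentiable (at p)" for v
    unfolding differentiable_def by blast
  then show "partial_s \<phi> differentiable (at p)" "partial_t \<phi> differentiable (at p)"
    unfolding partial_s_def[abs_def] partial_t_def[abs_def] fr by blast+
qed

text \<open>From right to left the principal curvatures must be shown to be real, that is, \<open>H\<^sup>2 - K\<close> must
  not be negative.  At the normal curvature \<open>k = L / E\<close> of the first coordinate direction the
  matrix \<open>II - k I\<close> has a zero on its diagonal, so the quadratic polynomial \<open>det (II - k I)\<close> is not
  positive there and has a real zero.\<close>

lemma mean_curvature_iff:
  fixes E F G L M N H :: real
  assumes E: "E > 0" and W: "E * G - F\<^sup>2 > 0"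
  shows "(\<exists>k1 k2. (\<forall>k. (L - k * E) * (N - k * G) - (M - k * F)\<^sup>2 = (E * G - F\<^sup>2) * (k - k1) * (k - k2))
            \<and> (k1 + k2) / 2 = H) \<longleftrightarrow> L * G - 2 * M * F + N * E = 2 * H * (E * G - F\<^sup>2)" (is "?l \<longleftrightarrow> ?r")
proof
  assume ?l
  then obtain k1 k2 where
    k: "\<And>k. (L - k * E) * (N - k * G) - (M - k * F)\<^sup>2 = (E * G - F\<^sup>2) * (k - k1) * (k - k2)"
    and "(k1 + k2) / 2 = H" by blast
  then have H: "k1 + k2 = 2 * H" by auto
  have "(L * G - 2 * M * F + N * E) = (E * G - F\<^sup>2) * (k1 + k2)"
    using k[of 1] k[of "-1"] by (simp add: algebra_simps power2_eq_square)
  then show ?r using H by (simp add: algebra_simps)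
next
  assume r: ?r
  define D where "D = E * G - F\<^sup>2"
  define K where "K = (L * N - M\<^sup>2) / D"
  have D: "D > 0" using W by (simp add: D_def)
  have q: "(L - k * E) * (N - k * G) - (M - k * F)\<^sup>2 = D * (k\<^sup>2 - 2 * H * k + K)" for k
  proof -
    have "(L - k * E) * (N - k * G) - (M - k * F)\<^sup>2
        = (L * N - M\<^sup>2) - k * (L * G - 2 * M * F + N * E) + k\<^sup>2 * (E * G - F\<^sup>2)"
      by (simp add: algebra_simps power2_eq_square)
    also have "\<dots> = D * K - k * (2 * H * D) + k\<^sup>2 * D" using r D by (simp add: K_def D_def)
    finally show ?thesis by (simp add: algebra_simps)
  qed
  have "D * ((L / E)\<^sup>2 - 2 * H * (L / E) + K) \<le> 0"
    unfolding q[symmetric] using E by simp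
  then have "(L / E)\<^sup>2 - 2 * H * (L / E) + K \<le> 0" using D by (simp add: mult_le_0_iff)
  moreover have "0 \<le> (H - L / E)\<^sup>2" by simp
  ultimately have HK: "0 \<le> H\<^sup>2 - K" by (simp add: power2_eq_square algebra_simps)
  show ?l
  proof (intro exI conjI allI)
    show "(H + sqrt (H\<^sup>2 - K) + (H - sqrt (H\<^sup>2 - K))) / 2 = H" by simp
    fix k
    have "(k - (H + sqrt (H\<^sup>2 - K))) * (k - (H - sqrt (H\<^sup>2 - K))) = (k - H)\<^sup>2 - (sqrt (H\<^sup>2 - K))\<^sup>2"
      by (simp add: algebra_simps power2_eq_square)
    also have "\<dots> = k\<^sup>2 - 2 * H * k + K" using HK by (simp add: power2_eq_square algebra_simps)
    finally show "(L - k * E) * (N - k * G) - (M - k * F)\<^sup>2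
        = (E * G - F\<^sup>2) * (k - (H + sqrt (H\<^sup>2 - K))) * (k - (H - sqrt (H\<^sup>2 - K)))"
      using q[of k] by (simp add: D_def mult.assoc)
  qed
qed

text \<open>Coordinates that rotate with the screw motion: in them all vectors attached to the surface are
  independent of \<open>t\<close>.\<close>

definition frame :: "real \<Rightarrow> real \<Rightarrow> real \<Rightarrow> real \<Rightarrow> real \<Rightarrow> real^3" where
  "frame w t a y c = vector [a * cos (w * t) + c * sin (w * t), y, - a * sin (w * t) + c * cos (w * t)]"

lemma twizzler_map_frame: "twizzler_map w x z (s, t) = frame w t (x s) t (z s)"
  by (simp add: twizzler_map_def frame_def)

lemma inner_frame: "frame w t a y c \<bullet> frame w t a' y' c' = a * a' + y * y' + c * c'"
proof -
  have "(a * cos (w * t) + c * sin (w * t)) * (a' * cos (w * t) + c' * sin (w * t)) +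
        (- a * sin (w * t) + c * cos (w * t)) * (- a' * sin (w * t) + c' * cos (w * t)) =
      (a * a' + c * c') * ((sin (w * t))\<^sup>2 + (cos (w * t))\<^sup>2)"
    by algebra
  also have "\<dots> = a * a' + c * c'" by simp
  finally show ?thesis
    by (simp add: frame_def inner_vec_def sum_3)
qed

lemma cross3_frame:
  "cross3 (frame w t a y c) (frame w t a' y' c') =
    frame w t (y * c' - c * y') (c * a' - a * c') (a * y' - y * a')"
proof -
  have "(- a * sin (w * t) + c * cos (w * t)) * (a' * cos (w * t) + c' * sin (w * t)) -
        (a * cos (w * t) + c * sin (w * t)) * (- a' * sin (w * t) + c' * cos (w * t)) =
      (c * a' - a * c') * ((sin (w * t))\<^sup>2 + (cos (w * t))\<^sup>2)"
    by algebra
  also have "\<dots> = c * a' - a * c'" by simp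
  finally show ?thesis
    by (simp add: frame_def cross3_def vec_eq_iff forall_3 algebra_simps)
qed

lemma norm_frame: "norm (frame w t a y c) = sqrt (a\<^sup>2 + y\<^sup>2 + c\<^sup>2)"
  by (simp add: norm_eq_sqrt_inner inner_frame power2_eq_square)

lemma frame_derivative_s:
  assumes "(a has_real_derivative a') (at s)" "(y has_real_derivative y') (at s)"
    "(c has_real_derivative c') (at s)"
  shows "((\<lambda>s. frame w t (a s) (y s) (c s)) has_vector_derivative frame w t a' y' c') (at s)"
  unfolding frame_def
  by (rule has_vector_derivative_vector_3) (auto intro!: derivative_eq_intros assms)

lemma frame_derivative_t:
  assumes "(y has_real_derivative y') (at t)"
  shows "((\<lambda>t. frame w t a (y t) c) has_vector_derivative frame w t (w * c) y' (- (w * a))) (at t)"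
  unfolding frame_def
  by (rule has_vector_derivative_vector_3)
     (auto intro!: derivative_eq_intros assms simp: algebra_simps)

lemma C2_twizzler_map_iff: "C2_map (twizzler_map w x z) \<longleftrightarrow> C2_map x \<and> C2_map z"
proof
  assume c: "C2_map (twizzler_map w x z)"
  have "C2_map (\<lambda>s::real. (s, 0::real))"
    by (intro C2_map_Pair C2_map_const C2_map_bounded_linear bounded_linear_ident)
  from C2_map_compose[OF c this] have c0: "C2_map (\<lambda>s. twizzler_map w x z (s, 0))" .
  from C2_map_vec_nth[OF c0, of 1] C2_map_vec_nth[OF c0, of 3] show "C2_map x \<and> C2_map z"
    by (simp add: twizzler_map_def)
next
  assume c: "C2_map x \<and> C2_map z"
  have lin: "C2_map (\<lambda>x::real. c * x)" for c
    by (rule C2_map_bounded_linear) (rule bounded_linear_mult_right)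
  have 1: "C2_map (\<lambda>p::real \<times> real. cos (w * snd p))" "C2_map (\<lambda>p::real \<times> real. sin (w * snd p))"
    by (intro C2_map_compose[OF C2_map_cos] C2_map_compose[OF C2_map_sin] C2_map_snd lin)+
  have 2: "C2_map (\<lambda>p::real \<times> real. x (fst p))" "C2_map (\<lambda>p::real \<times> real. z (fst p))"
    "C2_map (\<lambda>p::real \<times> real. (-1) * x (fst p))"
    using c by (intro C2_map_fst C2_map_compose[OF lin]; simp)+
  have 3: "C2_map (\<lambda>p::real \<times> real. snd p)"
    by (intro C2_map_bounded_linear bounded_linear_snd)
  have "C2_map (\<lambda>p. vector [x (fst p) * cos (w * snd p) + z (fst p) * sin (w * snd p), snd p,
      ((-1) * x (fst p)) * sin (w * snd p) + z (fst p) * cos (w * snd p)] :: real^3)"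
    by (intro C2_map_vector_3 C2_map_add C2_map_mult 1 2 3)
  then show "C2_map (twizzler_map w x z)"
    by (simp add: twizzler_map_def case_prod_unfold)
qed

text \<open>The derivatives of the profile curve are parameters of the locale so that the same computations
  serve for a curve constructed by quadratures and for the curve of an arbitrary Twizzler.\<close>

locale profile =
  fixes w :: real and x z x' z' x'' z'' :: "real \<Rightarrow> real"
  assumes x: "\<And>s. (x has_real_derivative x' s) (at s)" and x': "\<And>s. (x' has_real_derivative x'' s) (at s)"
    and z: "\<And>s. (z has_real_derivative z' s) (at s)" and z': "\<And>s. (z' has_real_derivative z'' s) (at s)"
    and cx: "continuous_on UNIV x''" and cz: "continuous_on UNIV z''"
    and unit: "\<And>s. (x' s)\<^sup>2 + (z' s)\<^sup>2 = 1"
begin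

definition kappa :: "real \<Rightarrow> real" where "kappa s = x' s * z'' s - z' s * x'' s"

lemma deriv_x: "deriv x s = x' s" and deriv_z: "deriv z s = z' s"
  using x z DERIV_imp_deriv by blast+

lemma xi1_eq: "xi1 x z s = x s * x' s + z s * z' s"
  by (simp add: xi1_def deriv_x deriv_z)

lemma xi2_eq: "xi2 x z s = - x s * z' s + z s * x' s"
  by (simp add: xi2_def deriv_x deriv_z)

lemma radius_xi: "(x s)\<^sup>2 + (z s)\<^sup>2 = (xi1 x z s)\<^sup>2 + (xi2 x z s)\<^sup>2"
proof -
  have "(xi1 x z s)\<^sup>2 + (xi2 x z s)\<^sup>2 = ((x s)\<^sup>2 + (z s)\<^sup>2) * ((x' s)\<^sup>2 + (z' s)\<^sup>2)"
    by (simp add: xi1_eq xi2_eq power2_eq_square algebra_simps)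
  then show ?thesis by (simp add: unit)
qed

lemma tangent_orthogonal: "x' s * x'' s + z' s * z'' s = 0"
proof -
  have "((\<lambda>s. (x' s)\<^sup>2 + (z' s)\<^sup>2) has_real_derivative 2 * (x' s * x'' s + z' s * z'' s)) (at s)"
    by (auto intro!: derivative_eq_intros x' z' simp: algebra_simps)
  moreover have "((\<lambda>s. (x' s)\<^sup>2 + (z' s)\<^sup>2) has_real_derivative 0) (at s)"
    by (simp add: unit)
  ultimately show ?thesis using DERIV_unique by fastforce
qed

lemma acceleration: "x'' s = - kappa s * z' s" "z'' s = kappa s * x' s"
proof -
  have "x'' s * ((x' s)\<^sup>2 + (z' s)\<^sup>2) = - kappa s * z' s + x' s * (x' s * x'' s + z' s * z'' s)"
    "z'' s * ((x' s)\<^sup>2 + (z' s)\<^sup>2) = kappa s * x' s + z' s * (x' s * x'' s + z' s * z'' s)"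
    by (simp_all add: kappa_def power2_eq_square algebra_simps)
  then show "x'' s = - kappa s * z' s" "z'' s = kappa s * x' s"
    unfolding unit tangent_orthogonal by simp_all
qed

text \<open>The treadmill sled: \<open>\<xi>\<^sub>1\<close> and \<open>\<xi>\<^sub>2\<close> are coordinates of the curve point in its own moving frame,
  which turns with angular velocity \<open>\<kappa>\<close>.\<close>

lemma xi1_derivative: "(xi1 x z has_real_derivative 1 + kappa s * xi2 x z s) (at s)"
proof -
  have "((\<lambda>s. x s * x' s + z s * z' s) has_real_derivative
      (x' s)\<^sup>2 + (z' s)\<^sup>2 + (x s * x'' s + z s * z'' s)) (at s)"
    by (auto intro!: derivative_eq_intros x z x' z' simp: power2_eq_square)
  then show ?thesis
    unfolding xi1_eq[abs_def] by (simp add: unit acceleration xi2_eq algebra_simps)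
qed

lemma xi2_derivative: "(xi2 x z has_real_derivative - kappa s * xi1 x z s) (at s)"
proof -
  have "((\<lambda>s. - x s * z' s + z s * x' s) has_real_derivative
      - x s * z'' s + z s * x'' s) (at s)"
    by (auto intro!: derivative_eq_intros x z x' z')
  then show ?thesis
    unfolding xi2_eq[abs_def] by (simp add: acceleration xi1_eq algebra_simps)
qed

lemma radius_derivative: "((\<lambda>s. (x s)\<^sup>2 + (z s)\<^sup>2) has_real_derivative 2 * xi1 x z s) (at s)"
  by (auto intro!: derivative_eq_intros x z simp: xi1_eq)

lemma C2_profile: "C2_map x" "C2_map z"
  using C2_map_realI x x' cx z z' cz by blast+

lemma C2_twizzler: "C2_map (twizzler_map w x z)"
  by (simp add: C2_twizzler_map_iff C2_profile)

lemma partial_s_twizzler: "partial_s (twizzler_map w x z) (s, t) = frame w t (x' s) 0 (z' s)"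
  by (rule partial_s_eqI[OF C2_map_imp_differentiable[OF C2_twizzler]])
     (auto simp: twizzler_map_frame intro!: frame_derivative_s x z)

lemma partial_t_twizzler: "partial_t (twizzler_map w x z) (s, t) = frame w t (w * z s) 1 (- (w * x s))"
  by (rule partial_t_eqI[OF C2_map_imp_differentiable[OF C2_twizzler]])
     (auto simp: twizzler_map_frame intro!: frame_derivative_t)

lemma second_partials_twizzler:
  "partial_s (partial_s (twizzler_map w x z)) (s, t) = frame w t (x'' s) 0 (z'' s)"
  "partial_s (partial_t (twizzler_map w x z)) (s, t) = frame w t (w * z' s) 0 (- (w * x' s))"
  "partial_t (partial_t (twizzler_map w x z)) (s, t) = frame w t (- (w * (w * x s))) 0 (- (w * (w * z s)))"
proof -
  show "partial_s (partial_s (twizzler_map w x z)) (s, t) = frame w t (x'' s) 0 (z'' s)"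
    by (rule partial_s_eqI[OF partials_differentiable(1)[OF C2_twizzler]])
       (auto simp: partial_s_twizzler intro!: frame_derivative_s x' z')
  show "partial_s (partial_t (twizzler_map w x z)) (s, t) = frame w t (w * z' s) 0 (- (w * x' s))"
    by (rule partial_s_eqI[OF partials_differentiable(2)[OF C2_twizzler]])
       (auto simp: partial_t_twizzler intro!: frame_derivative_s derivative_eq_intros x z)
  show "partial_t (partial_t (twizzler_map w x z)) (s, t)
      = frame w t (- (w * (w * x s))) 0 (- (w * (w * z s)))"
    by (rule partial_t_eqI[OF partials_differentiable(2)[OF C2_twizzler]])
       (use frame_derivative_t[of "\<lambda>_. 1" 0 t w "w * z s" "- (w * x s)"] in
         \<open>simp add: partial_t_twizzler\<close>)
qed

lemma unit_normal_twizzler: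
  "unit_normal (twizzler_map w x z) (s, t) =
     inverse (sqrt (1 + w\<^sup>2 * (xi1 x z s)\<^sup>2)) *\<^sub>R frame w t (- z' s) (w * xi1 x z s) (x' s)"
proof -
  have n: "cross3 (frame w t (x' s) 0 (z' s)) (frame w t (w * z s) 1 (- (w * x s)))
      = frame w t (- z' s) (w * xi1 x z s) (x' s)"
    by (simp add: cross3_frame xi1_eq algebra_simps)
  have "norm (frame w t (- z' s) (w * xi1 x z s) (x' s)) = sqrt (1 + w\<^sup>2 * (xi1 x z s)\<^sup>2)"
    using unit[of s] by (simp add: norm_frame power_mult_distrib algebra_simps)
  then show ?thesis
    by (simp add: unit_normal_def Let_def partial_s_twizzler partial_t_twizzler n)
qed

lemma immersion_twizzler: "immersion (twizzler_map w x z)"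
  unfolding immersion_def
proof (intro conjI allI C2_twizzler)
  fix p :: "real \<times> real"
  obtain s t where p: "p = (s, t)" by (cases p)
  note d = C2_map_imp_differentiable[OF C2_twizzler, of p]
  have lin: "linear (frechet_derivative (twizzler_map w x z) (at p))"
    using d by (simp add: linear_frechet_derivative)
  show "inj (frechet_derivative (twizzler_map w x z) (at p))"
  proof (subst linear_injective_0[OF lin], intro allI impI)
    fix h assume h: "frechet_derivative (twizzler_map w x z) (at p) h = 0"
    obtain a b where hab: "h = (a, b)" by (cases h)
    have eq: "a *\<^sub>R frame w t (x' s) 0 (z' s) + b *\<^sub>R frame w t (w * z s) 1 (- (w * x s)) = 0"
      using h unfolding hab frechet_derivative_partials[OF d] by (simp add: p partial_s_twizzler partial_t_twizzler)
    then have "(a *\<^sub>R frame w t (x' s) 0 (z' s) + b *\<^sub>R frame w t (w * z s) 1 (- (w * x s))) $ 2 = 0 $ 2"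
      by simp
    then have b: "b = 0" by (simp add: frame_def)
    with eq have "norm (a *\<^sub>R frame w t (x' s) 0 (z' s)) = 0" by simp
    then have "a = 0" using unit[of s] by (simp add: norm_frame)
    with b show "h = 0" by (simp add: hab zero_prod_def)
  qed
qed

text \<open>In the rotating frame the fundamental forms depend on \<open>s\<close> only.  Constant mean curvature
  therefore is an ordinary differential equation for the profile curve, linear in its curvature.\<close>

lemma constant_mean_curvature_iff:
  "constant_mean_curvature (twizzler_map w x z) H \<longleftrightarrow>
     (\<forall>s. kappa s * (1 + w\<^sup>2 * ((x s)\<^sup>2 + (z s)\<^sup>2)) + w\<^sup>2 * xi2 x z s
         = 2 * H * sqrt (1 + w\<^sup>2 * (xi1 x z s)\<^sup>2) ^ 3)"
proof -
  have "(\<exists>k1 k2. principal_curvatures (twizzler_map w x z) (s, t) k1 k2 \<and> (k1 + k2) / 2 = H) \<longleftrightarrow>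
      kappa s * (1 + w\<^sup>2 * ((x s)\<^sup>2 + (z s)\<^sup>2)) + w\<^sup>2 * xi2 x z s
         = 2 * H * sqrt (1 + w\<^sup>2 * (xi1 x z s)\<^sup>2) ^ 3" for s t
  proof -
    let ?D = "sqrt (1 + w\<^sup>2 * (xi1 x z s)\<^sup>2)"
    let ?E = 1 let ?F = "w * xi2 x z s" let ?G = "1 + w\<^sup>2 * ((x s)\<^sup>2 + (z s)\<^sup>2)"
    have D: "?D > 0" "?D\<^sup>2 = 1 + w\<^sup>2 * (xi1 x z s)\<^sup>2"
      by (simp_all add: add_pos_nonneg)
    have W: "?E * ?G - ?F\<^sup>2 = ?D\<^sup>2"
      unfolding D radius_xi by (simp add: power_mult_distrib algebra_simps)
    have E: "partial_s (twizzler_map w x z) (s, t) \<bullet> partial_s (twizzler_map w x z) (s, t) = ?E"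
      using unit[of s] by (simp add: partial_s_twizzler inner_frame power2_eq_square)
    have F: "partial_s (twizzler_map w x z) (s, t) \<bullet> partial_t (twizzler_map w x z) (s, t) = ?F"
      by (simp add: partial_s_twizzler partial_t_twizzler inner_frame xi2_eq algebra_simps)
    have G: "partial_t (twizzler_map w x z) (s, t) \<bullet> partial_t (twizzler_map w x z) (s, t) = ?G"
      by (simp add: partial_t_twizzler inner_frame power2_eq_square algebra_simps)
    have L: "partial_s (partial_s (twizzler_map w x z)) (s, t) \<bullet> unit_normal (twizzler_map w x z) (s, t)
        = inverse ?D * kappa s"
      by (simp add: second_partials_twizzler unit_normal_twizzler inner_frame kappa_def algebra_simps)
    have M: "partial_s (partial_t (twizzler_map w x z)) (s, t) \<bullet> unit_normal (twizzler_map w x z) (s, t)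
        = inverse ?D * (- w)"
    proof -
      have "w * z' s * (- z' s) + 0 * (w * xi1 x z s) + - (w * x' s) * x' s = - w * ((x' s)\<^sup>2 + (z' s)\<^sup>2)"
        by (simp add: algebra_simps power2_eq_square)
      then show ?thesis
        unfolding second_partials_twizzler unit_normal_twizzler inner_scaleR_right inner_frame
        by (simp add: unit)
    qed
    have N: "partial_t (partial_t (twizzler_map w x z)) (s, t) \<bullet> unit_normal (twizzler_map w x z) (s, t)
        = inverse ?D * (- w\<^sup>2 * xi2 x z s)"
      unfolding second_partials_twizzler unit_normal_twizzler inner_scaleR_right inner_frame
      by (simp add: xi2_eq power2_eq_square algebra_simps)
    have "(\<exists>k1 k2. principal_curvatures (twizzler_map w x z) (s, t) k1 k2 \<and> (k1 + k2) / 2 = H) \<longleftrightarrow>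
        inverse ?D * kappa s * ?G - 2 * (inverse ?D * (- w)) * ?F + inverse ?D * (- w\<^sup>2 * xi2 x z s) * ?E
         = 2 * H * (?E * ?G - ?F\<^sup>2)"
      unfolding principal_curvatures_def Let_def E F G L M N
      by (rule mean_curvature_iff) (use W D in auto)
    also have "\<dots> \<longleftrightarrow> inverse ?D * (kappa s * ?G + w\<^sup>2 * xi2 x z s) = 2 * H * ?D\<^sup>2"
      unfolding W by (simp add: algebra_simps power2_eq_square)
    also have "\<dots> \<longleftrightarrow> kappa s * ?G + w\<^sup>2 * xi2 x z s = 2 * H * ?D ^ 3"
      using D(1) by (simp add: field_simps power2_eq_square power3_eq_cube)
    finally show ?thesis .
  qed
  then show ?thesis unfolding constant_mean_curvature_def by (metis surj_pair)
qed

end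

text \<open>The section \<open>t = 0\<close> of the immersion shows that its profile curve is of class \<open>C2\<close>.\<close>

lemma twizzler_imp_profile:
  assumes "twizzler H w x z"
  obtains x' z' x'' z'' where "profile x z x' z' x'' z''"
proof -
  have c: "C2_map x" "C2_map z" and u: "\<And>s. (deriv x s)\<^sup>2 + (deriv z s)\<^sup>2 = 1"
    using assms by (auto simp: twizzler_def immersion_def C2_twizzler_map_iff)
  obtain x' x'' where x: "\<And>s. (x has_real_derivative x' s) (at s)"
    "\<And>s. (x' has_real_derivative x'' s) (at s)" "continuous_on UNIV x''"
    using C2_map_vectorD[OF c(1)] by (auto simp: has_real_derivative_iff_has_vector_derivative)
  obtain z' z'' where z: "\<And>s. (z has_real_derivative z' s) (at s)"
    "\<And>s. (z' has_real_derivative z'' s) (at s)" "continuous_on UNIV z''"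
    using C2_map_vectorD[OF c(2)] by (auto simp: has_real_derivative_iff_has_vector_derivative)
  have "deriv x = x'" "deriv z = z'" using x z DERIV_imp_deriv by blast+
  then have "profile x z x' z' x'' z''" by unfold_locales (use x z u in auto)
  then show thesis by (rule that)
qed


section \<open>The joint parametrization\<close>

text \<open>The eccentricity \<open>e\<close> of the rolling conic, with \<open>M = (e\<^sup>2 - 1) / 4\<close>.  All formulas are simpler in
  \<open>e\<close> than in \<open>M\<close>.\<close>

definition ecc :: "real \<Rightarrow> real" where "ecc M = sqrt (1 + 4 * M)"

text \<open>The square of the distance from the axis.  Half of the parameter \<open>u\<close> is arc length along the
  curves orthogonal to the helices (for a surface of revolution: along the meridian); in terms of
  this parameter the distance from the axis does not depend on the pitch.\<close>

definition rad2 :: "real \<Rightarrow> real \<Rightarrow> real" where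
  "rad2 e u = (1 + e\<^sup>2 - 2 * e * cos u) / 4"

text \<open>For a Delaunay surface this is the distance from the axis times the cosine of the angle between
  meridian and axis; it changes sign where the meridian of a nodoid turns back.  For a Twizzler it is
  \<open>- \<xi>\<^sub>2 / sqrt (1 + w\<^sup>2 \<xi>\<^sub>1\<^sup>2)\<close>, so that the equation \<open>h\<^sub>w (\<xi>\<^sub>1, \<xi>\<^sub>2) = M\<close> reads \<open>rad2 - axial = M\<close>.\<close>

definition axial :: "real \<Rightarrow> real \<Rightarrow> real" where
  "axial e u = (1 - e * cos u) / 2"

definition height_slope :: "real \<Rightarrow> real \<Rightarrow> real \<Rightarrow> real" where
  "height_slope \<epsilon> e u = axial e u * sqrt (\<epsilon>\<^sup>2 + rad2 e u) / (2 * rad2 e u)"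

text \<open>A screw surface about the second coordinate axis with pitch \<open>\<epsilon> = 1 / w\<close>, parametrized by the polar
  angle \<open>\<theta>\<close> about the axis instead of the height.  In contrast to the height, the angle remains a
  parameter in the limit \<open>\<epsilon> = 0\<close>, where a surface of revolution appears.\<close>

definition family :: "real \<Rightarrow> real \<Rightarrow> real \<times> real \<Rightarrow> real^3" where
  "family \<epsilon> e = (\<lambda>(u, \<theta>). vector
     [sqrt (rad2 e u) * cos \<theta>, prim (height_slope \<epsilon> e) u - \<epsilon> * \<theta>, sqrt (rad2 e u) * sin \<theta>])"

text \<open>The surface stays away from the axis except for \<open>e = 1\<close>, that is \<open>M = 0\<close>, where the Delaunay
  surface degenerates to a chain of spheres.\<close>

lemma rad2_pos:
  assumes "e \<ge> 0" "e \<noteq> 1" shows "rad2 e u > 0"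
proof -
  have "e * cos u \<le> e * 1" using assms(1) by (intro mult_left_mono) auto
  moreover have "0 < (1 - e)\<^sup>2" using assms(2) by simp
  moreover have "(1 - e)\<^sup>2 = 1 - 2 * e + e\<^sup>2" by (simp add: power2_eq_square algebra_simps)
  ultimately show ?thesis unfolding rad2_def by simp
qed

lemma rad2_minus_axial_squared: "rad2 e u - (axial e u)\<^sup>2 = (e * sin u / 2)\<^sup>2"
proof -
  have "(e * sin u / 2)\<^sup>2 = e\<^sup>2 * (1 - (cos u)\<^sup>2) / 4"
    by (simp add: power_mult_distrib power_divide sin_squared_eq)
  then show ?thesis
    by (simp add: rad2_def axial_def power2_eq_square algebra_simps add_divide_distrib diff_divide_distrib)
qed

lemma rad2_minus_axial: "rad2 e u - axial e u = (e\<^sup>2 - 1) / 4"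
  by (simp add: rad2_def axial_def field_simps)

lemma rad2_derivative: "(rad2 e has_real_derivative e * sin u / 2) (at u)"
  unfolding rad2_def[abs_def] by (auto intro!: derivative_eq_intros)

lemma axial_derivative: "(axial e has_real_derivative e * sin u / 2) (at u)"
  unfolding axial_def[abs_def] by (auto intro!: derivative_eq_intros)

lemma rad_derivative:
  assumes "e \<ge> 0" "e \<noteq> 1"
  shows "((\<lambda>u. sqrt (rad2 e u)) has_real_derivative e * sin u / (4 * sqrt (rad2 e u))) (at u)"
  using rad2_pos[OF assms, of u]
  by (auto intro!: derivative_eq_intros rad2_derivative simp: divide_simps)

subsection \<open>Regularity of the functions involved\<close>

lemma C2_map_realD:
  fixes f :: "real \<Rightarrow> real"
  assumes "C2_map f"
  shows "\<exists>f' f''. (\<forall>x. (f has_real_derivative f' x) (at x)) \<and> (\<forall>x. (f' has_real_derivative f'' x) (at x))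
    \<and> continuous_on UNIV f \<and> continuous_on UNIV f' \<and> continuous_on UNIV f''"
proof -
  obtain f' f'' where d: "\<And>x. (f has_vector_derivative f' x) (at x)"
    "\<And>x. (f' has_vector_derivative f'' x) (at x)" and c: "continuous_on UNIV f''"
    using assms by (rule C2_map_vectorD) (rule that)
  note d' = d[folded has_real_derivative_iff_has_vector_derivative]
  have "continuous_on UNIV f" "continuous_on UNIV f'"
    using d' by (meson DERIV_isCont continuous_at_imp_continuous_on)+
  with d' c show ?thesis by blast
qed

lemma C2_map_sqrt:
  fixes f :: "real \<Rightarrow> real"
  assumes f: "C2_map f" and pos: "\<And>x. f x > 0"
  shows "C2_map (\<lambda>x. sqrt (f x))"
proof -
  obtain f' f'' where d: "\<And>x. (f has_real_derivative f' x) (at x)"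
    "\<And>x. (f' has_real_derivative f'' x) (at x)"
    and cf: "continuous_on UNIV f" "continuous_on UNIV f'" and c: "continuous_on UNIV f''"
    using C2_map_realD[OF f] by blast
  show ?thesis
  proof (rule C2_map_realI)
    show "((\<lambda>x. sqrt (f x)) has_real_derivative f' x / (2 * sqrt (f x))) (at x)" for x
      using pos[of x] by (auto intro!: derivative_eq_intros d simp: divide_simps)
    show "((\<lambda>x. f' x / (2 * sqrt (f x))) has_real_derivative
       (f'' x * (2 * sqrt (f x)) - f' x * (f' x / sqrt (f x))) / (2 * sqrt (f x))\<^sup>2) (at x)" for x
      using pos[of x] by (auto intro!: derivative_eq_intros d simp: divide_simps power2_eq_square)
    show "continuous_on UNIV (\<lambda>x. (f'' x * (2 * sqrt (f x)) - f' x * (f' x / sqrt (f x))) / (2 * sqrt (f x))\<^sup>2)"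
      using pos less_imp_neq[OF pos] by (intro continuous_intros c cf) auto
  qed
qed

lemma C2_map_divide:
  fixes f g :: "real \<Rightarrow> real"
  assumes f: "C2_map f" and g: "C2_map g" and nz: "\<And>x. g x \<noteq> 0"
  shows "C2_map (\<lambda>x. f x / g x)"
proof -
  obtain g' g'' where d: "\<And>x. (g has_real_derivative g' x) (at x)"
    "\<And>x. (g' has_real_derivative g'' x) (at x)"
    and cg: "continuous_on UNIV g" "continuous_on UNIV g'" and c: "continuous_on UNIV g''"
    using C2_map_realD[OF g] by blast
  have "C2_map (\<lambda>x. inverse (g x))"
  proof (rule C2_map_realI)
    show "((\<lambda>x. inverse (g x)) has_real_derivative - g' x / (g x)\<^sup>2) (at x)" for x
      using nz[of x] by (auto intro!: derivative_eq_intros d simp: divide_simps power2_eq_square)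
    show "((\<lambda>x. - g' x / (g x)\<^sup>2) has_real_derivative
       (- g'' x * (g x)\<^sup>2 + g' x * (2 * g x * g' x)) / ((g x)\<^sup>2)\<^sup>2) (at x)" for x
      using nz[of x] by (auto intro!: derivative_eq_intros d simp: divide_simps power2_eq_square)
    show "continuous_on UNIV (\<lambda>x. (- g'' x * (g x)\<^sup>2 + g' x * (2 * g x * g' x)) / ((g x)\<^sup>2)\<^sup>2)"
      using nz by (intro continuous_intros c cg) auto
  qed
  from C2_map_mult[OF f this] show ?thesis by (simp add: divide_inverse)
qed

lemma C2_map_power2: "C2_map f \<Longrightarrow> C2_map (\<lambda>x. (f x :: real)\<^sup>2)"
  unfolding power2_eq_square by (rule C2_map_mult)

lemma C2_map_diff:
  fixes f g :: "'a::real_normed_vector \<Rightarrow> real"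
  assumes "C2_map f" "C2_map g" shows "C2_map (\<lambda>x. f x - g x)"
  using C2_map_add[OF assms(1) C2_map_mult[OF C2_map_const[of "-1"] assms(2)]] by simp

lemma C2_map_ident: "C2_map (\<lambda>x. x)"
  by (rule C2_map_bounded_linear[OF bounded_linear_ident])

lemma C2_map_rad2: "C2_map (rad2 e)" and C2_map_axial: "C2_map (axial e)"
  unfolding rad2_def[abs_def] axial_def[abs_def]
  by (intro C2_map_divide C2_map_diff C2_map_mult C2_map_const C2_map_cos; simp)+

lemma C2_map_prim:
  assumes "C2_map k" shows "C2_map (prim k)"
proof -
  obtain k' k'' where d: "\<And>x. (k has_real_derivative k' x) (at x)"
    "\<And>x. (k' has_real_derivative k'' x) (at x)"
    and "continuous_on UNIV k" "continuous_on UNIV k'" "continuous_on UNIV k''"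
    using C2_map_realD[OF assms] by blast
  then show ?thesis
    by (intro C2_map_realI[of "prim k" k k'] has_real_derivative_prim d)
qed

lemma C2_map_continuous: "C2_map f \<Longrightarrow> continuous_on UNIV f"
  by (intro C1_map_imp_continuous C2_map_imp_C1)

lemma prim_has_derivative:
  "C2_map k \<Longrightarrow> (prim k has_real_derivative k u) (at u)"
  by (intro has_real_derivative_prim C2_map_continuous)

lemma C2_map_height_slope:
  assumes "e \<ge> 0" "e \<noteq> 1" shows "C2_map (height_slope \<epsilon> e)"
proof -
  have "\<epsilon>\<^sup>2 + rad2 e u > 0" "2 * rad2 e u \<noteq> 0" for u
    using rad2_pos[OF assms, of u] by (simp_all add: add_nonneg_pos)
  then show ?thesis
    unfolding height_slope_def[abs_def]
    by (intro C2_map_divide C2_map_mult C2_map_sqrt C2_map_add C2_map_const C2_map_rad2 C2_map_axial)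
qed

lemma prim_inverse_C2:
  assumes k: "C2_map k" and c: "0 < c" "\<And>u. c \<le> k u"
  shows "bij (prim k)" "C2_map (inv (prim k))"
    "(inv (prim k) has_real_derivative 1 / k (inv (prim k) y)) (at y)"
proof -
  obtain k' k'' where d: "\<And>x. (k has_real_derivative k' x) (at x)"
    "\<And>x. (k' has_real_derivative k'' x) (at x)"
    and "continuous_on UNIV k" "continuous_on UNIV k'" "continuous_on UNIV k''"
    using C2_map_realD[OF k] by blast
  with d show "C2_map (inv (prim k))"
    by (intro C2_map_inverse[of _ k c k'] prim_has_derivative k c)
  show "bij (prim k)" "(inv (prim k) has_real_derivative 1 / k (inv (prim k) y)) (at y)"
    using bij_and_inverse_of_derivative_bound[of "prim k" k c] prim_has_derivative[OF k] c by auto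
qed

lemma prim_scale: "prim (\<lambda>u. c * k u) u = c * prim k u"
  by (simp add: prim_def)

lemma continuous_on_family:
  fixes U :: "'a::metric_space set"
  assumes "continuous_on U \<epsilon>" "continuous_on U e" "\<And>q. q \<in> U \<Longrightarrow> e q \<ge> 0 \<and> e q \<noteq> 1"
  shows "continuous_on (U \<times> UNIV) (\<lambda>(q, s, t). family (\<epsilon> q) (e q) (s, t))"
proof -
  have 1: "continuous_on (U \<times> UNIV) (\<lambda>z :: _ \<times> real. \<epsilon> (fst z))"
    "continuous_on (U \<times> UNIV) (\<lambda>z :: _ \<times> real. e (fst z))"
    by (rule continuous_on_compose2[OF assms(1)] continuous_on_compose2[OF assms(2)];
        auto intro!: continuous_intros)+
  have r: "continuous_on (U \<times> UNIV) (\<lambda>z. rad2 (e (fst z)) (snd z))"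
    and p: "continuous_on (U \<times> UNIV) (\<lambda>z. axial (e (fst z)) (snd z))"
    unfolding rad2_def axial_def by (auto intro!: continuous_intros 1)
  have nz: "2 * rad2 (e q) u \<noteq> 0" if "q \<in> U" for q u
    using rad2_pos[of "e q" u] assms(3)[OF that] by simp
  have "continuous_on (U \<times> UNIV) (\<lambda>z. height_slope (\<epsilon> (fst z)) (e (fst z)) (snd z))"
    unfolding height_slope_def
    by (intro continuous_on_divide continuous_on_mult continuous_on_real_sqrt continuous_on_add
        continuous_on_power continuous_on_const 1 r p) (use nz in auto)
  then have "continuous_on (U \<times> UNIV) (\<lambda>(q, u). prim (height_slope (\<epsilon> q) (e q)) u)"
    by (intro continuous_on_prim_param) (simp add: case_prod_unfold)
  note P = this
  have sel: "continuous_on (U \<times> UNIV) (\<lambda>z :: 'a \<times> real \<times> real. (fst z, fst (snd z)))"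
    "(\<lambda>z :: 'a \<times> real \<times> real. (fst z, fst (snd z))) ` (U \<times> UNIV) \<subseteq> U \<times> UNIV"
    by (auto intro!: continuous_intros)
  have 2: "continuous_on (U \<times> UNIV) (\<lambda>z :: _ \<times> real \<times> real.
      prim (height_slope (\<epsilon> (fst z)) (e (fst z))) (fst (snd z)))"
    using continuous_on_compose2[OF P sel] by simp
  have "continuous_on (U \<times> UNIV) (\<lambda>z :: _ \<times> real \<times> real. rad2 (e (fst z)) (fst (snd z)))"
    using continuous_on_compose2[OF r sel] by simp
  moreover have "continuous_on (U \<times> UNIV) (\<lambda>z :: _ \<times> real \<times> real. \<epsilon> (fst z))"
    by (rule continuous_on_compose2[OF assms(1)]) (auto intro!: continuous_intros)
  ultimately show ?thesis
    unfolding family_def case_prod_unfold fst_conv snd_conv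
    by (intro continuous_on_vector_3 continuous_intros 2)
qed

section \<open>Twizzlers\<close>

lemma polar_twizzler_map:
  "twizzler_map w (\<lambda>s. R s * cos (T s)) (\<lambda>s. R s * sin (T s)) (s, t) =
     vector [R s * cos (T s - w * t), t, R s * sin (T s - w * t)]"
  by (simp add: twizzler_map_def vec_eq_iff forall_3 cos_diff sin_diff algebra_simps)

text \<open>The profile curve is found by quadratures.  Put \<open>\<rho> = \<xi>\<^sub>1\<^sup>2 + \<xi>\<^sub>2\<^sup>2\<close>.  The level equation
  \<open>h\<^sub>w (\<xi>\<^sub>1, \<xi>\<^sub>2) = M\<close> gives \<open>(1 + w\<^sup>2 (\<rho> - M)\<^sup>2) \<xi>\<^sub>1\<^sup>2 = \<rho> - (\<rho> - M)\<^sup>2\<close>, and \<open>\<rho>' = 2 \<xi>\<^sub>1\<close> along the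
  curve.  In the parameter \<open>u\<close> with \<open>ds / du = sqrt (1 + w\<^sup>2 (\<rho> - M)\<^sup>2) / 2\<close> this becomes
  \<open>(d\<rho> / du)\<^sup>2 = \<rho> - (\<rho> - M)\<^sup>2\<close>, which is free of \<open>w\<close> and is solved by \<open>\<rho> = rad2 e u\<close>; the polar angle
  of the curve then has derivative \<open>axial * sqrt (1 + w\<^sup>2 \<rho>) / (2 \<rho>)\<close>.  Since the level equation alone
  also has solutions of constant \<open>\<rho>\<close>, it does not imply the prescribed mean curvature; the latter is
  verified for the curve found.\<close>

lemma twizzler_exists:
  assumes w: "w > 0" and e: "e \<ge> 0" "e \<noteq> 1"
  obtains x z h where "twizzler 1 w x z" "\<And>s. h_fun w (xi1 x z s) (xi2 x z s) = (e\<^sup>2 - 1) / 4"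
    "C2_diffeo h" "family (1 / w) e = twizzler_map w x z \<circ> h"
proof -
  define k where "k u = sqrt (1 + w\<^sup>2 * (axial e u)\<^sup>2) / 2" for u
  define l where "l u = axial e u * sqrt (1 + w\<^sup>2 * rad2 e u) / (2 * rad2 e u)" for u
  have Wpos: "1 + w\<^sup>2 * rad2 e u > 0" and gpos: "1 + w\<^sup>2 * (axial e u)\<^sup>2 > 0"
    and rpos: "rad2 e u > 0" and rnz: "2 * rad2 e u \<noteq> 0" for u
    using rad2_pos[OF e, of u] by (simp_all add: add_pos_nonneg)
  have k: "C2_map k" unfolding k_def[abs_def]
    by (intro C2_map_divide C2_map_sqrt C2_map_add C2_map_mult C2_map_power2 C2_map_const C2_map_axial
        gpos) simp
  have k2: "1 / 2 \<le> k u" for u unfolding k_def by simp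
  have l: "C2_map l" unfolding l_def[abs_def]
    by (intro C2_map_divide C2_map_sqrt C2_map_add C2_map_mult C2_map_const C2_map_axial C2_map_rad2
        Wpos rnz)
  define S where "S = prim k"
  define U where "U = inv S"
  note S = prim_inverse_C2[OF k _ k2, folded S_def, folded U_def, simplified]
  have SU: "S (U s) = s" "U (S u) = u" for s u
    using S(1) by (simp_all add: U_def bij_is_surj surj_f_inv_f bij_is_inj)
  define \<Theta> where "\<Theta> = prim l"
  have \<Theta>: "(\<Theta> has_real_derivative l u) (at u)" "C2_map \<Theta>" for u
    unfolding \<Theta>_def using l by (auto intro: prim_has_derivative C2_map_prim)
  define r where "r u = sqrt (rad2 e u)" for u
  have r: "C2_map r" "(r has_real_derivative e * sin u / (4 * r u)) (at u)" "r u > 0" "(r u)\<^sup>2 = rad2 e u" for u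
    unfolding r_def[abs_def] using rpos[of u] by (auto intro!: C2_map_sqrt C2_map_rad2 rpos rad_derivative e)
  define x where "x s = r (U s) * cos (\<Theta> (U s))" for s
  define z where "z s = r (U s) * sin (\<Theta> (U s))" for s
  have xz: "C2_map x" "C2_map z" unfolding x_def[abs_def] z_def[abs_def]
    by (intro C2_map_mult C2_map_compose[OF r(1)] C2_map_compose[OF C2_map_cos]
        C2_map_compose[OF C2_map_sin] C2_map_compose[OF \<Theta>(2)] S(2))+
  obtain x' x'' where
    xd: "\<And>s. (x has_real_derivative x' s) (at s)" "\<And>s. (x' has_real_derivative x'' s) (at s)"
      "continuous_on UNIV x''"
    using C2_map_realD[OF xz(1)] by blast
  obtain z' z'' where
    zd: "\<And>s. (z has_real_derivative z' s) (at s)" "\<And>s. (z' has_real_derivative z'' s) (at s)"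
      "continuous_on UNIV z''"
    using C2_map_realD[OF xz(2)] by blast
  define g where "g s = sqrt (1 + w\<^sup>2 * (axial e (U s))\<^sup>2)" for s
  define W where "W s = sqrt (1 + w\<^sup>2 * rad2 e (U s))" for s
  define P where "P s = axial e (U s)" for s
  define \<rho> where "\<rho> s = rad2 e (U s)" for s
  define \<sigma> where "\<sigma> s = e * sin (U s) / 2" for s
  have g: "g s > 0" "(g s)\<^sup>2 = 1 + w\<^sup>2 * (P s)\<^sup>2" and W: "W s > 0" "(W s)\<^sup>2 = 1 + w\<^sup>2 * \<rho> s"
    and \<rho>: "\<rho> s > 0" "\<rho> s - (P s)\<^sup>2 = (\<sigma> s)\<^sup>2" "\<rho> s - P s = (e\<^sup>2 - 1) / 4" for s
    using Wpos[of "U s"] gpos[of "U s"] rpos[of "U s"] rad2_minus_axial_squared rad2_minus_axial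
    by (simp_all add: g_def W_def P_def \<rho>_def \<sigma>_def)
  have Ud: "(U has_real_derivative 2 / g s) (at s)" for s
    using S(3)[of s] by (simp add: k_def g_def)
  have x'_eq: "x' s = (\<sigma> s / (2 * r (U s)) * cos (\<Theta> (U s)) - r (U s) * sin (\<Theta> (U s)) * l (U s)) * (2 / g s)"
    and z'_eq: "z' s = (\<sigma> s / (2 * r (U s)) * sin (\<Theta> (U s)) + r (U s) * cos (\<Theta> (U s)) * l (U s)) * (2 / g s)" for s
  proof -
    have 1: "((\<lambda>s. r (U s)) has_real_derivative (\<sigma> s / (2 * r (U s))) * (2 / g s)) (at s)"
      using DERIV_chain2[OF r(2)[of "U s"] Ud[of s]] by (simp add: \<sigma>_def)
    have 2: "((\<lambda>s. \<Theta> (U s)) has_real_derivative l (U s) * (2 / g s)) (at s)"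
      using DERIV_chain2[OF \<Theta>(1)[of "U s"] Ud[of s]] .
    have "(x has_real_derivative (\<sigma> s / (2 * r (U s)) * cos (\<Theta> (U s)) - r (U s) * sin (\<Theta> (U s)) * l (U s)) * (2 / g s)) (at s)"
      unfolding x_def[abs_def] by (auto intro!: derivative_eq_intros 1 2 simp: algebra_simps)
    then show "x' s = (\<sigma> s / (2 * r (U s)) * cos (\<Theta> (U s)) - r (U s) * sin (\<Theta> (U s)) * l (U s)) * (2 / g s)"
      using DERIV_unique xd(1) by blast
    have "(z has_real_derivative (\<sigma> s / (2 * r (U s)) * sin (\<Theta> (U s)) + r (U s) * cos (\<Theta> (U s)) * l (U s)) * (2 / g s)) (at s)"
      unfolding z_def[abs_def] by (auto intro!: derivative_eq_intros 1 2 simp: algebra_simps)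
    then show "z' s = (\<sigma> s / (2 * r (U s)) * sin (\<Theta> (U s)) + r (U s) * cos (\<Theta> (U s)) * l (U s)) * (2 / g s)"
      using DERIV_unique zd(1) by blast
  qed
  have rl: "r (U s) * l (U s) = P s * W s / (2 * r (U s))" for s
  proof -
    have "l (U s) = P s * W s / (2 * (r (U s))\<^sup>2)" by (simp add: l_def P_def W_def r(4))
    then show ?thesis using r(3)[of "U s"] by (simp add: power2_eq_square)
  qed
  have unit: "(x' s)\<^sup>2 + (z' s)\<^sup>2 = 1" for s
  proof -
    have cs: "(cos (\<Theta> (U s)))\<^sup>2 = 1 - (sin (\<Theta> (U s)))\<^sup>2" by (simp add: cos_squared_eq)
    have "(x' s)\<^sup>2 + (z' s)\<^sup>2 = ((\<sigma> s / (2 * r (U s)))\<^sup>2 + (r (U s) * l (U s))\<^sup>2) * (2 / g s)\<^sup>2"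
      unfolding x'_eq z'_eq using cs by algebra
    also have "\<dots> = ((\<sigma> s)\<^sup>2 + (P s)\<^sup>2 * (W s)\<^sup>2) / (\<rho> s * (g s)\<^sup>2)"
      unfolding rl power_divide power_mult_distrib r(4)
      using g(1)[of s] \<rho>(1)[of s] by (simp add: \<rho>_def[symmetric] field_simps)
    also have "(\<sigma> s)\<^sup>2 + (P s)\<^sup>2 * (W s)\<^sup>2 = \<rho> s * (g s)\<^sup>2"
      unfolding g W \<rho>(2)[symmetric] by (simp add: algebra_simps)
    finally show ?thesis using g(1)[of s] \<rho>(1)[of s] by simp
  qed
  interpret profile w x z x' z' x'' z''
    by unfold_locales (use xd zd unit in auto)
  have X1: "xi1 x z s = \<sigma> s / g s" for s
  proof -
    have "xi1 x z s = \<sigma> s / g s * ((sin (\<Theta> (U s)))\<^sup>2 + (cos (\<Theta> (U s)))\<^sup>2)"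
      unfolding xi1_eq x'_eq z'_eq x_def z_def using r(3)[of "U s"] g(1)[of s]
      by (simp add: field_simps power2_eq_square del: sin_cos_squared_add sin_cos_squared_add2 sin_cos_squared_add3)
    then show ?thesis by simp
  qed
  have X2: "xi2 x z s = - (P s * W s / g s)" for s
  proof -
    have "xi2 x z s = - ((r (U s) * (r (U s) * l (U s))) * (2 / g s)) * ((sin (\<Theta> (U s)))\<^sup>2 + (cos (\<Theta> (U s)))\<^sup>2)"
      unfolding xi2_eq x'_eq z'_eq x_def z_def by algebra
    also have "\<dots> = - ((r (U s) * (r (U s) * l (U s))) * (2 / g s))" by simp
    also have "\<dots> = - (P s * W s / g s)"
      unfolding rl using r(3)[of "U s"] by (simp add: field_simps)
    finally show ?thesis .
  qed
  have D2: "1 + w\<^sup>2 * (\<sigma> s / g s)\<^sup>2 = (W s / g s)\<^sup>2" for s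
  proof -
    have "1 + w\<^sup>2 * (\<sigma> s / g s)\<^sup>2 = ((g s)\<^sup>2 + w\<^sup>2 * (\<sigma> s)\<^sup>2) / (g s)\<^sup>2"
      using g(1)[of s] by (simp add: power_divide field_simps)
    also have "(g s)\<^sup>2 + w\<^sup>2 * (\<sigma> s)\<^sup>2 = (W s)\<^sup>2"
      unfolding g W \<rho>(2)[symmetric] by (simp add: algebra_simps)
    finally show ?thesis by (simp add: power_divide)
  qed
  have D: "sqrt (1 + w\<^sup>2 * (xi1 x z s)\<^sup>2) = W s / g s" for s
    unfolding X1 D2 using g(1)[of s] W(1)[of s] by simp
  have rad: "(x s)\<^sup>2 + (z s)\<^sup>2 = \<rho> s" for s
  proof -
    have "(x s)\<^sup>2 + (z s)\<^sup>2 = (r (U s))\<^sup>2 * ((sin (\<Theta> (U s)))\<^sup>2 + (cos (\<Theta> (U s)))\<^sup>2)"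
      unfolding x_def z_def by algebra
    then show ?thesis by (simp add: r(4) \<rho>_def)
  qed
  have hM: "h_fun w (xi1 x z s) (xi2 x z s) = (e\<^sup>2 - 1) / 4" for s
    unfolding h_fun_def D radius_xi[symmetric] rad unfolding X2 using \<rho>(3)[of s] g(1)[of s] W(1)[of s]
    by simp
  (* The curvature follows from comparing the derivatives of xi1 and xi2 with the equations of the
     treadmill sled.  Both coordinates are needed, as either of them can vanish. *)
  have Pd: "(P has_real_derivative \<sigma> s * (2 / g s)) (at s)"
    and \<rho>d: "(\<rho> has_real_derivative \<sigma> s * (2 / g s)) (at s)" for s
    using DERIV_chain2[OF axial_derivative[of e "U s"] Ud[of s]]
      DERIV_chain2[OF rad2_derivative[of e "U s"] Ud[of s]]
    unfolding P_def[abs_def] \<rho>_def[abs_def] \<sigma>_def by auto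
  have \<sigma>d: "(\<sigma> has_real_derivative (1 - 2 * P s) / g s) (at s)" for s
    unfolding \<sigma>_def[abs_def]
    by (auto intro!: derivative_eq_intros Ud simp: P_def axial_def diff_divide_distrib)
  have gd: "(g has_real_derivative w\<^sup>2 * P s * \<sigma> s * 2 / (g s)\<^sup>2) (at s)" for s
  proof -
    have "((\<lambda>s. sqrt (1 + w\<^sup>2 * (P s)\<^sup>2)) has_real_derivative
        (w\<^sup>2 * (2 * P s * (\<sigma> s * (2 / g s)))) / (2 * g s)) (at s)"
      using gpos[of "U s"]
      by (auto intro!: derivative_eq_intros Pd simp: P_def[symmetric] g_def divide_simps)
    moreover have "g = (\<lambda>s. sqrt (1 + w\<^sup>2 * (P s)\<^sup>2))" by (simp add: g_def P_def fun_eq_iff)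
    ultimately show ?thesis using g(1)[of s] by (simp add: field_simps power2_eq_square)
  qed
  have Wd: "(W has_real_derivative w\<^sup>2 * \<sigma> s / (W s * g s)) (at s)" for s
  proof -
    have "((\<lambda>s. sqrt (1 + w\<^sup>2 * \<rho> s)) has_real_derivative
        (w\<^sup>2 * (\<sigma> s * (2 / g s))) / (2 * W s)) (at s)"
      using Wpos[of "U s"]
      by (auto intro!: derivative_eq_intros \<rho>d simp: \<rho>_def[symmetric] W_def divide_simps)
    moreover have "W = (\<lambda>s. sqrt (1 + w\<^sup>2 * \<rho> s))" by (simp add: W_def \<rho>_def fun_eq_iff)
    ultimately show ?thesis using g(1)[of s] W(1)[of s] by (simp add: field_simps power2_eq_square)
  qed
  (* the curvature for which the equation of constant mean curvature 1 holds *)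
  define K where "K s = (W s / g s) * (2 * (W s / g s)\<^sup>2 + w\<^sup>2 * P s) / (W s)\<^sup>2" for s
  have kappa: "kappa s = K s" for s
  proof -
    have "(xi1 x z has_real_derivative
        ((1 - 2 * P s) / g s * g s - \<sigma> s * (w\<^sup>2 * P s * \<sigma> s * 2 / (g s)\<^sup>2)) / (g s)\<^sup>2) (at s)"
      unfolding X1[abs_def] using g(1)[of s]
      by (auto intro!: derivative_eq_intros \<sigma>d gd simp: power2_eq_square)
    then have "1 + kappa s * xi2 x z s =
        ((1 - 2 * P s) / g s * g s - \<sigma> s * (w\<^sup>2 * P s * \<sigma> s * 2 / (g s)\<^sup>2)) / (g s)\<^sup>2"
      using DERIV_unique xi1_derivative by blast
    also have "\<dots> = ((1 - 2 * P s) * (g s)\<^sup>2 - 2 * w\<^sup>2 * P s * (\<sigma> s)\<^sup>2) / ((g s)\<^sup>2)\<^sup>2"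
      using g(1)[of s] by (simp add: field_simps power2_eq_square)
    also have "(1 - 2 * P s) * (g s)\<^sup>2 - 2 * w\<^sup>2 * P s * (\<sigma> s)\<^sup>2 =
        (g s)\<^sup>2 * (g s)\<^sup>2 - P s * (2 * (W s)\<^sup>2 + w\<^sup>2 * P s * (g s)\<^sup>2)"
      unfolding g W \<rho>(2)[symmetric] by (simp add: algebra_simps power2_eq_square)
    also have "\<dots> / ((g s)\<^sup>2)\<^sup>2 = 1 + K s * xi2 x z s"
      unfolding X2 K_def using g(1)[of s] W(1)[of s] by (simp add: field_simps power2_eq_square)
    finally have 1: "kappa s * xi2 x z s = K s * xi2 x z s" by simp
    have X2': "xi2 x z = (\<lambda>s. - (P s * W s / g s))" using X2 by auto
    have "(xi2 x z has_real_derivative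
        - (((\<sigma> s * (2 / g s) * W s + P s * (w\<^sup>2 * \<sigma> s / (W s * g s))) * g s
            - P s * W s * (w\<^sup>2 * P s * \<sigma> s * 2 / (g s)\<^sup>2)) / (g s)\<^sup>2)) (at s)"
      unfolding X2' using g(1)[of s]
      by (auto intro!: derivative_eq_intros Pd Wd gd simp: power2_eq_square)
    then have "- kappa s * xi1 x z s =
        - (((\<sigma> s * (2 / g s) * W s + P s * (w\<^sup>2 * \<sigma> s / (W s * g s))) * g s
            - P s * W s * (w\<^sup>2 * P s * \<sigma> s * 2 / (g s)\<^sup>2)) / (g s)\<^sup>2)"
      using DERIV_unique xi2_derivative by blast
    also have "\<dots> = - \<sigma> s * (2 * (W s)\<^sup>2 * ((g s)\<^sup>2 - w\<^sup>2 * (P s)\<^sup>2) + w\<^sup>2 * P s * (g s)\<^sup>2) / (W s * ((g s)\<^sup>2)\<^sup>2)"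
      using g(1)[of s] W(1)[of s] by (simp add: field_simps power2_eq_square)
    also have "(g s)\<^sup>2 - w\<^sup>2 * (P s)\<^sup>2 = 1" unfolding g by simp
    also have "- \<sigma> s * (2 * (W s)\<^sup>2 * 1 + w\<^sup>2 * P s * (g s)\<^sup>2) / (W s * ((g s)\<^sup>2)\<^sup>2) = - K s * xi1 x z s"
      unfolding X1 K_def using g(1)[of s] W(1)[of s] by (simp add: field_simps power2_eq_square)
    finally have 2: "kappa s * xi1 x z s = K s * xi1 x z s" by simp
    have "(xi1 x z s)\<^sup>2 + (xi2 x z s)\<^sup>2 > 0"
      unfolding radius_xi[symmetric] rad by (rule \<rho>)
    then have "xi1 x z s \<noteq> 0 \<or> xi2 x z s \<noteq> 0" by auto
    with 1 2 show ?thesis by auto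
  qed
  have "constant_mean_curvature (twizzler_map w x z) 1"
    unfolding constant_mean_curvature_iff
  proof
    fix s
    have "K s * (W s)\<^sup>2 + w\<^sup>2 * (- (P s * W s / g s)) = 2 * (W s / g s) ^ 3"
      unfolding K_def using W(1)[of s] g(1)[of s]
      by (simp add: field_simps power2_eq_square power3_eq_cube)
    then show "kappa s * (1 + w\<^sup>2 * ((x s)\<^sup>2 + (z s)\<^sup>2)) + w\<^sup>2 * xi2 x z s
        = 2 * 1 * sqrt (1 + w\<^sup>2 * (xi1 x z s)\<^sup>2) ^ 3"
      unfolding D rad W(2)[symmetric] kappa X2 by simp
  qed
  then have tw: "twizzler 1 w x z"
    unfolding twizzler_def using immersion_twizzler unit by (simp add: deriv_x deriv_z)
  define h where "h = (\<lambda>(u, \<theta>). (S u, 1 / w * \<Theta> u + (- 1 / w) * \<theta>))"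
  have h: "C2_diffeo h" unfolding h_def
    by (rule C2_diffeo_shear[OF S(1)])
       (use S(2) w in \<open>auto simp: S_def U_def intro!: C2_map_prim k C2_map_mult C2_map_const \<Theta>(2)
          C2_map_divide C2_map_ident\<close>)
  have slope: "height_slope (1 / w) e = (\<lambda>u. 1 / w * l u)"
  proof
    fix u
    have "sqrt ((1 / w)\<^sup>2 + rad2 e u) = sqrt (1 + w\<^sup>2 * rad2 e u) / w"
    proof -
      have "(1 / w)\<^sup>2 + rad2 e u = (1 + w\<^sup>2 * rad2 e u) / w\<^sup>2"
        using w by (simp add: field_simps)
      then show ?thesis using w by (simp add: real_sqrt_divide)
    qed
    then show "height_slope (1 / w) e u = 1 / w * l u"
      by (simp add: height_slope_def l_def)
  qed
  have "family (1 / w) e = twizzler_map w x z \<circ> h"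
  proof
    fix p :: "real \<times> real"
    obtain u \<theta> where p: "p = (u, \<theta>)" by (cases p)
    have "\<Theta> u - w * (1 / w * \<Theta> u + (- 1 / w) * \<theta>) = \<theta>"
      using w by (simp add: field_simps)
    then show "family (1 / w) e p = (twizzler_map w x z \<circ> h) p"
      unfolding p h_def x_def[abs_def] z_def[abs_def]
      by (simp add: polar_twizzler_map SU family_def slope prim_scale \<Theta>_def r_def del: times_divide_eq_left)
  qed
  with tw hM h that show thesis by blast
qed


section \<open>The cylinder\<close>

lemma covering_space_homeomorphism_compose:
  assumes cov: "covering_space C p S" and h: "homeomorphism C' C h h'" and f: "homeomorphism S S' f f'"
  shows "covering_space C' (\<lambda>x. f (p (h x))) S'"
proof -
  have p: "continuous_on C p" "p ` C = S" using cov by (auto simp: covering_space_def)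
  have even: "\<forall>x\<in>S. \<exists>T. x \<in> T \<and> openin (top_of_set S) T \<and>
      (\<exists>v. \<Union>v = C \<inter> p -` T \<and> (\<forall>u\<in>v. openin (top_of_set C) u) \<and>
         pairwise disjnt v \<and> (\<forall>u\<in>v. \<exists>q. homeomorphism u T p q))"
    using cov by (simp add: covering_space_def)
  have hc: "continuous_on C' h" "h ` C' = C" and fc: "continuous_on S f" "f ` S = S'"
    and f'c: "continuous_on S' f'" "f' ` S' = S"
    using h f by (auto simp: homeomorphism_def)
  have f'f: "f' (f x) = x" "f x \<in> S'" if "x \<in> S" for x
    using f that by (auto simp: homeomorphism_def)
  have ff': "f (f' y) = y" "f' y \<in> S" if "y \<in> S'" for y
    using f that by (auto simp: homeomorphism_def)
  have hC: "h x \<in> C" if "x \<in> C'" for x using that hc by blast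
  have pS: "p x \<in> S" if "x \<in> C" for x using that p by blast
  have "\<exists>T. y \<in> T \<and> openin (top_of_set S') T \<and>
      (\<exists>V. \<Union>V = C' \<inter> (\<lambda>x. f (p (h x))) -` T \<and> (\<forall>u\<in>V. openin (top_of_set C') u) \<and>
         pairwise disjnt V \<and> (\<forall>u\<in>V. \<exists>q. homeomorphism u T (\<lambda>x. f (p (h x))) q))"
    if y: "y \<in> S'" for y
  proof -
    have "f' y \<in> S" using y f'c by blast
    from bspec[OF even this] obtain T V where T: "f' y \<in> T" "openin (top_of_set S) T" and
      V: "\<Union>V = C \<inter> p -` T" "\<forall>u\<in>V. openin (top_of_set C) u" "pairwise disjnt V"
        "\<forall>u\<in>V. \<exists>q. homeomorphism u T p q"
      by (elim exE conjE)
    have TS: "T \<subseteq> S" using T(2) openin_imp_subset by blast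
    define T' where "T' = S' \<inter> f' -` T"
    define V' where "V' = (\<lambda>u. C' \<inter> h -` u) ` V"
    have VC: "u \<subseteq> C" if "u \<in> V" for u using bspec[OF V(2) that] openin_imp_subset by blast
    have fT: "f ` T = T'"
    proof
      show "f ` T \<subseteq> T'" using f'f TS by (auto simp: T'_def subset_iff)
      show "T' \<subseteq> f ` T"
      proof
        fix y assume "y \<in> T'"
        then have "y = f (f' y)" "f' y \<in> T" using ff' by (auto simp: T'_def)
        then show "y \<in> f ` T" by blast
      qed
    qed
    have "openin (top_of_set S') T'"
      unfolding T'_def by (rule continuous_openin_preimage[OF f'c(1) _ T(2)]) (use ff' in auto)
    moreover have "y \<in> T'" using y T by (simp add: T'_def)
    moreover have "\<Union>V' = C' \<inter> (\<lambda>x. f (p (h x))) -` T'"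
    proof -
      have "x \<in> \<Union>V' \<longleftrightarrow> x \<in> C' \<and> h x \<in> C \<inter> p -` T" for x
        unfolding V(1)[symmetric] V'_def by auto
      moreover have "p (h x) \<in> T \<longleftrightarrow> f (p (h x)) \<in> T'" if "x \<in> C'" for x
      proof -
        have "p (h x) \<in> S" using that hC pS by simp
        then show ?thesis using f'f by (simp add: T'_def)
      qed
      ultimately show ?thesis using hC by (intro set_eqI) (simp, blast)
    qed
    moreover have "openin (top_of_set C') u" if u: "u \<in> V'" for u
    proof -
      obtain u0 where u0: "u0 \<in> V" "u = C' \<inter> h -` u0" using u by (auto simp: V'_def)
      show ?thesis unfolding u0(2)
        by (rule continuous_openin_preimage[OF hc(1) _ bspec[OF V(2) u0(1)]]) (use hC in auto)
    qed
    moreover have "pairwise disjnt V'"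
      unfolding V'_def
    proof (rule pairwise_imageI)
      fix a b assume "a \<in> V" "b \<in> V" "a \<noteq> b"
      then have "disjnt a b" using V(3) by (simp add: pairwise_def)
      then show "disjnt (C' \<inter> h -` a) (C' \<inter> h -` b)" by (auto simp: disjnt_iff)
    qed
    moreover have "\<exists>q. homeomorphism u T' (\<lambda>x. f (p (h x))) q" if u: "u \<in> V'" for u
    proof -
      obtain u0 where u0: "u0 \<in> V" "u = C' \<inter> h -` u0" using u by (auto simp: V'_def)
      obtain q where q: "homeomorphism u0 T p q" using bspec[OF V(4) u0(1)] by blast
      have "h ` u = u0"
      proof
        show "h ` u \<subseteq> u0" using u0(2) by blast
        show "u0 \<subseteq> h ` u"
        proof
          fix c assume c: "c \<in> u0"
          then obtain a where "a \<in> C'" "c = h a" using VC[OF u0(1)] hc(2) by blast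
          then show "c \<in> h ` u" using c u0(2) by blast
        qed
      qed
      then have hu: "homeomorphism u u0 h h'"
        by (intro homeomorphism_of_subsets[OF h]) (use VC[OF u0(1)] u0(2) in auto)
      have "homeomorphism T T' f f'"
        by (rule homeomorphism_of_subsets[OF f TS]) (use fT T'_def in auto)
      from homeomorphism_compose[OF homeomorphism_compose[OF hu q] this]
      show ?thesis by (auto simp: o_def)
    qed
    ultimately show ?thesis
      by (intro exI[of _ T'] conjI exI[of _ V'] ballI) simp_all
  qed
  moreover have "continuous_on C' (\<lambda>x. f (p (h x)))"
    using continuous_on_compose2[OF fc(1) continuous_on_compose2[OF p(1) hc(1)]] p hc by blast
  moreover have "(\<lambda>x. f (p (h x))) ` C' = S'"
  proof -
    have "(\<lambda>x. f (p (h x))) ` C' = f ` (p ` (h ` C'))" by (simp add: image_image)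
    then show ?thesis by (simp only: hc p fc)
  qed
  ultimately show ?thesis by (simp add: covering_space_def)
qed

definition round_cylinder :: "(real^3) set" where
  "round_cylinder = {p. (p $ 1)\<^sup>2 + (p $ 3)\<^sup>2 = 1 / 4}"

text \<open>This homeomorphism turns the complex exponential function into the standard parametrization of
  the cylinder, which therefore is a covering like the exponential function.\<close>

lemma homeomorphism_punctured_plane_cylinder:
  "homeomorphism (- {0}) round_cylinder
     (\<lambda>\<zeta>::complex. vector [Re \<zeta> / (2 * norm \<zeta>), ln (norm \<zeta>), Im \<zeta> / (2 * norm \<zeta>)] :: real^3)
     (\<lambda>p. complex_of_real (2 * exp (p $ 2)) * Complex (p $ 1) (p $ 3))"
proof (rule homeomorphismI)
  let ?F = "\<lambda>\<zeta>::complex. vector [Re \<zeta> / (2 * norm \<zeta>), ln (norm \<zeta>), Im \<zeta> / (2 * norm \<zeta>)] :: real^3"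
  let ?G = "\<lambda>p::real^3. complex_of_real (2 * exp (p $ 2)) * Complex (p $ 1) (p $ 3)"
  show "continuous_on (- {0}) ?F"
    by (intro continuous_on_vector_3 continuous_intros) auto
  show "continuous_on round_cylinder ?G"
    unfolding Complex_eq by (intro continuous_intros)
  have n: "norm (?G p) = exp (p $ 2)" if "p \<in> round_cylinder" for p
  proof -
    have "norm (Complex (p $ 1) (p $ 3)) = sqrt ((1/2)\<^sup>2)"
      using that by (simp add: round_cylinder_def complex_norm power_divide)
    then show ?thesis by (simp add: norm_mult)
  qed
  show "?F ` (- {0}) \<subseteq> round_cylinder"
  proof (rule image_subsetI)
    fix \<zeta> :: complex assume "\<zeta> \<in> - {0}"
    then have n: "(norm \<zeta>)\<^sup>2 \<noteq> 0" by simp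
    have "((Re \<zeta>)\<^sup>2 + (Im \<zeta>)\<^sup>2) / (4 * (norm \<zeta>)\<^sup>2) = 1 / 4"
      unfolding cmod_power2[symmetric] using n by simp
    then show "?F \<zeta> \<in> round_cylinder"
      by (simp add: round_cylinder_def power_divide power_mult_distrib add_divide_distrib)
  qed
  show "?G ` round_cylinder \<subseteq> - {0}"
  proof (rule image_subsetI)
    fix p :: "real^3" assume "p \<in> round_cylinder"
    then have "norm (?G p) \<noteq> 0" by (simp only: n exp_not_eq_zero not_False_eq_True)
    then have "?G p \<noteq> 0" unfolding norm_eq_zero .
    then show "?G p \<in> - {0}" by blast
  qed
  show "?G (?F \<zeta>) = \<zeta>" if "\<zeta> \<in> - {0}" for \<zeta>
    using that by (simp add: complex_eq_iff)
  show "?F (?G p) = p" if "p \<in> round_cylinder" for p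
    unfolding n[OF that] by (simp add: vec_eq_iff forall_3)
qed

lemma standard_cylinder_covering:
  "covering_space UNIV (twizzler_map 0 (\<lambda>s. cos (2 * s) / 2) (\<lambda>s. sin (2 * s) / 2)) round_cylinder"
proof -
  have h: "homeomorphism UNIV UNIV (\<lambda>(s, t). Complex t (2 * s)) (\<lambda>\<zeta>. (Im \<zeta> / 2, Re \<zeta>))"
    unfolding case_prod_unfold Complex_eq
    by (rule homeomorphismI) (auto intro!: continuous_intros simp: complex_eq_iff)
  have "twizzler_map 0 (\<lambda>s. cos (2 * s) / 2) (\<lambda>s. sin (2 * s) / 2) = (\<lambda>x. (\<lambda>\<zeta>::complex.
     vector [Re \<zeta> / (2 * norm \<zeta>), ln (norm \<zeta>), Im \<zeta> / (2 * norm \<zeta>)] :: real^3)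
       (exp ((\<lambda>(s, t). Complex t (2 * s)) x)))"
    by (auto simp: fun_eq_iff twizzler_map_def vec_eq_iff forall_3 Re_exp Im_exp)
  then show ?thesis
    using covering_space_homeomorphism_compose[OF covering_space_exp_punctured_plane h
        homeomorphism_punctured_plane_cylinder] by simp
qed

text \<open>With \<open>w = 0\<close> the twizzler map is a cylinder over its profile curve; the computations for profile
  curves thus show that this parametrization is an immersion.\<close>

lemma standard_cylinder:
  "twizzler_map 0 (\<lambda>s. cos (2 * s) / 2) (\<lambda>s. sin (2 * s) / 2) \<in> cylinder_surface"
proof -
  interpret profile 0 "\<lambda>s. cos (2 * s) / 2" "\<lambda>s. sin (2 * s) / 2" "\<lambda>s. - sin (2 * s)" "\<lambda>s. cos (2 * s)"
    "\<lambda>s. - (2 * cos (2 * s))" "\<lambda>s. - (2 * sin (2 * s))"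
    by unfold_locales (auto intro!: derivative_eq_intros continuous_intros)
  show ?thesis
    using immersion_twizzler standard_cylinder_covering
    by (simp add: cylinder_surface_def round_cylinder_def)
qed

lemma same_surface_reparametrization:
  assumes "C2_diffeo h" "\<psi> = \<phi> \<circ> h" shows "same_surface \<phi> \<psi>"
proof -
  have "rigid_motion (\<lambda>x. x)"
    unfolding rigid_motion_def
    by (rule exI[of _ "mat 1"], rule exI[of _ 0])
       (simp add: rotation_matrix_def orthogonal_matrix_id)
  moreover have "\<psi> = (\<lambda>x. x) \<circ> \<phi> \<circ> h" using assms(2) by (simp add: o_def)
  ultimately show ?thesis using assms(1) unfolding same_surface_def by blast
qed

text \<open>For \<open>e = 0\<close> the height is linear in \<open>u\<close> and \<open>\<theta>\<close>, so every pitch gives a linear reparametrization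
  of the same covering.\<close>

lemma cylinder_parametrized: "parametrizes (family \<epsilon> 0) cylinder_surface"
proof -
  define c where "c = sqrt (\<epsilon>\<^sup>2 + 1 / 4)"
  have c: "c > 0" unfolding c_def by (simp add: add_nonneg_pos)
  have r: "rad2 0 u = 1 / 4" "axial 0 u = 1 / 2" for u by (simp_all add: rad2_def axial_def)
  have hs: "height_slope \<epsilon> 0 = (\<lambda>_. c)" by (simp add: height_slope_def r c_def fun_eq_iff)
  have sq: "sqrt (1 / 4) = (1 / 2 :: real)" by (simp add: real_sqrt_divide)
  define h where "h = (\<lambda>(u::real, \<theta>::real). (1 / 2 * \<theta>, c * u + (- \<epsilon>) * \<theta>))"
  define j where "j = (\<lambda>(s::real, t::real). (1 / c * t + (2 * \<epsilon> / c) * s, 2 * s))"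
  have lin: "C2_map (\<lambda>x::real. a * x)" for a
    by (rule C2_map_bounded_linear) (rule bounded_linear_mult_right)
  have h: "C2_diffeo h"
  proof (rule C2_diffeoI)
    show "C2_map h" "C2_map j" unfolding h_def j_def case_prod_unfold
      by (intro C2_map_Pair C2_map_add C2_map_fst[OF lin] C2_map_snd[OF lin])+
    show "j (h p) = p" "h (j p) = p" for p
      using c by (auto simp: h_def j_def case_prod_unfold prod_eq_iff field_simps)
  qed
  have "family \<epsilon> 0 = twizzler_map 0 (\<lambda>s. cos (2 * s) / 2) (\<lambda>s. sin (2 * s) / 2) \<circ> h"
    by (auto simp: fun_eq_iff h_def family_def twizzler_map_def r hs prim_def sq vec_eq_iff forall_3
        simp del: real_sqrt_divide)
  then show ?thesis
    unfolding parametrizes_def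
    using same_surface_reparametrization[OF h] standard_cylinder by blast
qed


section \<open>Rolling conics\<close>

subsection \<open>The conic in polar coordinates about a focus\<close>

text \<open>The real and the imaginary part of \<open>- e / 2 + (1 - e\<^sup>2) / 2 * exp (\<i> u) / (1 - e cos u)\<close>: the conic
  in polar coordinates about the focus \<open>- e / 2\<close>, where \<open>1 - e cos u = 2 axial\<close>.  For a hyperbola
  negative \<open>axial\<close> gives the right branch and positive \<open>axial\<close> the left one.\<close>

definition pre :: "real \<Rightarrow> real \<Rightarrow> real" where
  "pre e u = - e / 2 + (1 - e\<^sup>2) * cos u / (4 * axial e u)"

definition pim :: "real \<Rightarrow> real \<Rightarrow> real" where
  "pim e u = (1 - e\<^sup>2) * sin u / (4 * axial e u)"

text \<open>A unit tangent vector of the conic.  It is chosen to be continuous across the poles of the polar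
  representation, at the price of a negative \<open>speed\<close> on hyperbolas.\<close>

definition tre :: "real \<Rightarrow> real \<Rightarrow> real" where
  "tre e u = - sin u / (2 * sqrt (rad2 e u))"

definition tim :: "real \<Rightarrow> real \<Rightarrow> real" where
  "tim e u = (cos u - e) / (2 * sqrt (rad2 e u))"

definition speed :: "real \<Rightarrow> real \<Rightarrow> real" where
  "speed e u = (1 - e\<^sup>2) * sqrt (rad2 e u) / (4 * (axial e u)\<^sup>2)"

lemma tangent_unit:
  assumes "e \<ge> 0" "e \<noteq> 1" shows "(tre e u)\<^sup>2 + (tim e u)\<^sup>2 = 1"
proof -
  have r: "rad2 e u > 0" by (rule rad2_pos[OF assms])
  have "(- sin u)\<^sup>2 + (cos u - e)\<^sup>2 = 4 * rad2 e u"
    by (simp add: rad2_def power2_eq_square algebra_simps)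
  then show ?thesis
    using r by (simp add: tre_def tim_def power_divide power_mult_distrib flip: add_divide_distrib)
qed

lemma pre_derivative:
  assumes "e \<ge> 0" "e \<noteq> 1" "axial e u \<noteq> 0"
  shows "(pre e has_real_derivative speed e u * tre e u) (at u)"
proof -
  have "(pre e has_real_derivative
     ((1 - e\<^sup>2) * - sin u * (4 * axial e u) - (1 - e\<^sup>2) * cos u * (4 * (e * sin u / 2))) / (4 * axial e u)\<^sup>2) (at u)"
    unfolding pre_def[abs_def] using assms(3)
    by (auto intro!: derivative_eq_intros axial_derivative simp: power2_eq_square)
  also have "(1 - e\<^sup>2) * - sin u * (4 * axial e u) - (1 - e\<^sup>2) * cos u * (4 * (e * sin u / 2))
      = - 2 * (1 - e\<^sup>2) * sin u"
    by (simp add: axial_def field_simps)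
  also have "- 2 * (1 - e\<^sup>2) * sin u / (4 * axial e u)\<^sup>2 = speed e u * tre e u"
    using rad2_pos[OF assms(1,2), of u] assms(3)
    by (simp add: speed_def tre_def field_simps power2_eq_square)
  finally show ?thesis .
qed

lemma pim_derivative:
  assumes "e \<ge> 0" "e \<noteq> 1" "axial e u \<noteq> 0"
  shows "(pim e has_real_derivative speed e u * tim e u) (at u)"
proof -
  have "(pim e has_real_derivative
     ((1 - e\<^sup>2) * cos u * (4 * axial e u) - (1 - e\<^sup>2) * sin u * (4 * (e * sin u / 2))) / (4 * axial e u)\<^sup>2) (at u)"
    unfolding pim_def[abs_def] using assms(3)
    by (auto intro!: derivative_eq_intros axial_derivative simp: power2_eq_square)
  also have "(1 - e\<^sup>2) * cos u * (4 * axial e u) - (1 - e\<^sup>2) * sin u * (4 * (e * sin u / 2))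
      = (1 - e\<^sup>2) * (2 * cos u - 2 * e * ((sin u)\<^sup>2 + (cos u)\<^sup>2))"
    unfolding axial_def by (simp add: field_simps power2_eq_square del: sin_cos_squared_add sin_cos_squared_add2 sin_cos_squared_add3)
  also have "\<dots> = 2 * (1 - e\<^sup>2) * (cos u - e)" by (simp add: algebra_simps)
  also have "2 * (1 - e\<^sup>2) * (cos u - e) / (4 * axial e u)\<^sup>2 = speed e u * tim e u"
    using rad2_pos[OF assms(1,2), of u] assms(3)
    by (simp add: speed_def tim_def field_simps power2_eq_square)
  finally show ?thesis .
qed

lemma pol_in_conic:
  assumes "e\<^sup>2 \<noteq> 1" "axial e u \<noteq> 0"
  shows "4 * (pre e u)\<^sup>2 - (pim e u)\<^sup>2 / ((e\<^sup>2 - 1) / 4) = 1"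
proof -
  define k where "k = (1 - e\<^sup>2) / (4 * axial e u)"
  have k: "1 - e\<^sup>2 = 2 * k * (1 - e * cos u)"
  proof -
    have "1 - e\<^sup>2 = k * (4 * axial e u)" using assms(2) by (simp add: k_def)
    then show ?thesis by (simp add: axial_def algebra_simps)
  qed
  have p: "pre e u = - e / 2 + k * cos u" "pim e u = k * sin u"
    by (simp_all add: pre_def pim_def k_def)
  have s: "(sin u)\<^sup>2 = 1 - (cos u)\<^sup>2" by (rule sin_squared_eq)
  have "(1 - e\<^sup>2) * (4 * (- e / 2 + k * cos u)\<^sup>2) + 4 * (k * sin u)\<^sup>2 = 1 - e\<^sup>2"
    using k s by algebra
  then show ?thesis using assms(1) unfolding p by (simp add: field_simps)
qed

text \<open>By the focus-directrix property the distance of \<open>x + \<i> y\<close> from the focus \<open>- e / 2\<close> is \<open>\<bar>1 / 2 + e x\<bar>\<close>.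
  Dividing by the signed quantity gives a unit vector also on the branch where it is negative.\<close>

lemma conic_polar:
  assumes xy: "4 * x\<^sup>2 - y\<^sup>2 / ((e\<^sup>2 - 1) / 4) = 1" and e: "e\<^sup>2 \<noteq> 1" and L: "1 / 2 + e * x \<noteq> 0"
  obtains u where "0 \<le> u" "u < 2 * pi" "pre e u = x" "pim e u = y"
    "axial e u = (1 - e\<^sup>2) / (4 * (1 / 2 + e * x))"
proof -
  define L where "L = 1 / 2 + e * x"
  have L0: "L \<noteq> 0" using L by (simp add: L_def)
  have y2: "4 * y\<^sup>2 = (e\<^sup>2 - 1) * (4 * x\<^sup>2 - 1)"
    using xy e by (simp add: field_simps)
  then have "y\<^sup>2 = (e\<^sup>2 - 1) * (4 * x\<^sup>2 - 1) / 4" by simp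
  then have "(x + e / 2)\<^sup>2 + y\<^sup>2 = L\<^sup>2"
    by (simp add: L_def power2_eq_square field_simps)
  then have "((x + e / 2) / L)\<^sup>2 + (y / L)\<^sup>2 = 1"
    using L0 by (simp add: power_divide flip: add_divide_distrib)
  then obtain u where u: "0 \<le> u" "u < 2 * pi" "(x + e / 2) / L = cos u" "y / L = sin u"
    using sincos_total_2pi by metis
  have "axial e u = (L - e * x - e\<^sup>2 / 2) / (2 * L)"
    using L0 by (simp add: axial_def u(3)[symmetric] field_simps power2_eq_square)
  also have "\<dots> = (1 - e\<^sup>2) / (4 * L)" using L0 by (simp add: L_def field_simps)
  finally have s: "axial e u = (1 - e\<^sup>2) / (4 * L)" .
  have "m / (4 * (m / (4 * L))) = L" if "m \<noteq> 0" for m :: real using that L0 by simp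
  from this[of "1 - e\<^sup>2"] e[symmetric] have k: "(1 - e\<^sup>2) / (4 * axial e u) = L"
    unfolding s right_minus_eq by blast
  have "pre e u = - e / 2 + L * cos u" "pim e u = L * sin u"
    unfolding k[symmetric] pre_def pim_def by simp_all
  then have "pre e u = x" "pim e u = y"
    unfolding u(3)[symmetric] u(4)[symmetric] using L0 by simp_all
  with u s that show thesis unfolding L_def by blast
qed

subsection \<open>The trace of the focus\<close>

text \<open>The meeting point of rolling and quadratures: relative to the line on which the conic rolls, the
  other focus \<open>e / 2\<close> has height \<open>sqrt (rad2 e u)\<close>, the distance of the surface from its axis.\<close>

lemma roll_focus:
  assumes e: "e \<ge> 0" "e \<noteq> 1" and P: "axial e u \<noteq> 0"
  shows "(complex_of_real (e / 2) - Complex (pre e u) (pim e u)) * cnj (Complex (tre e u) (tim e u))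
    = Complex (- (sqrt (rad2 e u) * e * sin u / (2 * axial e u))) (sqrt (rad2 e u))"
proof -
  define r where "r = sqrt (rad2 e u)"
  define P where "P = axial e u"
  define k where "k = (1 - e\<^sup>2) / (4 * P)"
  have r: "r > 0" "r\<^sup>2 = rad2 e u" using rad2_pos[OF e, of u] by (simp_all add: r_def)
  have P0: "P \<noteq> 0" using P by (simp add: P_def)
  have p: "pre e u = - e / 2 + k * cos u" "pim e u = k * sin u"
    by (simp_all add: pre_def pim_def k_def P_def)
  have t: "tre e u = - sin u / (2 * r)" "tim e u = (cos u - e) / (2 * r)"
    by (simp_all add: tre_def tim_def r_def)
  have kP: "k * (1 - e * cos u) = (1 - e\<^sup>2) / 2"
  proof -
    have "1 - e\<^sup>2 = k * (4 * P)" using P0 by (simp add: k_def)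
    then show ?thesis by (simp add: P_def axial_def algebra_simps)
  qed
  have k1: "k - 1 = - (r\<^sup>2 / P)"
  proof -
    have "1 - e\<^sup>2 = 4 * P - 4 * r\<^sup>2" unfolding r(2) by (simp add: P_def axial_def rad2_def field_simps)
    then show ?thesis unfolding k_def using P0 by (simp add: diff_divide_distrib)
  qed
  have "(e / 2 - pre e u) * tre e u + (- pim e u) * tim e u = e * sin u * (k - 1) / (2 * r)"
    unfolding p t using r(1) by (simp add: field_simps)
  also have "\<dots> = - (r * e * sin u / (2 * P))"
    unfolding k1 using r(1) P0 by (simp add: field_simps power2_eq_square)
  finally have re: "(e / 2 - pre e u) * tre e u + (- pim e u) * tim e u = - (r * e * sin u / (2 * P))" .
  have "(- pim e u) * tre e u - (e / 2 - pre e u) * tim e u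
      = (e\<^sup>2 - e * cos u - k * e * cos u + k * ((sin u)\<^sup>2 + (cos u)\<^sup>2)) / (2 * r)"
    unfolding p t using r(1)
    by (simp add: field_simps power2_eq_square del: sin_cos_squared_add sin_cos_squared_add2 sin_cos_squared_add3)
  also have "\<dots> = (e\<^sup>2 - e * cos u + k * (1 - e * cos u)) / (2 * r)"
    by (simp add: algebra_simps)
  also have "\<dots> = (2 * r\<^sup>2) / (2 * r)"
  proof -
    have "e\<^sup>2 - e * cos u + (1 - e\<^sup>2) / 2 = 2 * rad2 e u" by (simp add: rad2_def field_simps)
    then show ?thesis by (simp only: kP r(2))
  qed
  also have "\<dots> = r" using r(1) by (simp add: power2_eq_square)
  finally have im: "(- pim e u) * tre e u - (e / 2 - pre e u) * tim e u = r" .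
  show ?thesis
    using re im by (simp add: complex_eq_iff r_def P_def)
qed

text \<open>The abscissa of the trace of the focus is the arc length of the conic minus this function; its
  derivative is \<open>height_slope 0 e\<close>, as it has to be for the trace to be the meridian of the family.\<close>

lemma focus_offset_derivative:
  assumes e: "e \<ge> 0" "e \<noteq> 1" and P: "axial e u \<noteq> 0"
  shows "((\<lambda>u. sqrt (rad2 e u) * e * sin u / (2 * axial e u)) has_real_derivative
     speed e u - height_slope 0 e u) (at u)"
proof -
  define r where "r = sqrt (rad2 e u)"
  define P where "P = axial e u"
  have r: "r > 0" "r\<^sup>2 = rad2 e u" using rad2_pos[OF e, of u] by (simp_all add: r_def)
  have P0: "P \<noteq> 0" using P by (simp add: P_def)
  have s2: "(e * sin u)\<^sup>2 = 4 * (r\<^sup>2 - P\<^sup>2)"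
    unfolding r(2) P_def rad2_minus_axial_squared by (simp add: power_divide power_mult_distrib)
  have c: "e * cos u = 1 - 2 * P" by (simp add: P_def axial_def diff_divide_distrib)
  have e2: "1 - e\<^sup>2 = 4 * (P - r\<^sup>2)" unfolding r(2) P_def using rad2_minus_axial[of e u] by (simp add: field_simps)
  have "((\<lambda>u. sqrt (rad2 e u) * e * sin u / (2 * axial e u)) has_real_derivative
     (((e * sin u / (4 * r)) * e * sin u + r * e * cos u) * (2 * P) - r * e * sin u * (2 * (e * sin u / 2))) / (2 * P)\<^sup>2) (at u)"
  proof -
    define R where "R = (\<lambda>u. sqrt (rad2 e u))"
    have R: "(R has_real_derivative e * sin u / (4 * r)) (at u)" "R u = r"
      using rad_derivative[OF e, of u] by (simp_all add: R_def r_def)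
    have "((\<lambda>u. R u * e * sin u / (2 * axial e u)) has_real_derivative
       (((e * sin u / (4 * r)) * e * sin u + r * e * cos u) * (2 * P) - r * e * sin u * (2 * (e * sin u / 2))) / (2 * P)\<^sup>2) (at u)"
      using P by (auto intro!: derivative_eq_intros axial_derivative R(1)
          simp: P_def R(2) power2_eq_square)
    then show ?thesis by (simp only: R_def)
  qed
  also have "(((e * sin u / (4 * r)) * e * sin u + r * e * cos u) * (2 * P) - r * e * sin u * (2 * (e * sin u / 2))) / (2 * P)\<^sup>2
     = (((e * sin u)\<^sup>2 / (4 * r) + r * (e * cos u)) * (2 * P) - r * (e * sin u)\<^sup>2) / (2 * P)\<^sup>2"
    by (simp add: power2_eq_square algebra_simps)
  also have "\<dots> = (1 - e\<^sup>2) * r / (4 * P\<^sup>2) - P / (2 * r)"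
    unfolding s2 c e2 using r(1) P0 by (simp add: field_simps power2_eq_square)
  also have "P / (2 * r) = height_slope 0 e u"
    using r by (simp add: height_slope_def P_def r_def field_simps power2_eq_square)
  finally show ?thesis by (simp add: speed_def r_def P_def)
qed

text \<open>The rotation exchanges the first two coordinate axes, so that the axis of revolution becomes the
  axis of the family; being orientation preserving, it reverses the third axis and with it \<open>\<theta>\<close>.\<close>

lemma revolve_same_surface:
  assumes g: "bij g" "C2_map g" "C2_map (inv g)"
    and \<beta>: "\<And>u. \<beta> (g u) = Complex (prim (height_slope 0 e) u + c) (sqrt (rad2 e u))"
  shows "same_surface (revolve \<beta>) (family 0 e)"
proof -
  define Q :: "real^3^3" where "Q = vector [vector [0, 1, 0], vector [1, 0, 0], vector [0, 0, -1]]"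
  define h where "h = (\<lambda>(u, \<theta>). (g u, 0 + (- 1) * \<theta>) :: real \<times> real)"
  have Q: "Q *v vector [x, y, z] = vector [y, x, - z]" for x y z
    by (simp add: Q_def vec_eq_iff forall_3 matrix_vector_mult_def sum_3)
  have "transpose Q ** Q = mat 1"
    by (simp add: Q_def vec_eq_iff forall_3 matrix_matrix_mult_def sum_3 transpose_def mat_def)
  then have "rotation_matrix Q"
    by (simp add: rotation_matrix_def orthogonal_matrix det_3 Q_def)
  then have R: "rigid_motion (\<lambda>x. Q *v x + vector [0, - c, 0])"
    unfolding rigid_motion_def by blast
  have h: "C2_diffeo h"
    unfolding h_def by (rule C2_diffeo_shear[OF g]) (simp_all add: C2_map_const)
  have "family 0 e = (\<lambda>x. Q *v x + vector [0, - c, 0]) \<circ> revolve \<beta> \<circ> h"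
    by (auto simp: fun_eq_iff family_def revolve_def h_def \<beta> Q vec_eq_iff forall_3)
  with R h show ?thesis unfolding same_surface_def by blast
qed

subsection \<open>Unduloids\<close>

lemma Complex_has_vector_derivative:
  assumes "(a has_real_derivative a') F" "(b has_real_derivative b') F"
  shows "((\<lambda>s. Complex (a s) (b s)) has_vector_derivative Complex a' b') F"
  unfolding Complex_eq
  by (intro has_vector_derivative_add has_vector_derivative_mult_right has_vector_derivative_of_real assms)

lemma C2_map_Complex:
  assumes "C2_map a" "C2_map b" shows "C2_map (\<lambda>s. Complex (a s) (b s))"
proof -
  have "C2_map (\<lambda>s. a s *\<^sub>R 1 + b s *\<^sub>R \<i>)"
    by (intro C2_map_add C2_map_scaleR assms C2_map_const)
  then show ?thesis by (simp add: Complex_eq scaleR_conv_of_real mult.commute)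
qed

lemma norm_tangent: "e \<ge> 0 \<Longrightarrow> e \<noteq> 1 \<Longrightarrow> norm (Complex (tre e u) (tim e u)) = 1"
  by (simp add: complex_norm tangent_unit)

lemma unduloid_parametrized:
  assumes e: "0 < e" "e < 1" and M: "M = (e\<^sup>2 - 1) / 4"
  shows "\<exists>\<gamma>. arc_length_param \<gamma> (conic M) \<and>
    same_surface (revolve (roll \<gamma> (complex_of_real (e / 2)))) (family 0 e)"
proof -
  have e': "e \<ge> 0" "e \<noteq> 1" using e by auto
  have e2: "e\<^sup>2 < 1" using e by (simp add: power_less_one_iff)
  have P: "axial e u > 0" "axial e u \<le> 1" for u
  proof -
    have "\<bar>e * cos u\<bar> \<le> e * 1" unfolding abs_mult using e by (intro mult_mono) auto
    then show "axial e u > 0" "axial e u \<le> 1" using e by (auto simp: axial_def)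
  qed
  have Pnz: "axial e u \<noteq> 0" "4 * axial e u \<noteq> 0" "4 * (axial e u)\<^sup>2 \<noteq> 0" for u using P(1)[of u] by auto
  have r: "rad2 e u > 0" for u by (rule rad2_pos[OF e'])
  have speed: "C2_map (speed e)"
    unfolding speed_def[abs_def]
    by (intro C2_map_divide C2_map_mult C2_map_sqrt C2_map_const C2_map_rad2 C2_map_power2 C2_map_axial
        r Pnz)
  (* from axial <= 1 and sqrt (rad2 e u) >= (1 - e) / 2 *)
  define c where "c = (1 - e\<^sup>2) * (1 - e) / 8"
  have c: "c > 0" "c \<le> speed e u" for u
  proof -
    show "c > 0" using e e2 by (simp add: c_def)
    have "e * cos u \<le> e * 1" using e by (intro mult_left_mono) auto
    then have "((1 - e) / 2)\<^sup>2 \<le> rad2 e u"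
      by (simp add: rad2_def power2_eq_square field_simps)
    then have 1: "(1 - e) / 2 \<le> sqrt (rad2 e u)" by (rule real_le_rsqrt)
    have "(axial e u)\<^sup>2 \<le> 1\<^sup>2" using P[of u] by (intro power_mono) auto
    moreover have "0 \<le> (1 - e\<^sup>2) * sqrt (rad2 e u)"
      using e2 r[of u] by (intro mult_nonneg_nonneg) auto
    ultimately have "(1 - e\<^sup>2) * ((1 - e) / 2) / 4 \<le> (1 - e\<^sup>2) * sqrt (rad2 e u) / (4 * (axial e u)\<^sup>2)"
      using 1 e2 P(1)[of u] by (intro frac_le mult_left_mono) auto
    then show "c \<le> speed e u" by (simp add: c_def speed_def)
  qed
  define S where "S = prim (speed e)"
  define U where "U = inv S"
  note S = prim_inverse_C2[OF speed c, folded S_def, folded U_def]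
  have SU: "S (U s) = s" "U (S u) = u" for s u
    using S(1) by (simp_all add: U_def bij_is_surj surj_f_inv_f bij_is_inj)
  define \<gamma> where "\<gamma> s = Complex (pre e (U s)) (pim e (U s))" for s
  have \<gamma>': "(\<gamma> has_vector_derivative Complex (tre e (U s)) (tim e (U s))) (at s)" for s
  proof -
    have "((\<lambda>s. pre e (U s)) has_real_derivative speed e (U s) * tre e (U s) * (1 / speed e (U s))) (at s)"
      "((\<lambda>s. pim e (U s)) has_real_derivative speed e (U s) * tim e (U s) * (1 / speed e (U s))) (at s)"
      using DERIV_chain2[OF pre_derivative[OF e' Pnz(1)] S(3)]
        DERIV_chain2[OF pim_derivative[OF e' Pnz(1)] S(3)] by auto
    moreover have "speed e (U s) \<noteq> 0" using c(1) c(2)[of "U s"] by linarith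
    ultimately show ?thesis
      unfolding \<gamma>_def[abs_def] by (intro Complex_has_vector_derivative) simp_all
  qed
  have "C2_map \<gamma>"
    unfolding \<gamma>_def[abs_def]
  proof (intro C2_map_Complex)
    have "C2_map (pre e)" "C2_map (pim e)"
      unfolding pre_def[abs_def] pim_def[abs_def]
      by (intro C2_map_add C2_map_divide C2_map_mult C2_map_const C2_map_axial C2_map_cos C2_map_sin
          Pnz; simp)+
    then show "C2_map (\<lambda>s. pre e (U s))" "C2_map (\<lambda>s. pim e (U s))"
      using C2_map_compose S(2) by (auto simp: U_def)
  qed
  moreover have "norm (vector_derivative \<gamma> (at s)) = 1" for s
    using vector_derivative_at[OF \<gamma>'] norm_tangent[OF e'] by metis
  moreover have "range \<gamma> = conic M"
  proof
    show "range \<gamma> \<subseteq> conic M"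
      using pol_in_conic e2 Pnz(1) by (auto simp: \<gamma>_def conic_def M)
    show "conic M \<subseteq> range \<gamma>"
    proof
      fix \<zeta> assume "\<zeta> \<in> conic M"
      then have \<zeta>: "4 * (Re \<zeta>)\<^sup>2 - (Im \<zeta>)\<^sup>2 / ((e\<^sup>2 - 1) / 4) = 1" by (simp add: conic_def M)
      have "(Im \<zeta>)\<^sup>2 / ((e\<^sup>2 - 1) / 4) \<le> 0" using e2 by (intro divide_nonneg_neg) auto
      then have "(2 * Re \<zeta>)\<^sup>2 \<le> 1\<^sup>2" using \<zeta> by (simp add: power_mult_distrib)
      then have "\<bar>2 * Re \<zeta>\<bar> \<le> \<bar>1\<bar>" by (simp only: abs_le_square_iff)
      then have "\<bar>e * Re \<zeta>\<bar> \<le> e * (1 / 2)" unfolding abs_mult using e by (intro mult_mono) auto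
      then have "1 / 2 + e * Re \<zeta> \<noteq> 0" using e by auto
      with \<zeta> e2 obtain u where "pre e u = Re \<zeta>" "pim e u = Im \<zeta>" using conic_polar by (metis less_irrefl)
      then have "\<zeta> = \<gamma> (S u)" by (simp add: \<gamma>_def SU complex_eq_iff)
      then show "\<zeta> \<in> range \<gamma>" by blast
    qed
  qed
  ultimately have al: "arc_length_param \<gamma> (conic M)"
    by (simp add: arc_length_param_def C2_map_imp_C1)
  define off where "off u = sqrt (rad2 e u) * e * sin u / (2 * axial e u)" for u
  have offd: "(off has_real_derivative speed e u - height_slope 0 e u) (at u)" for u
    unfolding off_def[abs_def] by (rule focus_offset_derivative[OF e' Pnz(1)])
  have "S u - off u = prim (height_slope 0 e) u" for u
  proof -
    have "((\<lambda>u. S u - off u - prim (height_slope 0 e) u) has_real_derivative 0) (at u)" for u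
      unfolding S_def
      by (auto intro!: derivative_eq_intros offd prim_has_derivative speed C2_map_height_slope e')
    then have "S u - off u - prim (height_slope 0 e) u = S 0 - off 0 - prim (height_slope 0 e) 0"
      by (intro DERIV_isconst_all) blast
    then show ?thesis by (simp add: S_def off_def)
  qed
  moreover have "roll \<gamma> (complex_of_real (e / 2)) (S u) = complex_of_real (S u) + Complex (- off u) (sqrt (rad2 e u))" for u
    unfolding roll_def vector_derivative_at[OF \<gamma>'] using roll_focus[OF e' Pnz(1)]
    by (simp add: \<gamma>_def SU off_def)
  ultimately have "roll \<gamma> (complex_of_real (e / 2)) (S u) = Complex (prim (height_slope 0 e) u + 0) (sqrt (rad2 e u))" for u
    by (metis (no_types, lifting) add.right_neutral complex_eq_iff complex.sel complex_of_real_def plus_complex.sel diff_conv_add_uminus add_0)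
  from revolve_same_surface[OF S(1) _ _ this]
  have "same_surface (revolve (roll \<gamma> (complex_of_real (e / 2)))) (family 0 e)"
    using S(2) speed by (simp add: S_def U_def C2_map_prim)
  with al show ?thesis by blast
qed


subsection \<open>Nodoids\<close>

lemma pre_alt: "axial e u \<noteq> 0 \<Longrightarrow> pre e u = (cos u - e) / (4 * axial e u)"
proof -
  assume P: "axial e u \<noteq> 0"
  have "- e / 2 * (4 * axial e u) + (1 - e\<^sup>2) * cos u = cos u - e"
    by (simp add: axial_def field_simps power2_eq_square)
  then have "(cos u - e) / (4 * axial e u) = (- e / 2 * (4 * axial e u) + (1 - e\<^sup>2) * cos u) / (4 * axial e u)"
    by simp
  also have "\<dots> = pre e u" using P by (simp add: pre_def field_simps)
  finally show ?thesis by simp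
qed

locale hyperbola =
  fixes e :: real
  assumes e: "1 < e"
begin

lemma e': "e \<ge> 0" "e \<noteq> 1" "e\<^sup>2 \<noteq> 1" "e\<^sup>2 > 1"
  using e by (auto simp: one_less_power power2_eq_1_iff)

text \<open>The direction, seen from a focus, in which the hyperbola goes to infinity.  There \<open>axial\<close> vanishes and
  the two kinds of arcs of the nodary meet with a tangent orthogonal to the axis.\<close>

definition v0 :: real where "v0 = arccos (1 / e)"

lemma v0: "0 < v0" "v0 < pi / 2" "cos v0 = 1 / e"
proof -
  have b: "-1 \<le> 1 / e" "1 / e \<le> 1" "0 < 1 / e" "1 / e < 1" using e by (auto simp: field_simps)
  show c: "cos v0 = 1 / e" unfolding v0_def using b by (intro cos_arccos)
  have "0 \<le> v0" unfolding v0_def using b by (intro arccos_lbound)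
  moreover have "v0 \<noteq> 0" using c b by auto
  ultimately show "0 < v0" by simp
  have "arccos (1 / e) < arccos 0" using b by (intro arccos_less_arccos) auto
  then show "v0 < pi / 2" by (simp add: v0_def)
qed

lemma axial_neg_iff: "axial e u < 0 \<longleftrightarrow> cos v0 < cos u" and axial_pos_iff: "axial e u > 0 \<longleftrightarrow> cos u < cos v0"
  using e by (auto simp: axial_def v0(3) field_simps)

lemma axial_arc1: "u \<in> {- v0<..<v0} \<Longrightarrow> axial e u < 0"
proof -
  assume "u \<in> {- v0<..<v0}"
  then have "cos v0 < cos \<bar>u\<bar>" using v0 by (intro cos_monotone_0_pi) auto
  then show ?thesis by (simp add: axial_neg_iff)
qed

lemma axial_arc2: "u \<in> {v0<..<2 * pi - v0} \<Longrightarrow> axial e u > 0"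
proof -
  assume u: "u \<in> {v0<..<2 * pi - v0}"
  have "cos u < cos v0"
  proof (cases "u \<le> pi")
    case True then show ?thesis using u v0 by (intro cos_monotone_0_pi) auto
  next
    case False
    then have "cos (2 * pi - u) < cos v0" using u v0 by (intro cos_monotone_0_pi) auto
    then show ?thesis by simp
  qed
  then show ?thesis by (simp add: axial_pos_iff)
qed

lemma arc1_angle:
  assumes "0 \<le> u" "u < 2 * pi" "axial e u < 0"
  shows "\<exists>u'\<in>{- v0<..<v0}. cos u' = cos u \<and> sin u' = sin u"
proof -
  have c: "cos v0 < cos u" using assms(3) by (simp add: axial_neg_iff)
  show ?thesis
  proof (cases "u \<le> pi")
    case True
    have "u < v0"
    proof (rule ccontr)
      assume "\<not> u < v0"
      then have "cos u \<le> cos v0" using True v0 by (intro cos_monotone_0_pi_le) auto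
      then show False using c by simp
    qed
    then show ?thesis using assms v0 by (intro bexI[of _ u]) auto
  next
    case False
    have "2 * pi - u < v0"
    proof (rule ccontr)
      assume "\<not> 2 * pi - u < v0"
      then have "cos (2 * pi - u) \<le> cos v0" using False v0 by (intro cos_monotone_0_pi_le) auto
      then show False using c by simp
    qed
    then show ?thesis using assms v0 by (intro bexI[of _ "u - 2 * pi"]) (auto simp: cos_diff sin_diff)
  qed
qed

lemma arc2_angle:
  assumes "0 \<le> u" "u < 2 * pi" "axial e u > 0"
  shows "u \<in> {v0<..<2 * pi - v0}"
proof -
  have c: "cos u < cos v0" using assms(3) by (simp add: axial_pos_iff)
  have "v0 < u"
  proof (rule ccontr)
    assume "\<not> v0 < u"
    then have "cos v0 \<le> cos u" using assms v0 by (intro cos_monotone_0_pi_le) auto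
    then show False using c by simp
  qed
  moreover have "v0 < 2 * pi - u"
  proof (rule ccontr)
    assume "\<not> v0 < 2 * pi - u"
    then have "cos v0 \<le> cos (2 * pi - u)" using assms v0 by (intro cos_monotone_0_pi_le) auto
    then show False using c by simp
  qed
  ultimately show ?thesis by auto
qed

definition M :: real where "M = (e\<^sup>2 - 1) / 4"

lemma M_pos: "M > 0" using e' by (simp add: M_def)

text \<open>The branch is a graph over its conjugate axis.  It is run through downwards, because then the arc
  length at the contact point decreases in \<open>u\<close>, in accordance with the negative \<open>speed\<close>.\<close>

definition xh :: "real \<Rightarrow> real" where "xh y = sqrt (1 + y\<^sup>2 / M) / 2"
definition xh' :: "real \<Rightarrow> real" where "xh' y = y / (4 * M * xh y)"
definition len' :: "real \<Rightarrow> real" where "len' y = sqrt (1 + (xh' y)\<^sup>2)"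
definition len :: "real \<Rightarrow> real" where "len = prim len'"
definition \<gamma> :: "real \<Rightarrow> complex" where "\<gamma> s = Complex (xh (inv len s)) (- inv len s)"

lemma radicand_pos: "1 + y\<^sup>2 / M > 0"
  using M_pos by (intro add_pos_nonneg) auto

lemma xh_ge: "xh y \<ge> 1 / 2"
  using M_pos by (simp add: xh_def)

lemma xh_sq: "4 * (xh y)\<^sup>2 - y\<^sup>2 / M = 1"
  using radicand_pos[of y] by (simp add: xh_def power_divide add_divide_distrib)

lemma xh_derivative: "(xh has_real_derivative xh' y) (at y)"
proof -
  have "(xh has_real_derivative (2 * y / M) / (2 * sqrt (1 + y\<^sup>2 / M)) / 2) (at y)"
    unfolding xh_def[abs_def] using radicand_pos[of y] M_pos
    by (auto intro!: derivative_eq_intros simp: inverse_eq_divide)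
  also have "(2 * y / M) / (2 * sqrt (1 + y\<^sup>2 / M)) / 2 = xh' y"
    unfolding xh'_def xh_def using radicand_pos[of y] M_pos by (simp add: field_simps)
  finally show ?thesis .
qed

lemma continuous_xh: "continuous_on UNIV xh" "continuous_on UNIV xh'" "continuous_on UNIV len'"
proof -
  show 1: "continuous_on UNIV xh"
    using xh_derivative by (meson DERIV_isCont continuous_at_imp_continuous_on)
  have "4 * M * xh y \<noteq> 0" for y using M_pos xh_ge[of y] by simp
  then show 2: "continuous_on UNIV xh'" unfolding xh'_def[abs_def]
    by (intro continuous_intros 1) auto
  then show "continuous_on UNIV len'" unfolding len'_def[abs_def]
    by (intro continuous_intros)
qed

lemma len'_ge: "1 \<le> len' y" unfolding len'_def by simp

lemma len_derivative: "(len has_real_derivative len' y) (at y)"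
  unfolding len_def by (rule has_real_derivative_prim[OF continuous_xh(3)])

lemmas len_inverse = bij_and_inverse_of_derivative_bound[of len len', OF len_derivative zero_less_one len'_ge]

lemma len_inv: "inv len (len y) = y" "len (inv len s) = s"
  using len_inverse(1) by (simp_all add: bij_is_inj bij_is_surj surj_f_inv_f)

lemma \<gamma>_derivative:
  "(\<gamma> has_vector_derivative Complex (xh' (inv len s) / len' (inv len s)) (- (1 / len' (inv len s)))) (at s)"
  unfolding \<gamma>_def[abs_def]
  using DERIV_chain2[OF xh_derivative len_inverse(2)[of s]] DERIV_minus[OF len_inverse(2)[of s]]
  by (intro Complex_has_vector_derivative) auto

lemma arc_length_\<gamma>: "arc_length_param \<gamma> (hyperbola_branch M)"
  unfolding arc_length_param_def
proof (intro conjI allI)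
  have il: "continuous_on UNIV (inv len)"
    using len_inverse(2) by (meson DERIV_isCont continuous_at_imp_continuous_on)
  have nz: "len' y \<noteq> 0" for y using len'_ge[of y] by auto
  have "continuous_on UNIV (\<lambda>s. xh' (inv len s))" "continuous_on UNIV (\<lambda>s. len' (inv len s))"
    using continuous_on_compose2[OF continuous_xh(2) il] continuous_on_compose2[OF continuous_xh(3) il] by auto
  then have "continuous_on UNIV (\<lambda>s. Complex (xh' (inv len s) / len' (inv len s)) (- (1 / len' (inv len s))))"
    unfolding Complex_eq by (intro continuous_intros) (auto simp: nz)
  with \<gamma>_derivative show "C1_map \<gamma>" by (rule C1_map_vectorI)
  fix s
  let ?y = "inv len s"
  have "(xh' ?y / len' ?y)\<^sup>2 + (- (1 / len' ?y))\<^sup>2 = (1 + (xh' ?y)\<^sup>2) / (len' ?y)\<^sup>2"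
    by (simp add: power_divide add_divide_distrib)
  also have "1 + (xh' ?y)\<^sup>2 = (len' ?y)\<^sup>2" by (simp add: len'_def)
  finally have "(xh' ?y / len' ?y)\<^sup>2 + (- (1 / len' ?y))\<^sup>2 = 1" using nz by simp
  then show "norm (vector_derivative \<gamma> (at s)) = 1"
    unfolding vector_derivative_at[OF \<gamma>_derivative] by (simp only: complex_norm complex.sel real_sqrt_one)
next
  show "range \<gamma> = hyperbola_branch M"
  proof
    show "range \<gamma> \<subseteq> hyperbola_branch M"
    proof (rule image_subsetI)
      fix s
      have "0 < xh (inv len s)" using xh_ge[of "inv len s"] by simp
      then show "\<gamma> s \<in> hyperbola_branch M"
        by (simp add: \<gamma>_def hyperbola_branch_def conic_def xh_sq)
    qed
    show "hyperbola_branch M \<subseteq> range \<gamma>"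
    proof
      fix \<zeta> assume "\<zeta> \<in> hyperbola_branch M"
      then have z: "4 * (Re \<zeta>)\<^sup>2 - (Im \<zeta>)\<^sup>2 / M = 1" "0 < Re \<zeta>"
        by (auto simp: hyperbola_branch_def conic_def)
      then have "1 + (- Im \<zeta>)\<^sup>2 / M = (2 * Re \<zeta>)\<^sup>2" by (simp add: power_mult_distrib)
      then have "sqrt (1 + (- Im \<zeta>)\<^sup>2 / M) = 2 * Re \<zeta>" using z(2) by (simp only: real_sqrt_abs; simp)
      then have "xh (- Im \<zeta>) = Re \<zeta>" by (simp add: xh_def)
      then have "\<gamma> (len (- Im \<zeta>)) = \<zeta>" by (simp add: \<gamma>_def len_inv complex_eq_iff)
      then show "\<zeta> \<in> range \<gamma>" by (metis rangeI)
    qed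
  qed
qed

text \<open>The arc length at the point of contact.  As reflection in the conjugate axis preserves the
  imaginary part, one formula holds on the arc of \<open>u\<close> that belongs to the right branch and on the arc
  that belongs to the left branch, the latter being reflected to the right branch.\<close>

definition contact :: "real \<Rightarrow> real" where "contact u = len (- pim e u)"

text \<open>The sign \<open>b\<close> is \<open>1\<close> on the right branch and \<open>- 1\<close> on the reflected left branch.  The tangent of \<open>\<gamma>\<close>
  comes out of implicit differentiation of \<open>xh (- pim e u) = b * pre e u\<close>.\<close>

lemma contact_arc:
  assumes b: "b\<^sup>2 = 1" and axial: "\<forall>u\<in>{l<..<h}. axial e u \<noteq> 0" and pre: "\<forall>u\<in>{l<..<h}. 0 < b * pre e u"
    and onto: "\<And>y. \<exists>u\<in>{l<..<h}. pim e u = y"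
  shows "\<And>u. u \<in> {l<..<h} \<Longrightarrow> \<gamma> (contact u) = Complex (b * pre e u) (pim e u)"
    "\<And>u. u \<in> {l<..<h} \<Longrightarrow> vector_derivative \<gamma> (at (contact u)) = Complex (b * tre e u) (tim e u)"
    "\<And>u. u \<in> {l<..<h} \<Longrightarrow> (contact has_real_derivative speed e u) (at u)"
    "continuous_on {l<..<h} contact" "bij_betw contact {l<..<h} UNIV"
proof -
  note P = bspec[OF axial] bspec[OF pre]
  have xh: "xh (- pim e u) = b * pre e u" if u: "u \<in> {l<..<h}" for u
  proof -
    have "4 * (pre e u)\<^sup>2 - (pim e u)\<^sup>2 / M = 1"
      unfolding M_def by (rule pol_in_conic[OF e'(3) P(1)[OF u]])
    then have "1 + (- pim e u)\<^sup>2 / M = (2 * (b * pre e u))\<^sup>2" using b by (simp add: power_mult_distrib)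
    then have "sqrt (1 + (- pim e u)\<^sup>2 / M) = 2 * (b * pre e u)"
      using P(2)[OF u] by (simp only: real_sqrt_abs; simp)
    then show ?thesis by (simp add: xh_def)
  qed
  show 1: "\<gamma> (contact u) = Complex (b * pre e u) (pim e u)" if "u \<in> {l<..<h}" for u
    by (simp add: \<gamma>_def contact_def len_inv xh[OF that])
  have speed: "speed e u < 0" if "u \<in> {l<..<h}" for u
  proof -
    have "(axial e u)\<^sup>2 > 0" using P(1)[OF that] by simp
    moreover have "sqrt (rad2 e u) > 0" using rad2_pos e' by simp
    moreover have "1 - e\<^sup>2 < 0" using e' by simp
    ultimately show ?thesis unfolding speed_def by (simp add: divide_neg_pos mult_neg_pos)
  qed
  have tim: "tim e u < 0" for u
  proof -
    have "cos u - e < 0" using e cos_le_one[of u] by linarith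
    then show ?thesis unfolding tim_def using rad2_pos[OF e'(1,2), of u] by (simp add: divide_neg_pos)
  qed
  have slope: "xh' (- pim e u) = - (b * tre e u) / tim e u" "len' (- pim e u) = - (1 / tim e u)"
    if u: "u \<in> {l<..<h}" for u
  proof -
    have "((\<lambda>u. xh (- pim e u)) has_real_derivative xh' (- pim e u) * (- (speed e u * tim e u))) (at u)"
      by (intro DERIV_chain2[OF xh_derivative] DERIV_minus pim_derivative e' P u)
    moreover have "((\<lambda>u. xh (- pim e u)) has_real_derivative b * (speed e u * tre e u)) (at u)"
      by (rule has_field_derivative_transform_within_open[of "\<lambda>u. b * pre e u" _ _ "{l<..<h}"])
         (use u P in \<open>auto intro!: DERIV_cmult pre_derivative e' simp: xh\<close>)
    ultimately have "xh' (- pim e u) * (- (speed e u * tim e u)) = b * (speed e u * tre e u)"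
      using DERIV_unique by blast
    then have "speed e u * (tim e u * xh' (- pim e u)) = speed e u * (- (b * tre e u))"
      by (simp add: algebra_simps)
    then have "tim e u * xh' (- pim e u) = - (b * tre e u)"
      using speed[OF u] by (simp only: mult_cancel_left) auto
    then show x: "xh' (- pim e u) = - (b * tre e u) / tim e u"
      using tim[of u] by (simp add: field_simps)
    have "1 + (xh' (- pim e u))\<^sup>2 = ((tim e u)\<^sup>2 + b\<^sup>2 * (tre e u)\<^sup>2) / (tim e u)\<^sup>2"
      using tim[of u] unfolding x by (simp add: power_divide power_mult_distrib add_divide_distrib)
    also have "(tim e u)\<^sup>2 + b\<^sup>2 * (tre e u)\<^sup>2 = 1"
      using tangent_unit[OF e'(1,2), of u] b by simp
    finally have "len' (- pim e u) = sqrt (1 / (tim e u)\<^sup>2)" by (simp add: len'_def)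
    then show "len' (- pim e u) = - (1 / tim e u)" using tim[of u] by (simp add: real_sqrt_divide)
  qed
  show "vector_derivative \<gamma> (at (contact u)) = Complex (b * tre e u) (tim e u)" if u: "u \<in> {l<..<h}" for u
    unfolding vector_derivative_at[OF \<gamma>_derivative] contact_def len_inv slope[OF u]
    using tim[of u] by (simp add: complex_eq_iff)
  show d: "(contact has_real_derivative speed e u) (at u)" if u: "u \<in> {l<..<h}" for u
  proof -
    have "(contact has_real_derivative len' (- pim e u) * (- (speed e u * tim e u))) (at u)"
      unfolding contact_def[abs_def]
      by (intro DERIV_chain2[OF len_derivative] DERIV_minus pim_derivative e' P u)
    then show ?thesis unfolding slope[OF u] using tim[of u] by simp
  qed
  show "continuous_on {l<..<h} contact"
    using d by (meson DERIV_isCont continuous_at_imp_continuous_on)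
  have dec: "contact y < contact x" if "x \<in> {l<..<h}" "y \<in> {l<..<h}" "x < y" for x y
  proof (rule DERIV_neg_imp_decreasing[OF that(3)])
    fix u assume "x \<le> u" "u \<le> y"
    then have "u \<in> {l<..<h}" using that by auto
    then show "\<exists>D. (contact has_real_derivative D) (at u) \<and> D < 0" using d speed by blast
  qed
  show "bij_betw contact {l<..<h} UNIV"
    unfolding bij_betw_def
  proof
    show "inj_on contact {l<..<h}"
      by (rule linorder_inj_onI') (use dec in force)
    show "contact ` {l<..<h} = UNIV"
    proof (rule UNIV_eq_I[symmetric])
      fix s
      obtain u where "u \<in> {l<..<h}" "pim e u = - inv len s" using onto by blast
      then show "s \<in> contact ` {l<..<h}" by (force simp: contact_def len_inv)
    qed
  qed
qed

lemma pim_arc1: "\<exists>u\<in>{- v0<..<v0}. pim e u = y"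
proof -
  have "1 / 2 + e * xh y > 0" using xh_ge[of y] e by (intro add_pos_pos mult_pos_pos) auto
  moreover obtain u where u: "0 \<le> u" "u < 2 * pi" "pim e u = y"
    "axial e u = (1 - e\<^sup>2) / (4 * (1 / 2 + e * xh y))"
    using conic_polar[OF xh_sq[unfolded M_def] e'(3), of y] calculation by (metis less_irrefl)
  ultimately have "axial e u < 0" using e' by (simp add: divide_neg_pos)
  from arc1_angle[OF u(1,2) this] obtain u' where u': "u' \<in> {- v0<..<v0}" "cos u' = cos u" "sin u' = sin u"
    by blast
  then have "pim e u' = y" using u(3) by (simp add: pim_def axial_def)
  with u' show ?thesis by blast
qed

lemma pim_arc2: "\<exists>u\<in>{v0<..<2 * pi - v0}. pim e u = y"
proof -
  have "e * (1 / 2) \<le> e * xh y" using xh_ge[of y] e by (intro mult_left_mono) auto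
  then have L: "1 / 2 + e * (- xh y) < 0" using e by linarith
  have "4 * (- xh y)\<^sup>2 - y\<^sup>2 / ((e\<^sup>2 - 1) / 4) = 1" using xh_sq[of y] by (simp add: M_def)
  then obtain u where u: "0 \<le> u" "u < 2 * pi" "pim e u = y"
    "axial e u = (1 - e\<^sup>2) / (4 * (1 / 2 + e * (- xh y)))"
    using conic_polar[of "- xh y" y e] L e'(3) by (metis less_irrefl)
  have "axial e u > 0" unfolding u(4) using e' L by (intro divide_neg_neg) auto
  from arc2_angle[OF u(1,2) this] u(3) show ?thesis by blast
qed

lemma cos_minus_e: "cos u - e < 0"
  using e cos_le_one[of u] by linarith

lemma arc1:
  "\<forall>u\<in>{- v0<..<v0}. axial e u \<noteq> 0" "\<forall>u\<in>{- v0<..<v0}. 0 < 1 * pre e u"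
  using axial_arc1 cos_minus_e by (force simp: pre_alt divide_neg_neg)+

lemma arc2:
  "\<forall>u\<in>{v0<..<2 * pi - v0}. axial e u \<noteq> 0"
  "\<forall>u\<in>{v0<..<2 * pi - v0}. 0 < (- 1) * pre e u"
  using axial_arc2 cos_minus_e by (force simp: pre_alt divide_neg_pos)+

lemma minus_one_squared: "(- 1 :: real)\<^sup>2 = 1" by simp

lemmas contact_arc1 = contact_arc[OF power_one arc1 pim_arc1]
lemmas contact_arc2 = contact_arc[OF minus_one_squared arc2 pim_arc2]

definition Y :: "real \<Rightarrow> real" where "Y = prim (height_slope 0 e)"

lemma Y_derivative: "(Y has_real_derivative height_slope 0 e u) (at u)"
  unfolding Y_def by (rule prim_has_derivative[OF C2_map_height_slope[OF e'(1,2)]])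

lemma height_constant:
  assumes "\<And>u. u \<in> {l<..<h} \<Longrightarrow> axial e u \<noteq> 0"
    "\<And>u. u \<in> {l<..<h} \<Longrightarrow> (contact has_real_derivative speed e u) (at u)"
  shows "\<exists>c. \<forall>u\<in>{l<..<h}. Y u = contact u - sqrt (rad2 e u) * e * sin u / (2 * axial e u) + c"
proof -
  define off where "off u = sqrt (rad2 e u) * e * sin u / (2 * axial e u)" for u
  have offd: "(off has_real_derivative speed e u - height_slope 0 e u) (at u)" if "u \<in> {l<..<h}" for u
    unfolding off_def[abs_def] by (rule focus_offset_derivative[OF e'(1,2) assms(1)[OF that]])
  have "((\<lambda>u. Y u - contact u + off u) has_real_derivative 0) (at u within {l<..<h})" if "u \<in> {l<..<h}" for u
  proof -
    have "((\<lambda>u. Y u - contact u + off u) has_real_derivative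
        height_slope 0 e u - speed e u + (speed e u - height_slope 0 e u)) (at u)"
      by (intro DERIV_add DERIV_diff Y_derivative assms(2) offd that)
    then show ?thesis by (simp add: has_field_derivative_at_within)
  qed
  moreover have "convex {l<..<h}" by (rule convex_real_interval)
  ultimately obtain c where c: "\<forall>u\<in>{l<..<h}. Y u - contact u + off u = c"
    using has_field_derivative_zero_constant[of "{l<..<h}" "\<lambda>u. Y u - contact u + off u"] by blast
  have "Y u = contact u - off u + c" if "u \<in> {l<..<h}" for u
    using bspec[OF c that] by simp
  then show ?thesis unfolding off_def by blast
qed

lemma bij_betw_shift: "bij_betw f {l<..<h} UNIV \<Longrightarrow> bij_betw (\<lambda>t. f (t - d)) {l + d<..<h + d} UNIV" for f :: "real \<Rightarrow> real"
proof -
  assume f: "bij_betw f {l<..<h} UNIV"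
  have "bij_betw (\<lambda>t. t - d) {l + d<..<h + d} {l<..<h}"
    by (rule bij_betw_byWitness[where f' = "\<lambda>t. t + d"]) auto
  from bij_betw_trans[OF this f] show ?thesis by (simp add: o_def)
qed

text \<open>The shift by \<open>v0\<close> lets a period begin at the left end of the arc around \<open>u = 0\<close>.\<close>

definition \<beta> :: "real \<Rightarrow> complex" where
  "\<beta> t = Complex (Y (t - v0)) (sqrt (rad2 e (t - v0)))"

text \<open>On both arcs the traces have the same abscissa up to a constant and the same height as the
  meridian of the family: for the second arc, reflecting the conic in its conjugate axis exchanges the
  foci and reverses the direction of rolling, which the reflection of the trace in the line undoes.
  The meridian is smooth and regular also at the junctions, because there \<open>axial = 0\<close> and hence the
  derivative of \<open>rad2\<close> does not vanish.\<close>

lemma nodary: "\<beta> \<in> nodary M"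
proof -
  have shift: "C2_map (\<lambda>t. t - v0)" by (intro C2_map_diff C2_map_ident C2_map_const)
  have r: "rad2 e u > 0" for u by (rule rad2_pos[OF e'(1,2)])
  have fM: "focus M = complex_of_real (e / 2)"
  proof -
    have "1 / 4 + M = (e / 2)\<^sup>2" by (simp add: M_def power_divide field_simps)
    then show ?thesis using e by (simp add: focus_def)
  qed
  have 1: "C2_map \<beta>" unfolding \<beta>_def[abs_def] Y_def
    by (intro C2_map_Complex C2_map_compose[OF _ shift] C2_map_prim C2_map_height_slope e'
        C2_map_sqrt C2_map_compose[OF C2_map_rad2 shift] r)
  have 2: "vector_derivative \<beta> (at t) \<noteq> 0" for t
  proof -
    let ?u = "t - v0"
    have "((\<lambda>t. Y (t - v0)) has_real_derivative height_slope 0 e ?u * 1) (at t)"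
      by (rule DERIV_chain2[OF Y_derivative]) (auto intro!: derivative_eq_intros)
    moreover have "((\<lambda>t. sqrt (rad2 e (t - v0))) has_real_derivative e * sin ?u / (4 * sqrt (rad2 e ?u)) * 1) (at t)"
      by (rule DERIV_chain2[OF rad_derivative[OF e'(1,2)]]) (auto intro!: derivative_eq_intros)
    ultimately have "(\<beta> has_vector_derivative Complex (height_slope 0 e ?u * 1) (e * sin ?u / (4 * sqrt (rad2 e ?u)) * 1)) (at t)"
      unfolding \<beta>_def[abs_def] by (rule Complex_has_vector_derivative)
    then have v: "vector_derivative \<beta> (at t) = Complex (height_slope 0 e ?u) (e * sin ?u / (4 * sqrt (rad2 e ?u)))"
      by (simp add: vector_derivative_at)
    show ?thesis
    proof
      assume "vector_derivative \<beta> (at t) = 0"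
      then have "axial e ?u = 0" "e * sin ?u = 0"
        using r[of ?u] by (auto simp: v complex_eq_iff height_slope_def)
      then have "rad2 e ?u = 0" using rad2_minus_axial_squared[of e ?u] by simp
      then show False using r[of ?u] by simp
    qed
  qed
  have 3: "\<beta> (t + 2 * pi) = \<beta> t + complex_of_real (Y (2 * pi))" for t
  proof -
    have "((\<lambda>u. Y (u + 2 * pi) - Y u) has_real_derivative 0) (at u)" for u
    proof -
      have "((\<lambda>u. Y (u + 2 * pi)) has_real_derivative height_slope 0 e (u + 2 * pi) * 1) (at u)"
        by (rule DERIV_chain2[OF Y_derivative]) (auto intro!: derivative_eq_intros)
      moreover have "height_slope 0 e (u + 2 * pi) = height_slope 0 e u"
        by (simp add: height_slope_def axial_def rad2_def)
      ultimately show ?thesis using DERIV_diff[OF _ Y_derivative] by fastforce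
    qed
    then have "(\<lambda>u. Y (u + 2 * pi) - Y u) (t - v0) = (\<lambda>u. Y (u + 2 * pi) - Y u) 0"
      by (intro DERIV_isconst_all) blast
    then have "Y (t - v0 + 2 * pi) = Y (t - v0) + Y (2 * pi)" by (simp add: Y_def)
    moreover have "rad2 e (t - v0 + 2 * pi) = rad2 e (t - v0)" by (simp add: rad2_def)
    moreover have eq: "t + 2 * pi - v0 = t - v0 + 2 * pi" by simp
    ultimately show ?thesis unfolding \<beta>_def eq by (simp add: complex_eq_iff)
  qed
  obtain c1 where c1: "\<And>u. u \<in> {- v0<..<v0} \<Longrightarrow>
      Y u = contact u - sqrt (rad2 e u) * e * sin u / (2 * axial e u) + c1"
    using height_constant[OF bspec[OF arc1(1)] contact_arc1(3)] by blast
  have 4: "\<beta> t = roll \<gamma> (focus M) (contact (t - v0)) + complex_of_real c1" if "t \<in> {0<..<2 * v0}" for t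
  proof -
    have u: "t - v0 \<in> {- v0<..<v0}" using that by auto
    have "roll \<gamma> (focus M) (contact (t - v0)) = complex_of_real (contact (t - v0)) +
        Complex (- (sqrt (rad2 e (t - v0)) * e * sin (t - v0) / (2 * axial e (t - v0)))) (sqrt (rad2 e (t - v0)))"
      unfolding roll_def fM contact_arc1(1)[OF u] contact_arc1(2)[OF u] mult_1_left using roll_focus[OF e'(1,2) bspec[OF arc1(1) u]]
      by simp
    then show ?thesis by (simp add: \<beta>_def c1[OF u] complex_eq_iff)
  qed
  obtain c2 where c2: "\<And>u. u \<in> {v0<..<2 * pi - v0} \<Longrightarrow>
      Y u = contact u - sqrt (rad2 e u) * e * sin u / (2 * axial e u) + c2"
    using height_constant[OF bspec[OF arc2(1)] contact_arc2(3)] by blast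
  have 5: "\<beta> t = cnj (roll \<gamma> (- focus M) (contact (t - v0))) + complex_of_real c2" if "t \<in> {2 * v0<..<2 * pi}" for t
  proof -
    have u: "t - v0 \<in> {v0<..<2 * pi - v0}" using that by auto
    have "cnj (roll \<gamma> (- focus M) (contact (t - v0))) = complex_of_real (contact (t - v0)) +
        (complex_of_real (e / 2) - Complex (pre e (t - v0)) (pim e (t - v0))) *
          cnj (Complex (tre e (t - v0)) (tim e (t - v0)))"
      unfolding roll_def fM contact_arc2(1)[OF u] contact_arc2(2)[OF u]
      by (simp add: complex_eq_iff algebra_simps)
    also have "\<dots> = complex_of_real (contact (t - v0)) +
        Complex (- (sqrt (rad2 e (t - v0)) * e * sin (t - v0) / (2 * axial e (t - v0)))) (sqrt (rad2 e (t - v0)))"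
      unfolding roll_focus[OF e'(1,2) bspec[OF arc2(1) u]] ..
    finally show ?thesis by (simp add: \<beta>_def c2[OF u] complex_eq_iff)
  qed
  have 6: "continuous_on {0<..<2 * v0} (\<lambda>t. contact (t - v0))"
    "continuous_on {2 * v0<..<2 * pi} (\<lambda>t. contact (t - v0))"
    by (rule continuous_on_compose2[OF contact_arc1(4)] continuous_on_compose2[OF contact_arc2(4)];
        auto intro!: continuous_intros)+
  have 7: "bij_betw (\<lambda>t. contact (t - v0)) {0<..<2 * v0} UNIV"
    "bij_betw (\<lambda>t. contact (t - v0)) {2 * v0<..<2 * pi} UNIV"
    using bij_betw_shift[OF contact_arc1(5), of v0] bij_betw_shift[OF contact_arc2(5), of v0] by simp_all
  have 8: "0 < 2 * v0" "2 * v0 < 2 * pi" using v0 by auto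
  show ?thesis
    unfolding nodary_def mem_Collect_eq
    by (intro conjI allI ballI 1 2 exI[of _ \<gamma>] exI[of _ "2 * v0"] exI[of _ "2 * pi"] exI[of _ "Y (2 * pi)"]
        exI[of _ c1] exI[of _ c2] exI[of _ "\<lambda>t. contact (t - v0)"] arc_length_\<gamma> 3 4 5 6 7 8)
qed

lemma nodoid_parametrized: "parametrizes (family 0 e) (revolve ` nodary M)"
proof -
  define g where "g u = u + v0" for u
  have ig: "inv g = (\<lambda>t. t - v0)" by (rule inv_equality) (simp_all add: g_def)
  have "bij g" by (rule o_bij[of "\<lambda>t. t - v0"]) (auto simp: g_def fun_eq_iff)
  moreover have "C2_map g" unfolding g_def[abs_def] by (intro C2_map_add C2_map_ident C2_map_const)
  moreover have "C2_map (inv g)" unfolding ig by (intro C2_map_diff C2_map_ident C2_map_const)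
  moreover have "\<beta> (g u) = Complex (prim (height_slope 0 e) u + 0) (sqrt (rad2 e u))" for u
    by (simp add: \<beta>_def g_def Y_def)
  ultimately have "same_surface (revolve \<beta>) (family 0 e)"
    by (rule revolve_same_surface)
  with nodary show ?thesis unfolding parametrizes_def by blast
qed

end


section \<open>Twizzlers with different parameters are not congruent\<close>

subsection \<open>The distance from the axis\<close>

text \<open>Let \<open>\<rho>\<close> be the squared distance from the axis and \<open>g = sqrt (1 + w\<^sup>2 (\<rho> - M)\<^sup>2)\<close>.  The functions
  \<open>X = 1 - 2 (\<rho> - M)\<close> and \<open>Z = 2 g \<xi>\<^sub>1\<close> satisfy a linear system describing rotation with angular
  velocity \<open>2 / g\<close>, and rotating back gives constants.  The level equation alone would also allow \<open>\<rho>\<close>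
  to rest at an extremal value; this is where the mean curvature equation enters.\<close>

lemma twizzler_radius:
  assumes tw: "twizzler 1 w x z" and h: "\<And>s. h_fun w (xi1 x z s) (xi2 x z s) = (e\<^sup>2 - 1) / 4"
    and w: "w > 0" and e: "e \<ge> 0"
  obtains a where "bij a" "\<And>s. (x s)\<^sup>2 + (z s)\<^sup>2 = rad2 e (a s)"
proof -
  obtain x' z' x'' z'' where p: "profile x z x' z' x'' z''" using twizzler_imp_profile[OF tw] by blast
  interpret profile w x z x' z' x'' z'' by (rule p)
  define D where "D s = sqrt (1 + w\<^sup>2 * (xi1 x z s)\<^sup>2)" for s
  define P where "P s = (x s)\<^sup>2 + (z s)\<^sup>2 - (e\<^sup>2 - 1) / 4" for s
  define g where "g s = sqrt (1 + w\<^sup>2 * (P s)\<^sup>2)" for s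
  define \<xi> where "\<xi> = xi1 x z"
  have D: "D s > 0" "(D s)\<^sup>2 = 1 + w\<^sup>2 * (\<xi> s)\<^sup>2" for s
    by (simp_all add: D_def \<xi>_def add_pos_nonneg)
  have gpos: "1 + w\<^sup>2 * (P s)\<^sup>2 > 0" for s by (simp add: add_pos_nonneg)
  have g: "g s > 0" "(g s)\<^sup>2 = 1 + w\<^sup>2 * (P s)\<^sup>2" for s
    using gpos[of s] by (simp_all add: g_def)
  have x2: "xi2 x z s = - (P s * D s)" for s
    using h[of s] D(1)[of s] unfolding h_fun_def radius_xi[symmetric] D_def[symmetric] P_def
    by (simp add: field_simps)
  have gD: "(g s)\<^sup>2 * (D s)\<^sup>2 = 1 + w\<^sup>2 * ((x s)\<^sup>2 + (z s)\<^sup>2)" for s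
    unfolding radius_xi x2 \<xi>_def[symmetric] using D(2)[of s] g(2)[of s] by algebra
  have \<rho>: "(x s)\<^sup>2 + (z s)\<^sup>2 = P s + (e\<^sup>2 - 1) / 4" for s by (simp add: P_def)
  have energy: "(g s)\<^sup>2 * (\<xi> s)\<^sup>2 = P s + (e\<^sup>2 - 1) / 4 - (P s)\<^sup>2" for s
  proof -
    have "w\<^sup>2 * ((g s)\<^sup>2 * (\<xi> s)\<^sup>2) = w\<^sup>2 * (P s + (e\<^sup>2 - 1) / 4 - (P s)\<^sup>2)"
      using gD[of s] unfolding \<rho> D(2) by (simp add: g(2) algebra_simps)
    then show ?thesis using w by simp
  qed
  have cmc: "kappa s * (1 + w\<^sup>2 * ((x s)\<^sup>2 + (z s)\<^sup>2)) + w\<^sup>2 * xi2 x z s = 2 * D s ^ 3" for s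
    using tw constant_mean_curvature_iff[of 1] unfolding twizzler_def D_def by simp
  have curv: "(g s)\<^sup>2 * (1 + kappa s * xi2 x z s) = 1 - 2 * P s - 2 * w\<^sup>2 * P s * (\<xi> s)\<^sup>2" for s
  proof -
    have "D s * (kappa s * (g s)\<^sup>2 * D s) = D s * (2 * (D s)\<^sup>2 + w\<^sup>2 * P s)"
      using cmc[of s] unfolding gD[symmetric] x2 by (simp add: algebra_simps power2_eq_square power3_eq_cube)
    then have "kappa s * (g s)\<^sup>2 * D s = 2 * (D s)\<^sup>2 + w\<^sup>2 * P s" using D(1)[of s] by simp
    moreover have "(g s)\<^sup>2 * (1 + kappa s * xi2 x z s) = (g s)\<^sup>2 - P s * (kappa s * (g s)\<^sup>2 * D s)"
      unfolding x2 by (simp add: algebra_simps)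
    ultimately show ?thesis unfolding D(2) g(2) by (simp add: algebra_simps power2_eq_square)
  qed
  define X where "X s = 1 - 2 * P s" for s
  define Z where "Z s = 2 * (g s * \<xi> s)" for s
  have Pd: "(P has_real_derivative 2 * \<xi> s) (at s)" for s
  proof -
    have "((\<lambda>s. (x s)\<^sup>2 + (z s)\<^sup>2 - (e\<^sup>2 - 1) / 4) has_real_derivative 2 * \<xi> s - 0) (at s)"
      by (intro DERIV_diff radius_derivative[folded \<xi>_def] DERIV_const)
    then show ?thesis by (simp add: P_def[abs_def])
  qed
  have gd: "(g has_real_derivative 2 * w\<^sup>2 * P s * \<xi> s / g s) (at s)" for s
  proof -
    have "((\<lambda>s. sqrt (1 + w\<^sup>2 * (P s)\<^sup>2)) has_real_derivative
        (w\<^sup>2 * (2 * P s * (2 * \<xi> s))) * (inverse (g s) / 2)) (at s)"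
      using gpos[of s] by (auto intro!: derivative_eq_intros Pd simp: g_def)
    then have "(g has_real_derivative (w\<^sup>2 * (2 * P s * (2 * \<xi> s))) * (inverse (g s) / 2)) (at s)"
      unfolding g_def[abs_def, symmetric] .
    then show ?thesis by (rule DERIV_cong) (use g(1)[of s] in \<open>simp add: field_simps\<close>)
  qed
  have Xd: "(X has_real_derivative - (2 / g s) * Z s) (at s)" for s
    unfolding X_def[abs_def] Z_def using g(1)[of s] by (auto intro!: derivative_eq_intros Pd)
  have Zd: "(Z has_real_derivative (2 / g s) * X s) (at s)" for s
  proof -
    have "(Z has_real_derivative 2 * (2 * w\<^sup>2 * P s * \<xi> s / g s * \<xi> s + (1 + kappa s * xi2 x z s) * g s)) (at s)"
      unfolding Z_def[abs_def] by (intro DERIV_cmult DERIV_mult gd xi1_derivative[folded \<xi>_def])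
    moreover have "2 * (2 * w\<^sup>2 * P s * \<xi> s / g s * \<xi> s + (1 + kappa s * xi2 x z s) * g s)
        = (2 / g s) * (2 * w\<^sup>2 * P s * (\<xi> s)\<^sup>2 + (g s)\<^sup>2 * (1 + kappa s * xi2 x z s))"
      using g(1)[of s] by (simp add: field_simps power2_eq_square)
    ultimately show ?thesis unfolding curv by (simp add: X_def)
  qed
  have XZ: "(X s)\<^sup>2 + (Z s)\<^sup>2 = e\<^sup>2" for s
  proof -
    have "(X s)\<^sup>2 + (Z s)\<^sup>2 = (1 - 2 * P s)\<^sup>2 + 4 * ((g s)\<^sup>2 * (\<xi> s)\<^sup>2)"
      by (simp add: X_def Z_def power_mult_distrib)
    also have "\<dots> = e\<^sup>2" unfolding energy by (simp add: power2_eq_square field_simps)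
    finally show ?thesis .
  qed
  have cg: "continuous_on UNIV g" using gd by (meson DERIV_isCont continuous_at_imp_continuous_on)
  define u where "u = prim (\<lambda>s. 2 / g s)"
  have "g s \<noteq> 0" for s using g(1)[of s] by simp
  then have ud: "(u has_real_derivative 2 / g s) (at s)" for s
    unfolding u_def by (intro has_real_derivative_prim continuous_intros cg) simp
  define c where "c = 2 / sqrt (1 + w\<^sup>2 * ((1 + e) / 2)\<^sup>2)"
  have c: "c > 0" "c \<le> 2 / g s" for s
  proof -
    have pos: "1 + w\<^sup>2 * ((1 + e) / 2)\<^sup>2 > 0" by (simp add: add_pos_nonneg)
    then show "c > 0" by (simp add: c_def)
    have "(X s)\<^sup>2 \<le> e\<^sup>2" using XZ[of s] zero_le_power2[of "Z s"] by linarith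
    then have "\<bar>X s\<bar> \<le> e" using e by (simp add: abs_le_square_iff[symmetric])
    then have "\<bar>P s\<bar> \<le> \<bar>(1 + e) / 2\<bar>" using e by (auto simp: X_def)
    then have "(P s)\<^sup>2 \<le> ((1 + e) / 2)\<^sup>2" by (simp only: abs_le_square_iff)
    then have "g s \<le> sqrt (1 + w\<^sup>2 * ((1 + e) / 2)\<^sup>2)" unfolding g_def
      by (intro real_sqrt_le_mono add_left_mono mult_left_mono) auto
    then show "c \<le> 2 / g s" unfolding c_def
      by (intro divide_left_mono mult_pos_pos real_sqrt_gt_zero[OF pos] g(1)) auto
  qed
  have bij: "bij u" by (rule bij_and_inverse_of_derivative_bound(1)[OF ud c])
  (* the vector (X, Z) turned back by the angle u s *)
  define A where "A s = X s * cos (u s) + Z s * sin (u s)" for s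
  define B where "B s = Z s * cos (u s) - X s * sin (u s)" for s
  have "(A has_real_derivative 0) (at s)" "(B has_real_derivative 0) (at s)" for s
    unfolding A_def[abs_def] B_def[abs_def]
    by (auto intro!: derivative_eq_intros Xd Zd ud simp: algebra_simps)
  then have AB: "A s = A 0" "B s = B 0" for s by (intro DERIV_isconst_all; blast)+
  have XAB: "X s = A 0 * cos (u s) - B 0 * sin (u s)" for s
  proof -
    have "A s * cos (u s) - B s * sin (u s) = X s * ((sin (u s))\<^sup>2 + (cos (u s))\<^sup>2)"
      unfolding A_def B_def by algebra
    then show ?thesis using AB(1)[of s] AB(2)[of s] by simp
  qed
  obtain \<phi> where \<phi>: "A 0 = e * cos \<phi>" "B 0 = e * sin \<phi>"
  proof -
    have "(A 0)\<^sup>2 + (B 0)\<^sup>2 = ((X 0)\<^sup>2 + (Z 0)\<^sup>2) * ((sin (u 0))\<^sup>2 + (cos (u 0))\<^sup>2)"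
      unfolding A_def B_def by algebra
    then have ab: "(A 0)\<^sup>2 + (B 0)\<^sup>2 = e\<^sup>2" by (simp add: XZ)
    show thesis
    proof (cases "e = 0")
      case True
      then show ?thesis using ab that[of 0] by (simp add: sum_power2_eq_zero_iff)
    next
      case False
      then have "(A 0 / e)\<^sup>2 + (B 0 / e)\<^sup>2 = 1" using ab by (simp add: power_divide flip: add_divide_distrib)
      then obtain t where "A 0 / e = cos t" "B 0 / e = sin t" using sincos_total_2pi by metis
      then show ?thesis using False that[of t] by (simp add: field_simps)
    qed
  qed
  have "X s = e * cos (u s + \<phi>)" for s
    unfolding XAB \<phi> by (simp add: cos_add algebra_simps)
  then have "(x s)\<^sup>2 + (z s)\<^sup>2 = rad2 e (u s + \<phi>)" for s
    unfolding \<rho> rad2_def using X_def[of s] by (simp add: field_simps)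
  moreover have "bij (\<lambda>s. u s + \<phi>)"
    using bij_comp[OF bij bij_plus_right[of \<phi>]] by (simp add: o_def)
  ultimately show thesis by (rule that[rotated])
qed

lemma rad2_le: "e \<ge> 0 \<Longrightarrow> rad2 e u \<le> ((1 + e) / 2)\<^sup>2"
proof -
  assume "e \<ge> 0"
  then have "e * (- 1) \<le> e * cos u" by (intro mult_left_mono) auto
  then show ?thesis by (simp add: rad2_def power2_eq_square field_simps)
qed

lemma rad2_eq_max_iff: "e > 0 \<Longrightarrow> rad2 e u = ((1 + e) / 2)\<^sup>2 \<longleftrightarrow> cos u = - 1"
proof -
  assume e: "e > 0"
  have "rad2 e u = ((1 + e) / 2)\<^sup>2 \<longleftrightarrow> e * cos u = e * (- 1)"
    by (auto simp: rad2_def power2_eq_square field_simps)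
  also have "\<dots> \<longleftrightarrow> cos u = - 1" using e by (simp only: mult_cancel_left) auto
  finally show ?thesis .
qed

lemma countable_cos_minus_one: "countable {u :: real. cos u = - 1}"
proof -
  have "{u :: real. cos u = - 1} \<subseteq> (\<lambda>n :: int. (2 * of_int n + 1) * pi) ` UNIV"
    by (auto simp: cos_eq_minus1)
  then show ?thesis by (rule countable_subset) simp
qed

subsection \<open>Rigid motions between helicoidal surfaces\<close>

definition helix :: "real \<Rightarrow> real \<Rightarrow> real \<Rightarrow> real \<Rightarrow> real^3" where
  "helix r w b t = vector [r * cos (b - w * t), t, r * sin (b - w * t)]"

lemma matrix_vector_3: "((Q :: real^3^3) *v v) $ i = Q $ i $ 1 * v $ 1 + Q $ i $ 2 * v $ 2 + Q $ i $ 3 * v $ 3"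
  by (simp add: matrix_vector_mult_def sum_3)

lemma orthogonal_matrix_3:
  assumes "orthogonal_matrix (Q :: real^3^3)"
  shows "Q $ 1 $ i * Q $ 1 $ j + Q $ 2 $ i * Q $ 2 $ j + Q $ 3 $ i * Q $ 3 $ j = (if i = j then 1 else 0)"
    "Q $ i $ 1 * Q $ j $ 1 + Q $ i $ 2 * Q $ j $ 2 + Q $ i $ 3 * Q $ j $ 3 = (if i = j then 1 else 0)"
proof -
  have "(transpose Q ** Q) $ i $ j = mat 1 $ i $ j" "(Q ** transpose Q) $ i $ j = mat 1 $ i $ j"
    using assms by (simp_all add: orthogonal_matrix_def)
  then show "Q $ 1 $ i * Q $ 1 $ j + Q $ 2 $ i * Q $ 2 $ j + Q $ 3 $ i * Q $ 3 $ j = (if i = j then 1 else 0)"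
    "Q $ i $ 1 * Q $ j $ 1 + Q $ i $ 2 * Q $ j $ 2 + Q $ i $ 3 * Q $ j $ 3 = (if i = j then 1 else 0)"
    by (simp_all add: matrix_matrix_mult_def transpose_def sum_3 mat_def)
qed

lemma linear_bounded_imp_zero:
  fixes a K :: real
  assumes "\<And>t. \<bar>t * a\<bar> \<le> K" shows "a = 0"
proof (rule ccontr)
  assume "a \<noteq> 0"
  then show False using assms[of "(\<bar>K\<bar> + 1) / a"] by auto
qed

text \<open>An image of a helix is unbounded in the direction of its axis only, so if it stays in a cylinder
  about the second axis then \<open>Q\<close> preserves this direction.  Adding the squared distances of two
  points on opposite sides of the helix makes the terms linear in the displacement \<open>c\<close> cancel.\<close>

lemma rigid_motion_helix:
  assumes Q: "orthogonal_matrix Q" and r: "r \<ge> 0" and w: "w > 0"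
    and cyl: "\<And>t. ((Q *v helix r w b t + c) $ 1)\<^sup>2 + ((Q *v helix r w b t + c) $ 3)\<^sup>2 \<le> r'\<^sup>2"
  shows "Q $ 1 $ 2 = 0" "Q $ 3 $ 2 = 0" "Q $ 2 $ 1 = 0" "Q $ 2 $ 3 = 0" "(Q $ 2 $ 2)\<^sup>2 = 1"
    "r\<^sup>2 + (c $ 1)\<^sup>2 + (c $ 3)\<^sup>2 \<le> r'\<^sup>2"
proof -
  have comp: "(Q *v helix r w b t + c) $ i =
      Q $ i $ 1 * (r * cos (b - w * t)) + Q $ i $ 2 * t + Q $ i $ 3 * (r * sin (b - w * t)) + c $ i" for i t
    by (simp add: matrix_vector_3 helix_def)
  have zero: "Q $ i $ 2 = 0" if i: "i = 1 \<or> i = 3" for i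
  proof (rule linear_bounded_imp_zero)
    fix t
    have "((Q *v helix r w b t + c) $ i)\<^sup>2 \<le> r'\<^sup>2"
      using i
    proof (elim disjE)
      assume i1: "i = 1"
      show ?thesis unfolding i1 using cyl[of t] zero_le_power2[of "(Q *v helix r w b t + c) $ 3"] by linarith
    next
      assume i3: "i = 3"
      show ?thesis unfolding i3 using cyl[of t] zero_le_power2[of "(Q *v helix r w b t + c) $ 1"] by linarith
    qed
    then have 1: "\<bar>(Q *v helix r w b t + c) $ i\<bar> \<le> \<bar>r'\<bar>" by (simp add: abs_le_square_iff)
    have 2: "\<bar>Q $ i $ 1 * (r * cos (b - w * t))\<bar> \<le> \<bar>Q $ i $ 1\<bar> * (r * 1)"
      "\<bar>Q $ i $ 3 * (r * sin (b - w * t))\<bar> \<le> \<bar>Q $ i $ 3\<bar> * (r * 1)"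
      using r unfolding abs_mult by (intro mult_mono; simp)+
    show "\<bar>t * Q $ i $ 2\<bar> \<le> \<bar>r'\<bar> + \<bar>Q $ i $ 1\<bar> * (r * 1) + \<bar>Q $ i $ 3\<bar> * (r * 1) + \<bar>c $ i\<bar>"
      using 1 2 unfolding comp mult.commute[of t] by linarith
  qed
  show 1: "Q $ 1 $ 2 = 0" "Q $ 3 $ 2 = 0" using zero by auto
  show 2: "(Q $ 2 $ 2)\<^sup>2 = 1"
    using orthogonal_matrix_3(1)[OF Q, of 2 2] 1 by (simp add: power2_eq_square)
  have "(Q $ 2 $ 1)\<^sup>2 + (Q $ 2 $ 3)\<^sup>2 = 0"
    using orthogonal_matrix_3(2)[OF Q, of 2 2] 2 by (simp add: power2_eq_square)
  then show "Q $ 2 $ 1 = 0" "Q $ 2 $ 3 = 0" by (simp_all add: sum_power2_eq_zero_iff)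
  have cols: "Q $ 1 $ 1 * Q $ 1 $ 1 + Q $ 3 $ 1 * Q $ 3 $ 1 = 1"
    using orthogonal_matrix_3(1)[OF Q, of 1 1] \<open>Q $ 2 $ 1 = 0\<close> by simp
  have c0: "(Q *v helix r w b (b / w) + c) $ i = Q $ i $ 1 * r + c $ i" if "i = 1 \<or> i = 3" for i
    using zero[OF that] w unfolding comp by simp
  have c1: "(Q *v helix r w b ((b - pi) / w) + c) $ i = - (Q $ i $ 1 * r) + c $ i" if "i = 1 \<or> i = 3" for i
    using zero[OF that] w unfolding comp by simp
  have "(Q $ 1 $ 1 * r + c $ 1)\<^sup>2 + (Q $ 3 $ 1 * r + c $ 3)\<^sup>2 \<le> r'\<^sup>2"
    "(- (Q $ 1 $ 1 * r) + c $ 1)\<^sup>2 + (- (Q $ 3 $ 1 * r) + c $ 3)\<^sup>2 \<le> r'\<^sup>2"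
    using cyl[of "b / w"] cyl[of "(b - pi) / w"]
    unfolding c0[OF disjI1[OF refl]] c0[OF disjI2[OF refl]] c1[OF disjI1[OF refl]] c1[OF disjI2[OF refl]]
    by blast+
  then have "2 * (r\<^sup>2 * (Q $ 1 $ 1 * Q $ 1 $ 1 + Q $ 3 $ 1 * Q $ 3 $ 1)) + 2 * (c $ 1)\<^sup>2 + 2 * (c $ 3)\<^sup>2 \<le> 2 * r'\<^sup>2"
    by (simp add: power2_eq_square algebra_simps)
  then show "r\<^sup>2 + (c $ 1)\<^sup>2 + (c $ 3)\<^sup>2 \<le> r'\<^sup>2" unfolding cols by simp
qed

lemma same_surface_sym_range:
  assumes "same_surface \<phi> \<psi>"
  obtains Q c Q' c' where "orthogonal_matrix Q" "orthogonal_matrix Q'"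
    "\<And>p. p \<in> range \<phi> \<Longrightarrow> Q *v p + c \<in> range \<psi>" "\<And>p. p \<in> range \<psi> \<Longrightarrow> Q' *v p + c' \<in> range \<phi>"
proof -
  obtain Q c h where Q: "rotation_matrix Q" and h: "bij h" and \<psi>: "\<And>p. \<psi> p = Q *v \<phi> (h p) + c"
    using assms unfolding same_surface_def rigid_motion_def C2_diffeo_def by (auto simp: o_def)
  have o: "orthogonal_matrix Q" using Q by (simp add: rotation_matrix_def)
  have inv: "transpose Q *v (Q *v v) = v" for v
    using o by (simp add: matrix_vector_mul_assoc orthogonal_matrix)
  show thesis
  proof (rule that[OF o, of "transpose Q" c "- (transpose Q *v c)"])
    show "orthogonal_matrix (transpose Q)" using o by (simp add: orthogonal_matrix_transpose)
    show "Q *v p + c \<in> range \<psi>" if p: "p \<in> range \<phi>" for p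
    proof -
      obtain y where y: "p = \<phi> y" using p by blast
      have "\<psi> (inv h y) = Q *v p + c" unfolding \<psi> y using h by (simp add: bij_is_surj surj_f_inv_f)
      then show ?thesis by (metis rangeI)
    qed
    show "transpose Q *v p + - (transpose Q *v c) \<in> range \<phi>" if p: "p \<in> range \<psi>" for p
    proof -
      obtain y where y: "p = \<psi> y" using p by blast
      have "transpose Q *v p + - (transpose Q *v c) = \<phi> (h y)"
        unfolding y \<psi> matrix_vector_right_distrib inv by simp
      then show ?thesis by (metis rangeI)
    qed
  qed
qed

lemma twizzler_map_range_cylinder:
  assumes "\<And>s. (x s)\<^sup>2 + (z s)\<^sup>2 \<le> r\<^sup>2" "p \<in> range (twizzler_map w x z)"
  shows "(p $ 1)\<^sup>2 + (p $ 3)\<^sup>2 \<le> r\<^sup>2"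
proof -
  obtain s t where p: "p = twizzler_map w x z (s, t)" using assms(2) by auto
  have "(p $ 1)\<^sup>2 + (p $ 3)\<^sup>2 = ((x s)\<^sup>2 + (z s)\<^sup>2) * ((sin (w * t))\<^sup>2 + (cos (w * t))\<^sup>2)"
    unfolding p twizzler_map_def by (simp only: prod.case vector_3) algebra
  then show ?thesis using assms(1)[of s] by simp
qed

lemma twizzler_map_polar:
  "x s = r * cos b \<Longrightarrow> z s = r * sin b \<Longrightarrow> twizzler_map w x z (s, t) = helix r w b t"
  using polar_twizzler_map[of w "\<lambda>_. r" "\<lambda>_. b" s t]
  by (simp add: twizzler_map_def helix_def)

lemma polar_exists: "r > 0 \<Longrightarrow> (a :: real)\<^sup>2 + b\<^sup>2 = r\<^sup>2 \<Longrightarrow> \<exists>t. a = r * cos t \<and> b = r * sin t"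
proof -
  assume r: "r > 0" and ab: "a\<^sup>2 + b\<^sup>2 = r\<^sup>2"
  then have "(a / r)\<^sup>2 + (b / r)\<^sup>2 = 1" by (simp add: power_divide flip: add_divide_distrib)
  then obtain t where "a / r = cos t" "b / r = sin t" using sincos_total_2pi by metis
  then show ?thesis using r by (intro exI[of _ t]) (simp add: field_simps)
qed

text \<open>A rigid motion preserving the axis takes a helix to a helix whose pitch is the same up to sign.
  Two helices of different pitch on a cylinder meet in countably many points, so countably many of
  them cannot cover a third one.\<close>

lemma helix_pitch_unique:
  assumes Q: "orthogonal_matrix Q" and Q0: "Q $ 1 $ 2 = 0" "Q $ 3 $ 2 = 0" "Q $ 2 $ 1 = 0" "Q $ 2 $ 3 = 0" "(Q $ 2 $ 2)\<^sup>2 = 1"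
    and c0: "c $ 1 = 0" "c $ 3 = 0" and r: "r > 0" and w: "w > 0" "w' > 0" and N: "countable N"
    and cover: "\<And>t. \<exists>b'\<in>N. \<exists>t'. Q *v helix r w b t + c = helix r w' b' t'"
  shows "w = w'"
proof (rule ccontr)
  assume ne: "w \<noteq> w'"
  have o: "(Q $ 1 $ 1)\<^sup>2 + (Q $ 3 $ 1)\<^sup>2 = 1" "(Q $ 1 $ 3)\<^sup>2 + (Q $ 3 $ 3)\<^sup>2 = 1"
    "Q $ 1 $ 1 * Q $ 1 $ 3 + Q $ 3 $ 1 * Q $ 3 $ 3 = 0"
    using orthogonal_matrix_3(1)[OF Q, of 1 1] orthogonal_matrix_3(1)[OF Q, of 3 3]
      orthogonal_matrix_3(1)[OF Q, of 1 3] Q0 by (simp_all add: power2_eq_square)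
  obtain \<gamma> where \<gamma>: "Q $ 1 $ 1 = cos \<gamma>" "Q $ 3 $ 1 = sin \<gamma>"
    using o(1) sincos_total_2pi by metis
  define \<delta> where "\<delta> = Q $ 1 $ 1 * Q $ 3 $ 3 - Q $ 3 $ 1 * Q $ 1 $ 3"
  have \<delta>: "\<delta>\<^sup>2 = 1" "Q $ 1 $ 3 = - \<delta> * Q $ 3 $ 1" "Q $ 3 $ 3 = \<delta> * Q $ 1 $ 1"
    using o unfolding \<delta>_def by algebra+
  define \<epsilon> where "\<epsilon> = Q $ 2 $ 2"
  have \<epsilon>: "\<epsilon>\<^sup>2 = 1" using Q0 by (simp add: \<epsilon>_def)
  have \<delta>\<epsilon>: "\<delta> = 1 \<or> \<delta> = - 1" "\<epsilon> = 1 \<or> \<epsilon> = - 1"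
    using \<delta>(1) \<epsilon> by (simp_all add: power2_eq_1_iff)
  define m where "m = w' * \<epsilon> - \<delta> * w"
  have m: "m \<noteq> 0" using \<delta>\<epsilon> w ne by (auto simp: m_def)
  define C where "C = (\<lambda>(b', n :: int). (b' - w' * c $ 2 + 2 * of_int n * pi - \<gamma> - \<delta> * b) / m)"
  have "t \<in> C ` (N \<times> UNIV)" for t
  proof -
    obtain b' t' where b': "b' \<in> N" and eq: "Q *v helix r w b t + c = helix r w' b' t'"
      using cover[of t] by blast
    have "(Q *v helix r w b t + c) $ i = helix r w' b' t' $ i" for i by (simp add: eq)
    from this[of 1] this[of 2] this[of 3]
    have "r * cos (\<gamma> + \<delta> * (b - w * t)) = r * cos (b' - w' * t')" "\<epsilon> * t + c $ 2 = t'"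
      "r * sin (\<gamma> + \<delta> * (b - w * t)) = r * sin (b' - w' * t')"
      using \<delta>\<epsilon>(1) unfolding matrix_vector_3 vector_add_component Q0 c0 \<delta>(2,3) \<gamma> \<epsilon>_def[symmetric]
      by (auto simp: helix_def cos_add sin_add cos_diff sin_diff algebra_simps)
    then have "cos (b' - w' * (\<epsilon> * t + c $ 2)) = cos (\<gamma> + \<delta> * (b - w * t))"
      "sin (b' - w' * (\<epsilon> * t + c $ 2)) = sin (\<gamma> + \<delta> * (b - w * t))"
      using r by auto
    then obtain n :: int where "\<gamma> + \<delta> * (b - w * t) = b' - w' * (\<epsilon> * t + c $ 2) + 2 * pi * of_int n"
      using sin_cos_eq_iff[of "\<gamma> + \<delta> * (b - w * t)" "b' - w' * (\<epsilon> * t + c $ 2)"] by auto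
    then have "m * t = b' - w' * c $ 2 + 2 * of_int n * pi - \<gamma> - \<delta> * b"
      by (simp add: m_def algebra_simps)
    then have "t = C (b', n)" using m by (simp add: C_def field_simps)
    then show ?thesis using b' by blast
  qed
  then have "UNIV = C ` (N \<times> UNIV)" by blast
  moreover have "countable (C ` (N \<times> UNIV))" using N by (intro countable_image countable_SIGMA) auto
  ultimately show False using uncountable_UNIV_real by simp
qed

text \<open>The largest distance from the axis is \<open>(1 + e) / 2\<close>, and it is assumed along countably many helices.
  Hence a congruence, which carries the axis to the axis, preserves \<open>e\<close> and then the pitch of these
  helices.\<close>

lemma twizzler_congruent_imp_eq:
  assumes tw: "twizzler 1 w x z" "\<And>s. h_fun w (xi1 x z s) (xi2 x z s) = (e\<^sup>2 - 1) / 4" "w > 0" "e > 0"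
    and tw': "twizzler 1 w' x' z'" "\<And>s. h_fun w' (xi1 x' z' s) (xi2 x' z' s) = (e'\<^sup>2 - 1) / 4" "w' > 0" "e' > 0"
    and same: "same_surface (twizzler_map w x z) (twizzler_map w' x' z')"
  shows "e = e' \<and> w = w'"
proof -
  have e: "e \<ge> 0" "e' \<ge> 0" using tw tw' by auto
  obtain a where a: "bij a" "\<And>s. (x s)\<^sup>2 + (z s)\<^sup>2 = rad2 e (a s)"
    using twizzler_radius[OF tw(1-3) e(1)] by blast
  obtain a' where a': "bij a'" "\<And>s. (x' s)\<^sup>2 + (z' s)\<^sup>2 = rad2 e' (a' s)"
    using twizzler_radius[OF tw'(1-3) e(2)] by blast
  define r where "r = (1 + e) / 2"
  define r' where "r' = (1 + e') / 2"
  have r: "r > 0" "r' > 0" using e by (auto simp: r_def r'_def)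
  obtain s0 where s0: "a s0 = pi" using a(1) by (metis bij_pointE)
  obtain s0' where s0': "a' s0' = pi" using a'(1) by (metis bij_pointE)
  have "(x s0)\<^sup>2 + (z s0)\<^sup>2 = r\<^sup>2" "(x' s0')\<^sup>2 + (z' s0')\<^sup>2 = r'\<^sup>2"
    unfolding a(2) a'(2) r_def r'_def using rad2_eq_max_iff tw(4) tw'(4) s0 s0' by auto
  then obtain b b' where b: "x s0 = r * cos b" "z s0 = r * sin b" and b': "x' s0' = r' * cos b'" "z' s0' = r' * sin b'"
    using polar_exists r by metis
  have hel: "helix r w b t \<in> range (twizzler_map w x z)" "helix r' w' b' t \<in> range (twizzler_map w' x' z')" for t
    using twizzler_map_polar[of x s0 r b z w t, OF b] twizzler_map_polar[of x' s0' r' b' z' w' t, OF b']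
    by (metis rangeI)+
  have cyl: "(p $ 1)\<^sup>2 + (p $ 3)\<^sup>2 \<le> r\<^sup>2" if "p \<in> range (twizzler_map w x z)" for p
    using twizzler_map_range_cylinder[OF _ that] rad2_le[OF e(1)] by (simp add: a(2) r_def)
  have cyl': "(p $ 1)\<^sup>2 + (p $ 3)\<^sup>2 \<le> r'\<^sup>2" if "p \<in> range (twizzler_map w' x' z')" for p
    using twizzler_map_range_cylinder[OF _ that] rad2_le[OF e(2)] by (simp add: a'(2) r'_def)
  obtain Q c Q' c' where Q: "orthogonal_matrix Q" "orthogonal_matrix Q'"
    "\<And>p. p \<in> range (twizzler_map w x z) \<Longrightarrow> Q *v p + c \<in> range (twizzler_map w' x' z')"
    "\<And>p. p \<in> range (twizzler_map w' x' z') \<Longrightarrow> Q' *v p + c' \<in> range (twizzler_map w x z)"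
    by (rule same_surface_sym_range[OF same]) (rule that)
  note R = rigid_motion_helix[OF Q(1) less_imp_le[OF r(1)] tw(3) cyl'[OF Q(3)[OF hel(1)]]]
  note R' = rigid_motion_helix[OF Q(2) less_imp_le[OF r(2)] tw'(3) cyl[OF Q(4)[OF hel(2)]]]
  have "r\<^sup>2 \<le> r'\<^sup>2" "r'\<^sup>2 \<le> r\<^sup>2"
    using R(6) R'(6) zero_le_power2[of "c $ 1"] zero_le_power2[of "c $ 3"]
      zero_le_power2[of "c' $ 1"] zero_le_power2[of "c' $ 3"] by linarith+
  then have rr: "r = r'" using r by (simp add: power2_eq_iff_nonneg)
  then have ee: "e = e'" by (simp add: r_def r'_def)
  have "(c $ 1)\<^sup>2 + (c $ 3)\<^sup>2 \<le> 0" using R(6) rr by simp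
  then have c0: "c $ 1 = 0" "c $ 3 = 0" by (simp_all add: sum_power2_le_zero_iff)
  (* a polar angle of the profile curve; only parameters of maximal distance r matter *)
  define f where "f s = (SOME b. x' s = r * cos b \<and> z' s = r * sin b)" for s
  define N where "N = f ` {s. cos (a' s) = - 1}"
  have "countable {s. cos (a' s) = - 1}"
  proof (rule countable_image_inj_on)
    show "countable (a' ` {s. cos (a' s) = - 1})"
      by (rule countable_subset[OF _ countable_cos_minus_one]) auto
    show "inj_on a' {s. cos (a' s) = - 1}"
      using bij_is_inj[OF a'(1)] by (rule inj_on_subset) simp
  qed
  then have N: "countable N" unfolding N_def by (rule countable_image)
  have "w = w'"
  proof (rule helix_pitch_unique[OF Q(1) R(1-5) c0 r(1) tw(3) tw'(3) N])
    fix t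
    define p where "p = Q *v helix r w b t + c"
    have "p \<in> range (twizzler_map w' x' z')" unfolding p_def by (rule Q(3)[OF hel(1)])
    then obtain s' t' where p': "p = twizzler_map w' x' z' (s', t')" by auto
    have "(p $ 1)\<^sup>2 + (p $ 3)\<^sup>2 = r\<^sup>2"
    proof -
      have o: "(Q $ 1 $ 1)\<^sup>2 + (Q $ 3 $ 1)\<^sup>2 = 1" "(Q $ 1 $ 3)\<^sup>2 + (Q $ 3 $ 3)\<^sup>2 = 1"
        "Q $ 1 $ 1 * Q $ 1 $ 3 + Q $ 3 $ 1 * Q $ 3 $ 3 = 0"
        using orthogonal_matrix_3(1)[OF Q(1), of 1 1] orthogonal_matrix_3(1)[OF Q(1), of 3 3]
          orthogonal_matrix_3(1)[OF Q(1), of 1 3] R by (simp_all add: power2_eq_square)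
      have "p $ i = Q $ i $ 1 * (r * cos (b - w * t)) + Q $ i $ 3 * (r * sin (b - w * t))" if "i = 1 \<or> i = 3" for i
        using that R c0 by (auto simp: p_def matrix_vector_3 helix_def)
      then have "(p $ 1)\<^sup>2 + (p $ 3)\<^sup>2 =
          (Q $ 1 $ 1 * (r * cos (b - w * t)) + Q $ 1 $ 3 * (r * sin (b - w * t)))\<^sup>2
          + (Q $ 3 $ 1 * (r * cos (b - w * t)) + Q $ 3 $ 3 * (r * sin (b - w * t)))\<^sup>2" by simp
      also have "\<dots> = r\<^sup>2 * ((sin (b - w * t))\<^sup>2 + (cos (b - w * t))\<^sup>2)"
        using o by algebra
      finally show ?thesis by simp
    qed
    moreover have "(p $ 1)\<^sup>2 + (p $ 3)\<^sup>2 = (x' s')\<^sup>2 + (z' s')\<^sup>2"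
    proof -
      have "(p $ 1)\<^sup>2 + (p $ 3)\<^sup>2 = ((x' s')\<^sup>2 + (z' s')\<^sup>2) * ((sin (w' * t'))\<^sup>2 + (cos (w' * t'))\<^sup>2)"
        unfolding p' twizzler_map_def by (simp only: prod.case vector_3) algebra
      then show ?thesis by simp
    qed
    ultimately have rho': "(x' s')\<^sup>2 + (z' s')\<^sup>2 = r\<^sup>2" by simp
    then have "cos (a' s') = - 1"
      using rad2_eq_max_iff[OF tw'(4)] by (simp add: a'(2) rr r'_def)
    then have "f s' \<in> N" by (simp add: N_def)
    moreover have "x' s' = r * cos (f s') \<and> z' s' = r * sin (f s')"
      unfolding f_def by (rule someI_ex) (rule polar_exists[OF r(1) rho'])
    then have "p = helix r w' (f s') t'"
      unfolding p' by (intro twizzler_map_polar) auto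
    ultimately show "\<exists>b'\<in>N. \<exists>t'. Q *v helix r w b t + c = helix r w' b' t'"
      unfolding p_def by blast
  qed
  with ee show ?thesis by simp
qed


section \<open>Continuity and injectivity\<close>

text \<open>The value \<open>1 / w\<close>; at \<open>v = 0\<close>, where \<open>w\<close> becomes infinite, it extends continuously by \<open>0\<close>.\<close>

definition pitch :: "real \<Rightarrow> real" where "pitch v = sqrt (v / (1 - v))"

lemma ecc_squared: "- 1 / 4 \<le> M \<Longrightarrow> (ecc M)\<^sup>2 = 1 + 4 * M"
  by (simp add: ecc_def)

lemma rho_parametrized:
  assumes "q \<in> Omega"
  shows "parametrizes (family (pitch (Im q)) (ecc (Re q))) (rho q)"
proof -
  define M where "M = Re q"
  define v where "v = Im q"
  define e where "e = ecc M"
  have M: "- 1 / 4 \<le> M" "M \<noteq> 0" and v: "0 \<le> v" "v < 1"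
    using assms by (auto simp: Omega_def M_def v_def)
  have e2: "e\<^sup>2 = 1 + 4 * M" using M by (simp add: e_def ecc_squared)
  have eM: "(e\<^sup>2 - 1) / 4 = M" by (simp add: e2)
  have e: "e \<ge> 0" "e \<noteq> 1" using M e2 by (auto simp: e_def ecc_def)
  consider "M = - 1 / 4" | "M \<noteq> - 1 / 4" "0 < v" | "M \<noteq> - 1 / 4" "v = 0" "M < 0" | "v = 0" "M > 0"
    using v M by linarith
  then have "parametrizes (family (pitch v) e) (rho q)"
  proof cases
    case 1
    then have "e = 0" by (simp add: e_def ecc_def)
    then show ?thesis using 1 cylinder_parametrized by (simp add: rho_def M_def)
  next
    case 2
    define w where "w = sqrt ((1 - v) / v)"
    have w: "w > 0" using 2 v by (simp add: w_def)
    have pw: "pitch v = 1 / w" by (simp add: pitch_def w_def real_sqrt_divide)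
    obtain x z h where t: "twizzler 1 w x z" "\<And>s. h_fun w (xi1 x z s) (xi2 x z s) = (e\<^sup>2 - 1) / 4"
      "C2_diffeo h" "family (1 / w) e = twizzler_map w x z \<circ> h"
      by (rule twizzler_exists[OF w e]) (rule that)
    have "twizzler_map w x z \<in> twizzler_surface M v"
      unfolding twizzler_surface_def Let_def w_def[symmetric] using t(1,2) eM by auto
    moreover have "rho q = twizzler_surface M v" using 2 by (simp add: rho_def M_def v_def)
    ultimately show ?thesis
      unfolding parametrizes_def pw using same_surface_reparametrization[OF t(3,4)] by blast
  next
    case 3
    have "e > 0" "e < 1"
      using 3 M by (auto simp: e_def ecc_def)
    then obtain \<gamma> where g: "arc_length_param \<gamma> (conic M)"
      "same_surface (revolve (roll \<gamma> (complex_of_real (e / 2)))) (family 0 e)"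
      using unduloid_parametrized[of e M] eM by auto
    have "1 / 4 + M = (e / 2)\<^sup>2" by (simp add: power_divide e2)
    then have foc: "focus M = complex_of_real (e / 2)" using e by (simp add: focus_def)
    have "roll \<gamma> (complex_of_real (e / 2)) \<in> undulary M"
      unfolding undulary_def foc using g(1) by blast
    moreover have "rho q = revolve ` undulary M" using 3 by (simp add: rho_def M_def v_def delaunay_surface_def)
    moreover have "pitch v = 0" using 3 by (simp add: pitch_def)
    ultimately show ?thesis using g(2) unfolding parametrizes_def by auto
  next
    case 4
    have "e > 1" using 4 by (simp add: e_def ecc_def)
    then have hyp: "hyperbola e" by (rule hyperbola.intro)
    have "hyperbola.M e = M" by (simp add: hyperbola.M_def[OF hyp] eM)
    moreover have "rho q = revolve ` nodary M" using 4 by (simp add: rho_def M_def v_def delaunay_surface_def)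
    moreover have "pitch v = 0" using 4 by (simp add: pitch_def)
    ultimately show ?thesis using hyperbola.nodoid_parametrized[OF hyp] by simp
  qed
  then show ?thesis by (simp add: M_def v_def e_def)
qed

lemma interior_Omega:
  assumes "p \<in> interior Omega" shows "- 1 / 4 < Re p" "0 < Im p" "Im p < 1"
proof -
  obtain d where d: "d > 0" "ball p d \<subseteq> Omega" using assms by (auto simp: mem_interior)
  have "p - complex_of_real (d / 2) \<in> Omega" "p - \<i> * complex_of_real (d / 2) \<in> Omega" "p \<in> Omega"
    using d by (auto intro!: subsetD[OF d(2)] simp: dist_norm norm_mult)
  then show "- 1 / 4 < Re p" "0 < Im p" "Im p < 1" using d(1) by (auto simp: Omega_def)
qed

lemma twizzler_surface_disjoint:
  assumes M: "- 1 / 4 < M" "- 1 / 4 < M'" and v: "0 < v" "v < 1" "0 < v'" "v' < 1"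
    and \<phi>: "\<phi> \<in> twizzler_surface M v" and \<psi>: "\<psi> \<in> twizzler_surface M' v'" and same: "same_surface \<phi> \<psi>"
  shows "M = M' \<and> v = v'"
proof -
  define w where "w = sqrt ((1 - v) / v)"
  define w' where "w' = sqrt ((1 - v') / v')"
  have w: "w > 0" "w' > 0" using v by (simp_all add: w_def w'_def)
  have e: "ecc M > 0" "ecc M' > 0" using M by (simp_all add: ecc_def)
  have eM: "((ecc M)\<^sup>2 - 1) / 4 = M" "((ecc M')\<^sup>2 - 1) / 4 = M'" using M by (simp_all add: ecc_squared)
  obtain x z where t: "\<phi> = twizzler_map w x z" "twizzler 1 w x z"
    "\<And>s. h_fun w (xi1 x z s) (xi2 x z s) = ((ecc M)\<^sup>2 - 1) / 4"
    using \<phi> unfolding twizzler_surface_def Let_def w_def eM by auto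
  obtain x' z' where t': "\<psi> = twizzler_map w' x' z'" "twizzler 1 w' x' z'"
    "\<And>s. h_fun w' (xi1 x' z' s) (xi2 x' z' s) = ((ecc M')\<^sup>2 - 1) / 4"
    using \<psi> unfolding twizzler_surface_def Let_def w'_def eM by auto
  have "ecc M = ecc M'" "w = w'"
    using twizzler_congruent_imp_eq[OF t(2,3) w(1) e(1) t'(2,3) w(2) e(2) same[unfolded t(1) t'(1)]] by auto
  then have "M = M'" "(1 - v) / v = (1 - v') / v'" by (simp_all add: ecc_def w_def w'_def)
  then show ?thesis using v by (simp add: field_simps)
qed

theorem theorem1p13:
  shows "(\<forall>p\<in>Omega. \<exists>U f. openin (top_of_set Omega) U \<and> p \<in> U \<and>
            continuous_on (U \<times> UNIV) (f :: complex \<times> real \<times> real \<Rightarrow> real^3) \<and>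
            (\<forall>q\<in>U. parametrizes (\<lambda>(s, t). f (q, s, t)) (rho q))) \<and>
         (\<forall>p\<in>interior Omega. \<forall>q\<in>interior Omega. p \<noteq> q \<longrightarrow>
            (\<forall>\<phi>\<in>rho p. \<forall>\<psi>\<in>rho q. \<not> same_surface \<phi> \<psi>))"
proof (intro conjI ballI impI notI)
  fix p assume p: "p \<in> Omega"
  define f where "f = (\<lambda>(q, s, t). family (pitch (Im q)) (ecc (Re q)) (s, t))"
  have "continuous_on Omega (\<lambda>q. pitch (Im q))" "continuous_on Omega (\<lambda>q. ecc (Re q))"
    unfolding pitch_def ecc_def by (auto intro!: continuous_intros simp: Omega_def)
  moreover have "ecc (Re q) \<ge> 0 \<and> ecc (Re q) \<noteq> 1" if "q \<in> Omega" for q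
    using that by (auto simp: Omega_def ecc_def)
  ultimately have "continuous_on (Omega \<times> UNIV) f"
    unfolding f_def by (rule continuous_on_family)
  moreover have "parametrizes (\<lambda>(s, t). f (q, s, t)) (rho q)" if "q \<in> Omega" for q
    using rho_parametrized[OF that] by (simp add: f_def)
  ultimately show "\<exists>U f. openin (top_of_set Omega) U \<and> p \<in> U \<and>
            continuous_on (U \<times> UNIV) (f :: complex \<times> real \<times> real \<Rightarrow> real^3) \<and>
            (\<forall>q\<in>U. parametrizes (\<lambda>(s, t). f (q, s, t)) (rho q))"
    using p by (intro exI[of _ Omega] exI[of _ f]) simp
next
  fix p q \<phi> \<psi>
  assume p: "p \<in> interior Omega" and q: "q \<in> interior Omega" and ne: "p \<noteq> q"
    and \<phi>: "\<phi> \<in> rho p" and \<psi>: "\<psi> \<in> rho q" and same: "same_surface \<phi> \<psi>"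
  note P = interior_Omega[OF p] and Q = interior_Omega[OF q]
  have "\<phi> \<in> twizzler_surface (Re p) (Im p)" "\<psi> \<in> twizzler_surface (Re q) (Im q)"
    using P Q \<phi> \<psi> by (simp_all add: rho_def)
  from twizzler_surface_disjoint[OF P(1) Q(1) P(2,3) Q(2,3) this same] ne
  show False by (simp add: complex_eq_iff)
qed

end
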